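(* Let $q\ge1$ be an integer, $H\in(\frac12,1)$, and let $\{Z_t^{q,H},0\le t\le 1\}$ be the Hermite process of order $q$ with self-similarity parameter $H$. Let $\Theta\subset\mathbb R$, let $\theta_0\in\Theta$ be the true parameter, and let $x_0\in\mathbb R$ be the known initial value. For each $\varepsilon>0$ let $X=\{X_t,0\le t\le1\}$ be the continuous solution of $$X_t=x_0+\theta_0\int_0^tX_s\,ds+\varepsilon Z_t^{q,H},\qquad 0\le t\le 1,$$ and let $\hat\theta_\varepsilon$ be a minimum $L_1$-norm estimator, i.e. a $\Theta$-valued random variable with $$\int_0^1|X_t-x_0e^{\hat\theta_\varepsilon t}|\,dt=\inf_{\theta\in\Theta}\int_0^1|X_t-x_0e^{\theta t}|\,dt .$$ Let $$Y_t=e^{\theta_0t}\int_0^te^{-\theta_0s}\,dZ_s^{q,H},\quad 0\le t\le1,\qquad \zeta=\arg\inf_{-\infty<u<\infty}\int_0^1\big|Y_t-u\,t\,x_0e^{\theta_0t}\big|\,dt .$$ Then, as $\varepsilon\to0$, the random variable $\varepsilon^{-1}(\hat\theta_\varepsilon-\theta_0)$ converges in probability to a random variable whose probability distribution is the same as that of $\zeta$.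
   Context: Hermite process. Let $W=\{W(h),h\in L^2(\mathbb R)\}$ be a centered Gaussian family on a probability space with $E[W(h)W(g)]=\langle h,g\rangle_{L^2(\mathbb R)}$. For a symmetric $f\in L^2(\mathbb R^q)$, $\int_{\mathbb R^q} f(\psi_1,\dots,\psi_q)\,dW_{\psi_1}\cdots dW_{\psi_q}$ denotes the multiple Wiener integral of order $q$ with respect to $W$. The Hermite process of order $q\ge1$ and self-similarity parameter $H\in(\frac12,1)$ is $$Z_t^{q,H}=c(q,H)\int_{\mathbb R^q}\Big(\int_0^t\prod_{j=1}^q (s-\psi_j)_+^{H_0-\frac32}\,ds\Big)dW_{\psi_1}\cdots dW_{\psi_q},\qquad t\ge 0,$$ where $H_0=1+\frac{H-1}{q}$, $c(q,H)=\sqrt{\dfrac{H(2H-1)}{q!\,\big(\beta(H_0-\frac12,\,2-2H_0)\big)^q}}$, and $\beta(\cdot,\cdot)$ is the Beta function. A version with continuous sample paths is used. Wiener integral. For a non-random $f$ with $\int_{\mathbb R}\int_{\mathbb R}|f(u)f(v)||u-v|^{2H-2}\,du\,dv<\infty$, the Wiener integral with respect to $Z^{q,H}$ is $$\int_{\mathbb R} f(u)\,dZ_u^{q,H}=c(q,H)\int_{\mathbb R^q}\Big(\int_{\mathbb R} f(u)\prod_{j=1}^q(u-\psi_j)_+^{H_0-\frac32}\,du\Big)dW_{\psi_1}\cdots dW_{\psi_q},$$ and $\int_0^t f(s)\,dZ_s^{q,H}$ means the integral of $f\mathbf 1_{[0,t]}$. The process $Y$ satisfies $X_t-x_0e^{\theta_0t}=\varepsilon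 Y_t$. The function $x_t(\theta)=x_0e^{\theta t}$ solves the noiseless equation $dx_t/dt=\theta x_t$ with value $x_0$ at $t=0$; it is taken as given that $\inf_{|\theta-\theta_0|>\delta}\int_0^1|x_t(\theta)-x_t(\theta_0)|\,dt>0$ for any $\delta>0$. It is assumed that a measurable selection $\hat\theta_\varepsilon$ attaining the infimum exists. Here $\arg\inf$ denotes the minimizer over $u\in\mathbb R$.
   Formalization: The true parameter θ0 is assumed to lie in the interior of Θ rather than merely in Θ; for Θ={θ0} (with q=1, x0≠0) the estimator is constantly θ0, so the limit is 0, while ζ is non-degenerate, and the claim as stated fails. *)

theory Defs
  imports "HOL-Probability.Probability"
begin

definition L2 :: "'a measure \<Rightarrow> ('a \<Rightarrow> real) set" where
  "L2 M = {f \<in> borel_measurable M. integrable M (\<lambda>x. (f x)\<^sup>2)}"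

text \<open>Convergence in the mean square sense; the extended nonnegative integral is used so
  that a difference that is not square integrable counts as being at distance infinity.\<close>

definition L2_converges :: "'a measure \<Rightarrow> (nat \<Rightarrow> 'a \<Rightarrow> real) \<Rightarrow> ('a \<Rightarrow> real) \<Rightarrow> bool" where
  "L2_converges M F f \<longleftrightarrow>
     (\<lambda>n. \<integral>\<^sup>+ x. ennreal ((F n x - f x)\<^sup>2) \<partial>M) \<longlonglongrightarrow> 0"

text \<open>The degenerate law at zero is included, as usual for Gaussian families.\<close>

definition centered_gaussian :: "'a measure \<Rightarrow> ('a \<Rightarrow> real) \<Rightarrow> bool" where
  "centered_gaussian M X \<longleftrightarrow> X \<in> borel_measurable M \<and>
     ((AE \<omega> in M. X \<omega> = 0) \<or>
      (\<exists>\<sigma>>0. distributed M lborel X (\<lambda>x. ennreal (normal_density 0 \<sigma> x))))"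

text \<open>The family is indexed by square integrable functions rather than by their almost
  everywhere classes; the covariance forces \<open>W h = W g\<close> almost surely whenever
  \<open>h = g\<close> almost everywhere.\<close>

definition isonormal :: "'a measure \<Rightarrow> ((real \<Rightarrow> real) \<Rightarrow> 'a \<Rightarrow> real) \<Rightarrow> bool" where
  "isonormal M W \<longleftrightarrow>
     (\<forall>n (h :: nat \<Rightarrow> real \<Rightarrow> real) (a :: nat \<Rightarrow> real). (\<forall>i<n. h i \<in> L2 lborel) \<longrightarrow>
        centered_gaussian M (\<lambda>\<omega>. \<Sum>i<n. a i * W (h i) \<omega>)) \<and>
     (\<forall>h \<in> L2 lborel. \<forall>g \<in> L2 lborel.
        (\<integral>\<omega>. W h \<omega> * W g \<omega> \<partial>M) = (\<integral>x. h x * g x \<partial>lborel))"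

text \<open>Multiple Wiener integrals in the sense of Ito. A point of \<open>q\<close>-dimensional space is a
  function on \<open>{..<q}\<close>. A list entry \<open>(a, A)\<close> stands for \<open>a\<close> times the indicator of the box
  \<open>A 0 \<times> \<dots> \<times> A (q - 1)\<close>, whose sides are pairwise disjoint, so that the box avoids the
  diagonals. After refinement of the sides, these combinations are exactly the usual
  elementary functions that vanish on the diagonals.\<close>

definition lebesgue_pow :: "nat \<Rightarrow> (nat \<Rightarrow> real) measure" where
  "lebesgue_pow q = (\<Pi>\<^sub>M j\<in>{..<q}. lborel)"

definition off_diagonal :: "nat \<Rightarrow> (real \<times> (nat \<Rightarrow> real set)) list \<Rightarrow> bool" where
  "off_diagonal q F \<longleftrightarrow>
     (\<forall>(a, A) \<in> set F. (\<forall>j<q. A j \<in> sets lborel \<and> emeasure lborel (A j) < \<infinity>) \<and>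
        disjoint_family_on A {..<q})"

definition elementary_fun ::
    "nat \<Rightarrow> (real \<times> (nat \<Rightarrow> real set)) list \<Rightarrow> (nat \<Rightarrow> real) \<Rightarrow> real" where
  "elementary_fun q F \<psi> = (\<Sum>(a, A)\<leftarrow>F. a * (\<Prod>j<q. indicator (A j) (\<psi> j)))"

definition elementary_integral ::
    "((real \<Rightarrow> real) \<Rightarrow> 'a \<Rightarrow> real) \<Rightarrow> nat \<Rightarrow> (real \<times> (nat \<Rightarrow> real set)) list \<Rightarrow> 'a \<Rightarrow> real" where
  "elementary_integral W q F \<omega> = (\<Sum>(a, A)\<leftarrow>F. a * (\<Prod>j<q. W (indicator (A j)) \<omega>))"

text \<open>\<open>J\<close> is a version of the multiple Wiener integral of order \<open>q\<close> of \<open>f\<close>. For a function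
  that is not symmetric, this is the integral of its symmetrization.\<close>

definition multiple_wiener_integral ::
    "'a measure \<Rightarrow> ((real \<Rightarrow> real) \<Rightarrow> 'a \<Rightarrow> real) \<Rightarrow> nat \<Rightarrow>
     ((nat \<Rightarrow> real) \<Rightarrow> real) \<Rightarrow> ('a \<Rightarrow> real) \<Rightarrow> bool" where
  "multiple_wiener_integral M W q f J \<longleftrightarrow>
     f \<in> L2 (lebesgue_pow q) \<and> J \<in> borel_measurable M \<and>
     (\<exists>F. (\<forall>n. off_diagonal q (F n)) \<and>
        L2_converges (lebesgue_pow q) (\<lambda>n. elementary_fun q (F n)) f \<and>
        L2_converges M (\<lambda>n. elementary_integral W q (F n)) J)"

definition hermite_H0 :: "nat \<Rightarrow> real \<Rightarrow> real" where
  "hermite_H0 q H = 1 + (H - 1) / real q"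

definition hermite_const :: "nat \<Rightarrow> real \<Rightarrow> real" where
  "hermite_const q H =
     sqrt (H * (2 * H - 1) /
       (fact q * Beta (hermite_H0 q H - 1/2) (2 - 2 * hermite_H0 q H) ^ q))"

text \<open>Since \<open>0 powr a = 0\<close>, the factors vanish for \<open>u \<le> \<psi> j\<close>, although the exponent is
  negative.\<close>

definition hermite_kernel :: "nat \<Rightarrow> real \<Rightarrow> (real \<Rightarrow> real) \<Rightarrow> (nat \<Rightarrow> real) \<Rightarrow> real" where
  "hermite_kernel q H f \<psi> =
     (LBINT u. f u * (\<Prod>j<q. max 0 (u - \<psi> j) powr (hermite_H0 q H - 3/2)))"

text \<open>\<open>Z\<close> is a version with continuous sample paths, on the time set \<open>T\<close>, of the Hermite
  process driven by \<open>W\<close>.\<close>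

definition hermite_process_on ::
    "'a measure \<Rightarrow> ((real \<Rightarrow> real) \<Rightarrow> 'a \<Rightarrow> real) \<Rightarrow> nat \<Rightarrow> real \<Rightarrow> real set \<Rightarrow>
     (real \<Rightarrow> 'a \<Rightarrow> real) \<Rightarrow> bool" where
  "hermite_process_on M W q H T Z \<longleftrightarrow>
     (\<forall>t\<in>T. \<exists>I. multiple_wiener_integral M W q (hermite_kernel q H (indicator {0..t})) I \<and>
        (\<forall>\<omega>\<in>space M. Z t \<omega> = hermite_const q H * I \<omega>)) \<and>
     (\<forall>\<omega>\<in>space M. continuous_on T (\<lambda>t. Z t \<omega>))"

text \<open>\<open>J\<close> is a version of the Wiener integral of \<open>f\<close> with respect to the Hermite process
  driven by \<open>W\<close>.\<close>

definition hermite_wiener_integral ::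
    "'a measure \<Rightarrow> ((real \<Rightarrow> real) \<Rightarrow> 'a \<Rightarrow> real) \<Rightarrow> nat \<Rightarrow> real \<Rightarrow>
     (real \<Rightarrow> real) \<Rightarrow> ('a \<Rightarrow> real) \<Rightarrow> bool" where
  "hermite_wiener_integral M W q H f J \<longleftrightarrow>
     f \<in> borel_measurable lborel \<and>
     integrable (lborel \<Otimes>\<^sub>M lborel)
       (\<lambda>(u, v). \<bar>f u * f v\<bar> * \<bar>u - v\<bar> powr (2 * H - 2)) \<and>
     (\<exists>I. multiple_wiener_integral M W q (hermite_kernel q H f) I \<and>
        (\<forall>\<omega>\<in>space M. J \<omega> = hermite_const q H * I \<omega>))"

definition tendsto_in_probability ::
    "'a measure \<Rightarrow> ('i \<Rightarrow> 'a \<Rightarrow> real) \<Rightarrow> ('a \<Rightarrow> real) \<Rightarrow> 'i filter \<Rightarrow> bool" where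
  "tendsto_in_probability M V \<xi> F \<longleftrightarrow>
     (\<forall>\<eta>>0. ((\<lambda>i. measure M {\<omega> \<in> space M. \<bar>V i \<omega> - \<xi> \<omega>\<bar> > \<eta>}) \<longlongrightarrow> 0) F)"

end

theory Submission
  imports Defs
begin

text \<open>The solution is \<open>X t = x0 exp (\<theta>0 t) + \<epsilon> Y t\<close> almost surely, since by integration by parts both sides are the
  same pathwise functional of \<open>Z\<close>. The Wiener integral defining \<open>Y\<close> is only given as a limit in mean
  square, so this needs that multiple Wiener integrals of Riemann sums converge to the integral of the limit,
  which rests on the Wick formula. Then everything happens path by path: \<open>u = (\<theta> - \<theta>0) / \<epsilon>\<close> nearly minimizes the convex
  function \<open>u \<mapsto> \<integral> \<bar>Y t - u t x0 exp (\<theta>0 t)\<bar> dt\<close>, whose minimizer is unique because \<open>Y\<close> is continuous and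
  \<open>t x0 exp (\<theta>0 t)\<close> vanishes only at \<open>0\<close>. Hence the estimator converges along every sequence \<open>\<epsilon> \<longrightarrow> 0\<close> almost surely
  to \<open>\<zeta>\<close> itself.\<close>

section \<open>Moments and the Wick formula in a Gaussian space\<close>

text \<open>\<open>multiple_wiener_integral\<close> speaks of one approximating sequence only, so
  two versions of the same integral can be compared only through a bound of the second moment of
  \<open>J\<close> by a multiple of the integral of the squared kernel. \<open>isonormal\<close>
  gives the laws of single linear combinations; the mixed moments behind that bound are recovered by
  polarization, and off-diagonal boxes cancel every pairing inside one factor, so that permutations
  of the sides remain. The kernel is a Bochner integral for every \<psi>, with value 0 where
  integrability fails, so linearity in the integrand is not automatic. Monotonicity of the integrand
  to the right of all \<psi> j makes every kernel in use vanish together at such points. \<Theta>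
  may be unbounded, so linearization in \<theta> must be preceded by a bound of \<theta> - \<theta>0
  of order \<epsilon>. The hypothesis \<open>\<theta>0 \<in> interior \<Theta>\<close> makes
  \<theta>0 plus \<epsilon> times the limiting minimizer an admissible competitor, and the
  separation hypothesis enters by excluding \<open>x0 = 0\<close>. Exceptional null sets depend on
  \<epsilon>, hence the passage to sequences, where countably many of them are discarded.\<close>

definition has_moments :: "'a measure \<Rightarrow> ('a \<Rightarrow> real) \<Rightarrow> bool" where
  "has_moments M X \<longleftrightarrow> X \<in> borel_measurable M \<and> (\<forall>k. integrable M (\<lambda>\<omega>. X \<omega> ^ k))"

lemma has_moments_measurable: "has_moments M X \<Longrightarrow> X \<in> borel_measurable M"
  by (simp add: has_moments_def)

lemma has_moments_integrable: "has_moments M X \<Longrightarrow> integrable M X"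
  unfolding has_moments_def by (metis (no_types, lifting) Bochner_Integration.integrable_cong power_one_right)

text \<open>The k-th power of the product is dominated by \<open>X ^ (2 * k) + Y ^ (2 * k)\<close>.
  Demanding all moments, not just the second, is what makes the class stable under products of any
  length.\<close>

lemma has_moments_mult:
  assumes "has_moments M X" "has_moments M Y"
  shows "has_moments M (\<lambda>\<omega>. X \<omega> * Y \<omega>)"
  unfolding has_moments_def
proof (intro conjI allI)
  have [measurable]: "X \<in> borel_measurable M" "Y \<in> borel_measurable M"
    using assms by (auto simp: has_moments_def)
  show "(\<lambda>\<omega>. X \<omega> * Y \<omega>) \<in> borel_measurable M" by measurable
  fix k
  have "integrable M (\<lambda>\<omega>. X \<omega> ^ (2 * k) + Y \<omega> ^ (2 * k))"
    using assms by (auto simp: has_moments_def)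
  then show "integrable M (\<lambda>\<omega>. (X \<omega> * Y \<omega>) ^ k)"
  proof (rule Bochner_Integration.integrable_bound)
    show "AE \<omega> in M. norm ((X \<omega> * Y \<omega>) ^ k) \<le> norm (X \<omega> ^ (2 * k) + Y \<omega> ^ (2 * k))"
    proof (rule AE_I2)
      fix \<omega>
      define a b where "a = \<bar>X \<omega> ^ k\<bar>" and "b = \<bar>Y \<omega> ^ k\<bar>"
      have "a * b \<le> a\<^sup>2 + b\<^sup>2"
      proof -
        have "0 \<le> a * b" by (simp add: a_def b_def)
        then show ?thesis using sum_squares_bound[of a b] by linarith
      qed
      moreover have "a\<^sup>2 = X \<omega> ^ (2 * k)" "b\<^sup>2 = Y \<omega> ^ (2 * k)"
        by (auto simp: a_def b_def power_mult[symmetric] mult.commute)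
      ultimately show "norm ((X \<omega> * Y \<omega>) ^ k) \<le> norm (X \<omega> ^ (2 * k) + Y \<omega> ^ (2 * k))"
        by (simp add: a_def b_def power_mult_distrib abs_mult)
    qed
  qed measurable
qed

lemma (in prob_space) has_moments_const: "has_moments M (\<lambda>\<omega>. c)"
  by (simp add: has_moments_def)

lemma (in prob_space) has_moments_power:
  "has_moments M X \<Longrightarrow> has_moments M (\<lambda>\<omega>. X \<omega> ^ k)"
  by (induction k) (simp_all add: has_moments_const has_moments_mult)

lemma (in prob_space) has_moments_prod:
  "(\<And>i. i \<in> S \<Longrightarrow> has_moments M (X i)) \<Longrightarrow> has_moments M (\<lambda>\<omega>. \<Prod>i\<in>S. X i \<omega>)"
  by (induction S rule: infinite_finite_induct) (simp_all add: has_moments_const has_moments_mult)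

lemma centered_gaussian_has_moments:
  assumes "prob_space M" and "centered_gaussian M X"
  shows "has_moments M X"
proof -
  interpret prob_space M by fact
  have [measurable]: "X \<in> borel_measurable M"
    using assms by (simp add: centered_gaussian_def)
  have "integrable M (\<lambda>\<omega>. X \<omega> ^ k)" for k
    using assms(2)[unfolded centered_gaussian_def]
  proof (elim conjE disjE exE)
    assume "AE \<omega> in M. X \<omega> = 0"
    then have "AE \<omega> in M. X \<omega> ^ k = 0 ^ k" by auto
    then show ?thesis
      by (subst integrable_cong_AE[where g = "\<lambda>_. 0 ^ k"]) auto
  next
    fix \<sigma> :: real
    assume \<sigma>: "\<sigma> > 0" and d: "distributed M lborel X (\<lambda>x. ennreal (normal_density 0 \<sigma> x))"
    show ?thesis
      using distributed_integrable[OF d, of "\<lambda>x. x ^ k"] integrable_normal_moment[OF \<sigma>, of 0 k] by simp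
  qed
  then show ?thesis by (simp add: has_moments_def)
qed

lemma centered_gaussian_expectation:
  assumes "prob_space M" and "centered_gaussian M X"
  shows "(\<integral>\<omega>. X \<omega> \<partial>M) = 0"
  using assms(2)[unfolded centered_gaussian_def]
proof (elim conjE disjE exE)
  assume [measurable]: "X \<in> borel_measurable M" and "AE \<omega> in M. X \<omega> = 0"
  then show ?thesis
    by (subst integral_cong_AE[where g = "\<lambda>_. 0"]) auto
next
  fix \<sigma> :: real
  assume \<sigma>: "\<sigma> > 0" and d: "distributed M lborel X (\<lambda>x. ennreal (normal_density 0 \<sigma> x))"
  show ?thesis
    using distributed_integral[OF d, of "\<lambda>x. x"] integral_normal_moment_odd[OF \<sigma>, of 0 0] by simp
qed

text \<open>Gaussian integration by parts for monomials, read off from the closed forms of the even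
  moments; for odd \<open>k\<close> both sides are 0. The recursive form treats both parities
  alike.\<close>

lemma normal_moment_step:
  assumes \<sigma>: "(\<sigma>::real) > 0"
  shows "(\<integral>x. normal_density 0 \<sigma> x * x ^ (k + 2) \<partial>lborel) =
    real (k + 1) * \<sigma>\<^sup>2 * (\<integral>x. normal_density 0 \<sigma> x * x ^ k \<partial>lborel)"
proof (cases "even k")
  case True
  then obtain m where k: "k = 2 * m" by blast
  have f: "fact (2 * Suc m) = real (2 * m + 2) * real (2 * m + 1) * fact (2 * m)"
    by (simp add: algebra_simps)
  have "(\<integral>x. normal_density 0 \<sigma> x * x ^ (2 * Suc m) \<partial>lborel) = fact (2 * Suc m) / ((2 / \<sigma>\<^sup>2) ^ Suc m * fact (Suc m))"
    using integral_normal_moment_even[OF \<sigma>, of 0 "Suc m"] by simp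
  also have "\<dots> = real (2 * m + 1) * \<sigma>\<^sup>2 * (fact (2 * m) / ((2 / \<sigma>\<^sup>2) ^ m * fact m))"
    unfolding f using \<sigma> by (simp add: divide_simps)
  also have "fact (2 * m) / ((2 / \<sigma>\<^sup>2) ^ m * fact m) = (\<integral>x. normal_density 0 \<sigma> x * x ^ (2 * m) \<partial>lborel)"
    using integral_normal_moment_even[OF \<sigma>, of 0 m] by simp
  finally show ?thesis by (simp add: k)
next
  case False
  then obtain m where k: "k = 2 * m + 1" using oddE by blast
  have k2: "k + 2 = 2 * Suc m + 1" by (simp add: k)
  show ?thesis
    using integral_normal_moment_odd[OF \<sigma>, of 0 m] integral_normal_moment_odd[OF \<sigma>, of 0 "Suc m"]
    unfolding k2 by (simp add: k)
qed

text \<open>With the variance written as a second moment, the identity also covers the degenerate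
  law and is polynomial in \<open>X\<close>. It can therefore be differentiated along a line of
  Gaussian variables.\<close>

lemma centered_gaussian_moment_step:
  assumes "prob_space M" and "centered_gaussian M X"
  shows "(\<integral>\<omega>. X \<omega> ^ (k + 2) \<partial>M) = real (k + 1) * (\<integral>\<omega>. (X \<omega>)\<^sup>2 \<partial>M) * (\<integral>\<omega>. X \<omega> ^ k \<partial>M)"
  using assms(2)[unfolded centered_gaussian_def]
proof (elim conjE disjE exE)
  assume [measurable]: "X \<in> borel_measurable M" and *: "AE \<omega> in M. X \<omega> = 0"
  have "(\<integral>\<omega>. X \<omega> ^ (k + 2) \<partial>M) = (\<integral>\<omega>. 0 \<partial>M)" for k
    by (rule integral_cong_AE) (use * in auto)
  from this[of k] this[of 0] show ?thesis by (simp add: power2_eq_square)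
next
  interpret prob_space M by fact
  fix \<sigma> :: real
  assume \<sigma>: "\<sigma> > 0" and d: "distributed M lborel X (\<lambda>x. ennreal (normal_density 0 \<sigma> x))"
  have m: "(\<integral>\<omega>. X \<omega> ^ j \<partial>M) = (\<integral>x. normal_density 0 \<sigma> x * x ^ j \<partial>lborel)" for j
    using distributed_integral[OF d, of "\<lambda>x. x ^ j"] by simp
  have "(\<integral>\<omega>. (X \<omega>)\<^sup>2 \<partial>M) = \<sigma>\<^sup>2"
    unfolding m using normal_moment_step[OF \<sigma>, of 0] integral_normal_density[OF \<sigma>, of 0]
    by (simp add: power2_eq_square)
  then show ?thesis
    by (simp only: m normal_moment_step[OF \<sigma>])
qed

text \<open>Joint Gaussianity in the form needed for polarization: \<open>L + s X\<close> has a
  centered Gaussian law for every real \<open>s\<close>, so the one-dimensional moment recursion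
  holds along the whole line.\<close>

locale gaussian_space = prob_space M for M :: "'a measure" +
  fixes V :: "('a \<Rightarrow> real) set"
  assumes gaussian: "X \<in> V \<Longrightarrow> centered_gaussian M X"
    and add: "X \<in> V \<Longrightarrow> Y \<in> V \<Longrightarrow> (\<lambda>\<omega>. X \<omega> + Y \<omega>) \<in> V"
    and scale: "X \<in> V \<Longrightarrow> (\<lambda>\<omega>. c * X \<omega>) \<in> V"
begin

lemma moments [intro]: "X \<in> V \<Longrightarrow> has_moments M X"
  using gaussian centered_gaussian_has_moments prob_space_axioms by blast

lemmas moments_intros = moments has_moments_mult has_moments_power has_moments_prod has_moments_const

text \<open>Polarization: identities that hold for all powers of the elements of \<open>V\<close> extend to mixed
  products by differentiating at \<open>s = 0\<close> along \<open>L + s X\<close>.\<close>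

lemma expectation_power_derivative:
  assumes "L \<in> V" "X \<in> V" "has_moments M U"
  shows "((\<lambda>s. expectation (\<lambda>\<omega>. U \<omega> * (L \<omega> + s * X \<omega>) ^ m)) has_real_derivative
    real m * expectation (\<lambda>\<omega>. U \<omega> * X \<omega> * L \<omega> ^ (m - 1))) (at 0)"
  using assms(3)
proof (induction m arbitrary: U)
  case 0
  then show ?case by simp
next
  case (Suc m)
  have LX: "(\<lambda>\<omega>. L \<omega> + s * X \<omega>) \<in> V" for s
    using add[OF assms(1) scale[OF assms(2)]] .
  have UL: "has_moments M (\<lambda>\<omega>. U \<omega> * L \<omega>)" and UX: "has_moments M (\<lambda>\<omega>. U \<omega> * X \<omega>)"
    by (intro moments_intros assms Suc.prems)+
  \<comment> \<open>One factor of the power is split off and its two summands are absorbed into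
    \<open>U\<close>, hence the induction over arbitrary \<open>U\<close>. At \<open>s = 0\<close>
    the product rule keeps only the value, not the derivative, of the expectation multiplied by
    \<open>s\<close>.\<close>
  have eq: "expectation (\<lambda>\<omega>. U \<omega> * (L \<omega> + s * X \<omega>) ^ Suc m) =
      expectation (\<lambda>\<omega>. U \<omega> * L \<omega> * (L \<omega> + s * X \<omega>) ^ m) +
      s * expectation (\<lambda>\<omega>. U \<omega> * X \<omega> * (L \<omega> + s * X \<omega>) ^ m)" for s
  proof -
    have "integrable M (\<lambda>\<omega>. U \<omega> * L \<omega> * (L \<omega> + s * X \<omega>) ^ m)"
      and "integrable M (\<lambda>\<omega>. U \<omega> * X \<omega> * (L \<omega> + s * X \<omega>) ^ m)"
      by (intro has_moments_integrable has_moments_mult UL UX has_moments_power moments LX)+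
    then show ?thesis
      by (subst Bochner_Integration.integral_mult_right_zero[symmetric],
          subst Bochner_Integration.integral_add[symmetric]) (auto simp: algebra_simps)
  qed
  have "real m * expectation (\<lambda>\<omega>. U \<omega> * L \<omega> * X \<omega> * L \<omega> ^ (m - 1)) =
      real m * expectation (\<lambda>\<omega>. U \<omega> * X \<omega> * L \<omega> ^ m)"
    by (cases m) (simp_all add: mult_ac)
  moreover note DERIV_add[OF Suc.IH[OF UL] DERIV_mult[OF DERIV_ident Suc.IH[OF UX]]]
  ultimately show ?case unfolding eq by (elim DERIV_cong) (simp add: algebra_simps)
qed

text \<open>Stein's identity for monomials. The moment recursion of order \<open>k + 3\<close> for
  \<open>L + s X\<close> is differentiated at \<open>s = 0\<close>; this expresses the claim for
  \<open>m = k + 2\<close> through the one for \<open>k\<close>, hence strong induction with base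
  cases 0 and 1.\<close>

lemma expectation_times_power:
  assumes L: "L \<in> V" and X: "X \<in> V"
  shows "expectation (\<lambda>\<omega>. X \<omega> * L \<omega> ^ m) =
    real m * expectation (\<lambda>\<omega>. X \<omega> * L \<omega>) * expectation (\<lambda>\<omega>. L \<omega> ^ (m - 1))"
proof (induction m rule: less_induct)
  case (less m)
  consider "m = 0" | "m = 1" | k where "m = k + 2"
    by (metis One_nat_def Suc_eq_plus1 add_2_eq_Suc' not0_implies_Suc)
  then show ?case
  proof cases
    case 1
    then show ?thesis using centered_gaussian_expectation[OF prob_space_axioms gaussian[OF X]] by simp
  next
    case 2
    then show ?thesis by (simp add: prob_space)
  next
    case 3
    let ?Y = "\<lambda>s \<omega>. L \<omega> + s * X \<omega>"
    have Y: "?Y s \<in> V" for s using add[OF L scale[OF X]] .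
    have D: "((\<lambda>s. expectation (\<lambda>\<omega>. ?Y s \<omega> ^ j)) has_real_derivative
        real j * expectation (\<lambda>\<omega>. X \<omega> * L \<omega> ^ (j - 1))) (at 0)" for j
      using expectation_power_derivative[OF L X has_moments_const[of 1], of j] by simp
    have "((\<lambda>s. real (k + 2) * expectation (\<lambda>\<omega>. (?Y s \<omega>)\<^sup>2) * expectation (\<lambda>\<omega>. ?Y s \<omega> ^ (k + 1)))
       has_real_derivative real (k + 2) * (2 * expectation (\<lambda>\<omega>. X \<omega> * L \<omega>)) * expectation (\<lambda>\<omega>. L \<omega> ^ (k + 1))
         + (real (k + 1) * expectation (\<lambda>\<omega>. X \<omega> * L \<omega> ^ k)) * (real (k + 2) * expectation (\<lambda>\<omega>. (L \<omega>)\<^sup>2))) (at 0)"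
      using DERIV_mult[OF DERIV_cmult[OF D[of 2], of "real (k + 2)"] D[of "k + 1"]]
      by (simp add: mult_ac)
    moreover have "expectation (\<lambda>\<omega>. ?Y s \<omega> ^ (k + 3)) =
        real (k + 2) * expectation (\<lambda>\<omega>. (?Y s \<omega>)\<^sup>2) * expectation (\<lambda>\<omega>. ?Y s \<omega> ^ (k + 1))" for s
      using centered_gaussian_moment_step[OF prob_space_axioms gaussian[OF Y], of s "k + 1"]
      by (simp add: numeral_3_eq_3)
    ultimately have "real (k + 3) * expectation (\<lambda>\<omega>. X \<omega> * L \<omega> ^ (k + 2)) =
        real (k + 2) * (2 * expectation (\<lambda>\<omega>. X \<omega> * L \<omega>)) * expectation (\<lambda>\<omega>. L \<omega> ^ (k + 1))
         + (real (k + 1) * expectation (\<lambda>\<omega>. X \<omega> * L \<omega> ^ k)) * (real (k + 2) * expectation (\<lambda>\<omega>. (L \<omega>)\<^sup>2))"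
      using D[of "k + 3"] by (simp add: DERIV_unique)
    also have "real (k + 1) * expectation (\<lambda>\<omega>. X \<omega> * L \<omega> ^ k) * (real (k + 2) * expectation (\<lambda>\<omega>. (L \<omega>)\<^sup>2)) =
        real (k + 1) * real (k + 2) * expectation (\<lambda>\<omega>. X \<omega> * L \<omega>) * (real k * expectation (\<lambda>\<omega>. (L \<omega>)\<^sup>2) * expectation (\<lambda>\<omega>. L \<omega> ^ (k - 1)))"
      using less.IH[of k] by (simp add: 3 mult_ac)
    \<comment> \<open>The moment recursion of \<open>L\<close> again, now read backwards; at
      \<open>k = 0\<close> both sides are 0, whatever \<open>k - 1\<close> means.\<close>
    also have "real k * expectation (\<lambda>\<omega>. (L \<omega>)\<^sup>2) * expectation (\<lambda>\<omega>. L \<omega> ^ (k - 1)) = expectation (\<lambda>\<omega>. L \<omega> ^ (k + 1))"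
    proof (cases k)
      case 0
      then show ?thesis using centered_gaussian_expectation[OF prob_space_axioms gaussian[OF L]] by simp
    next
      case (Suc j)
      then show ?thesis
        using centered_gaussian_moment_step[OF prob_space_axioms gaussian[OF L], of j] by simp
    qed
    finally have "real (k + 3) * expectation (\<lambda>\<omega>. X \<omega> * L \<omega> ^ (k + 2)) =
      real (k + 3) * (real (k + 2) * expectation (\<lambda>\<omega>. X \<omega> * L \<omega>) * expectation (\<lambda>\<omega>. L \<omega> ^ (k + 1)))"
      by (simp add: algebra_simps)
    then show ?thesis by (simp add: 3)
  qed
qed

text \<open>Interpolates between Stein's identity (\<open>S\<close> empty) and the Wick formula
  (\<open>m = 0\<close>). The power of \<open>L\<close> is a reservoir: differentiating along
  \<open>L + s X j\<close> turns one of its factors into \<open>X j\<close>, which enlarges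
  \<open>S\<close> by \<open>j\<close>.\<close>

lemma wick_power:
  assumes "finite S" "X0 \<in> V" "\<And>k. k \<in> S \<Longrightarrow> X k \<in> V" "L \<in> V"
  shows "expectation (\<lambda>\<omega>. X0 \<omega> * (\<Prod>k\<in>S. X k \<omega>) * L \<omega> ^ m) =
    (\<Sum>k\<in>S. expectation (\<lambda>\<omega>. X0 \<omega> * X k \<omega>) * expectation (\<lambda>\<omega>. (\<Prod>l\<in>S - {k}. X l \<omega>) * L \<omega> ^ m)) +
    real m * expectation (\<lambda>\<omega>. X0 \<omega> * L \<omega>) * expectation (\<lambda>\<omega>. (\<Prod>k\<in>S. X k \<omega>) * L \<omega> ^ (m - 1))"
  using assms
proof (induction S arbitrary: L m rule: finite_induct)
  case empty
  then show ?case using expectation_times_power[of L X0 m] by simp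
next
  case (insert j S)
  have Xj: "X j \<in> V" and XS: "\<And>k. k \<in> S \<Longrightarrow> X k \<in> V" using insert.prems by auto
  note L = \<open>L \<in> V\<close> and X0 = \<open>X0 \<in> V\<close>
  let ?Y = "\<lambda>s \<omega>. L \<omega> + s * X j \<omega>"
  have Y: "?Y s \<in> V" for s using add[OF L scale[OF Xj]] .
  have P: "has_moments M (\<lambda>\<omega>. \<Prod>k\<in>T. X k \<omega>)" if "T \<subseteq> S" for T
    using that XS by (intro has_moments_prod moments) auto
  have D: "((\<lambda>s. expectation (\<lambda>\<omega>. U \<omega> * ?Y s \<omega> ^ n)) has_real_derivative
      real n * expectation (\<lambda>\<omega>. U \<omega> * X j \<omega> * L \<omega> ^ (n - 1))) (at 0)" if "has_moments M U" for U n
    using expectation_power_derivative[OF L Xj that] .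
  \<comment> \<open>The formula for \<open>S\<close> is used with exponent \<open>m + 1\<close>, so
    that exponent \<open>m\<close> is left after differentiation. The common factor
    \<open>m + 1\<close> is nonzero and cancels at the end.\<close>
  let ?m = "Suc m"
  have "((\<lambda>s. expectation (\<lambda>\<omega>. X0 \<omega> * (\<Prod>k\<in>S. X k \<omega>) * ?Y s \<omega> ^ ?m)) has_real_derivative
      real ?m * expectation (\<lambda>\<omega>. X0 \<omega> * (\<Prod>k\<in>S. X k \<omega>) * X j \<omega> * L \<omega> ^ m)) (at 0)"
    using D[of "\<lambda>\<omega>. X0 \<omega> * (\<Prod>k\<in>S. X k \<omega>)" ?m] by (simp add: has_moments_mult P X0 moments)
  moreover have "expectation (\<lambda>\<omega>. X0 \<omega> * (\<Prod>k\<in>S. X k \<omega>) * ?Y s \<omega> ^ ?m) =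
      (\<Sum>k\<in>S. expectation (\<lambda>\<omega>. X0 \<omega> * X k \<omega>) * expectation (\<lambda>\<omega>. (\<Prod>l\<in>S - {k}. X l \<omega>) * ?Y s \<omega> ^ ?m)) +
      real ?m * expectation (\<lambda>\<omega>. X0 \<omega> * ?Y s \<omega>) * expectation (\<lambda>\<omega>. (\<Prod>k\<in>S. X k \<omega>) * ?Y s \<omega> ^ m)" for s
    using insert.IH[OF X0 XS Y, of s ?m] by simp
  moreover have "((\<lambda>s. (\<Sum>k\<in>S. expectation (\<lambda>\<omega>. X0 \<omega> * X k \<omega>) * expectation (\<lambda>\<omega>. (\<Prod>l\<in>S - {k}. X l \<omega>) * ?Y s \<omega> ^ ?m)) +
      real ?m * expectation (\<lambda>\<omega>. X0 \<omega> * ?Y s \<omega>) * expectation (\<lambda>\<omega>. (\<Prod>k\<in>S. X k \<omega>) * ?Y s \<omega> ^ m)) has_real_derivative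
      (\<Sum>k\<in>S. expectation (\<lambda>\<omega>. X0 \<omega> * X k \<omega>) * (real ?m * expectation (\<lambda>\<omega>. (\<Prod>l\<in>S - {k}. X l \<omega>) * X j \<omega> * L \<omega> ^ m))) +
      ((real ?m * expectation (\<lambda>\<omega>. X0 \<omega> * X j \<omega>)) * expectation (\<lambda>\<omega>. (\<Prod>k\<in>S. X k \<omega>) * L \<omega> ^ m) +
       (real m * expectation (\<lambda>\<omega>. (\<Prod>k\<in>S. X k \<omega>) * X j \<omega> * L \<omega> ^ (m - 1))) * (real ?m * expectation (\<lambda>\<omega>. X0 \<omega> * L \<omega>)))) (at 0)"
  proof (intro DERIV_add DERIV_sum DERIV_cmult)
    show "((\<lambda>s. expectation (\<lambda>\<omega>. (\<Prod>l\<in>S - {k}. X l \<omega>) * ?Y s \<omega> ^ ?m)) has_real_derivative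
        real ?m * expectation (\<lambda>\<omega>. (\<Prod>l\<in>S - {k}. X l \<omega>) * X j \<omega> * L \<omega> ^ m)) (at 0)" for k
      using D[OF P[of "S - {k}"], of ?m] by simp
    have "((\<lambda>s. expectation (\<lambda>\<omega>. X0 \<omega> * ?Y s \<omega>)) has_real_derivative expectation (\<lambda>\<omega>. X0 \<omega> * X j \<omega>)) (at 0)"
      using D[OF moments[OF X0], of 1] by simp
    from DERIV_mult[OF DERIV_cmult[OF this, of "real ?m"] D[OF P[of S], of m]]
    show "((\<lambda>s. real ?m * expectation (\<lambda>\<omega>. X0 \<omega> * ?Y s \<omega>) * expectation (\<lambda>\<omega>. (\<Prod>k\<in>S. X k \<omega>) * ?Y s \<omega> ^ m)) has_real_derivative
      ((real ?m * expectation (\<lambda>\<omega>. X0 \<omega> * X j \<omega>)) * expectation (\<lambda>\<omega>. (\<Prod>k\<in>S. X k \<omega>) * L \<omega> ^ m) +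
       (real m * expectation (\<lambda>\<omega>. (\<Prod>k\<in>S. X k \<omega>) * X j \<omega> * L \<omega> ^ (m - 1))) * (real ?m * expectation (\<lambda>\<omega>. X0 \<omega> * L \<omega>)))) (at 0)"
      by simp
  qed
  ultimately have "real ?m * expectation (\<lambda>\<omega>. X0 \<omega> * (\<Prod>k\<in>S. X k \<omega>) * X j \<omega> * L \<omega> ^ m) =
      (\<Sum>k\<in>S. expectation (\<lambda>\<omega>. X0 \<omega> * X k \<omega>) * (real ?m * expectation (\<lambda>\<omega>. (\<Prod>l\<in>S - {k}. X l \<omega>) * X j \<omega> * L \<omega> ^ m))) +
      ((real ?m * expectation (\<lambda>\<omega>. X0 \<omega> * X j \<omega>)) * expectation (\<lambda>\<omega>. (\<Prod>k\<in>S. X k \<omega>) * L \<omega> ^ m) +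
       (real m * expectation (\<lambda>\<omega>. (\<Prod>k\<in>S. X k \<omega>) * X j \<omega> * L \<omega> ^ (m - 1))) * (real ?m * expectation (\<lambda>\<omega>. X0 \<omega> * L \<omega>)))"
    by (simp only: DERIV_unique)
  also have "\<dots> = real ?m * ((\<Sum>k\<in>S. expectation (\<lambda>\<omega>. X0 \<omega> * X k \<omega>) * expectation (\<lambda>\<omega>. (\<Prod>l\<in>S - {k}. X l \<omega>) * X j \<omega> * L \<omega> ^ m)) +
      (expectation (\<lambda>\<omega>. X0 \<omega> * X j \<omega>) * expectation (\<lambda>\<omega>. (\<Prod>k\<in>S. X k \<omega>) * L \<omega> ^ m) +
       real m * expectation (\<lambda>\<omega>. X0 \<omega> * L \<omega>) * expectation (\<lambda>\<omega>. (\<Prod>k\<in>S. X k \<omega>) * X j \<omega> * L \<omega> ^ (m - 1))))"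
    by (simp add: algebra_simps sum_distrib_left del: of_nat_Suc)
  finally have *: "expectation (\<lambda>\<omega>. X0 \<omega> * (\<Prod>k\<in>S. X k \<omega>) * X j \<omega> * L \<omega> ^ m) =
      (\<Sum>k\<in>S. expectation (\<lambda>\<omega>. X0 \<omega> * X k \<omega>) * expectation (\<lambda>\<omega>. (\<Prod>l\<in>S - {k}. X l \<omega>) * X j \<omega> * L \<omega> ^ m)) +
      (expectation (\<lambda>\<omega>. X0 \<omega> * X j \<omega>) * expectation (\<lambda>\<omega>. (\<Prod>k\<in>S. X k \<omega>) * L \<omega> ^ m) +
       real m * expectation (\<lambda>\<omega>. X0 \<omega> * L \<omega>) * expectation (\<lambda>\<omega>. (\<Prod>k\<in>S. X k \<omega>) * X j \<omega> * L \<omega> ^ (m - 1)))"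
    by (simp del: of_nat_Suc)
  have "expectation (\<lambda>\<omega>. (\<Prod>l\<in>insert j S - {k}. X l \<omega>) * L \<omega> ^ m) =
      expectation (\<lambda>\<omega>. (\<Prod>l\<in>S - {k}. X l \<omega>) * X j \<omega> * L \<omega> ^ m)" if "k \<in> S" for k
  proof -
    have "insert j S - {k} = insert j (S - {k})" using that insert.hyps by auto
    then show ?thesis using insert.hyps by (simp add: mult_ac)
  qed
  moreover have "insert j S - {j} = S" using insert.hyps by auto
  ultimately show ?case using * insert.hyps by (simp add: mult_ac add_ac)
qed

text \<open>Isserlis' theorem in recursive form. At exponent 0 the variable \<open>L\<close>
  disappears, so \<open>X0\<close> serves as a placeholder for it.\<close>

lemma wick:
  assumes "finite S" "X0 \<in> V" "\<And>k. k \<in> S \<Longrightarrow> X k \<in> V"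
  shows "expectation (\<lambda>\<omega>. X0 \<omega> * (\<Prod>k\<in>S. X k \<omega>)) =
    (\<Sum>k\<in>S. expectation (\<lambda>\<omega>. X0 \<omega> * X k \<omega>) * expectation (\<lambda>\<omega>. \<Prod>l\<in>S - {k}. X l \<omega>))"
  using wick_power[OF assms assms(2), where m = 0] by simp

end

section \<open>Pairings between two orthogonal families\<close>

definition bijections :: "nat \<Rightarrow> nat set \<Rightarrow> (nat \<Rightarrow> nat) set" where
  "bijections n Q = {\<sigma> \<in> {..<n} \<rightarrow>\<^sub>E Q. bij_betw \<sigma> {..<n} Q}"

lemma finite_bijections: "finite Q \<Longrightarrow> finite (bijections n Q)"
  unfolding bijections_def by (rule finite_subset[of _ "{..<n} \<rightarrow>\<^sub>E Q"]) (auto intro: finite_PiE)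

lemma bijections_0: "bijections 0 Q = (if Q = {} then {\<lambda>_. undefined} else {})"
  by (auto simp: bijections_def bij_betw_def)

text \<open>Laplace expansion of a permanent along its last row. The target \<open>Q\<close> is an
  arbitrary finite set because the point matched with \<open>n\<close> has to be removed from
  it.\<close>

lemma sum_bijections_Suc:
  assumes "finite Q"
  shows "(\<Sum>\<sigma>\<in>bijections (Suc n) Q. \<Prod>i<Suc n. g i (\<sigma> i)) =
    (\<Sum>j\<in>Q. g n j * (\<Sum>\<sigma>\<in>bijections n (Q - {j}). \<Prod>i<n. g i (\<sigma> i)) :: real)"
proof -
  have "(\<Sum>j\<in>Q. g n j * (\<Sum>\<sigma>\<in>bijections n (Q - {j}). \<Prod>i<n. g i (\<sigma> i))) =
      (\<Sum>(j, \<sigma>)\<in>(SIGMA j:Q. bijections n (Q - {j})). g n j * (\<Prod>i<n. g i (\<sigma> i)))"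
    using assms by (simp add: sum_distrib_left sum.Sigma finite_bijections)
  also have "\<dots> = (\<Sum>\<sigma>\<in>bijections (Suc n) Q. \<Prod>i<Suc n. g i (\<sigma> i))"
  \<comment> \<open>The value at \<open>n\<close> is split off; resetting it to
    \<open>undefined\<close> keeps the restriction extensional, so every bijection is counted
    once.\<close>
  proof (rule sum.reindex_bij_witness[where i = "\<lambda>\<sigma>. (\<sigma> n, \<sigma>(n := undefined))"
        and j = "\<lambda>(j, \<sigma>). \<sigma>(n := j)"], goal_cases)
    case (1 p)
    then show ?case by (auto simp: bijections_def PiE_def extensional_def)
  next
    case (2 p)
    then obtain j \<sigma> where p: "p = (j, \<sigma>)" "j \<in> Q" and \<sigma>: "\<sigma> \<in> {..<n} \<rightarrow>\<^sub>E Q - {j}" "bij_betw \<sigma> {..<n} (Q - {j})"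
      by (auto simp: bijections_def)
    have "bij_betw (\<sigma>(n := j)) {..<n} (Q - {j})"
      using \<sigma>(2) by (subst bij_betw_cong[where g = \<sigma>]) auto
    then have "bij_betw (\<sigma>(n := j)) (insert n {..<n}) (insert ((\<sigma>(n := j)) n) (Q - {j}))"
      by (intro notIn_Un_bij_betw[where A = "{..<n}" and b = n, simplified]) auto
    moreover have "insert j (Q - {j}) = Q" using p by auto
    ultimately have "bij_betw (\<sigma>(n := j)) {..<Suc n} Q" by (simp add: lessThan_Suc)
    moreover have "\<sigma>(n := j) \<in> {..<Suc n} \<rightarrow>\<^sub>E Q"
      using \<sigma>(1) p by (auto simp: PiE_iff extensional_def)
    ultimately show ?case by (simp add: p bijections_def)
  next
    case (3 \<sigma>)
    then show ?case by (auto simp: fun_eq_iff)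
  next
    case (4 \<sigma>)
    then have \<sigma>: "\<sigma> \<in> {..<Suc n} \<rightarrow>\<^sub>E Q" "bij_betw \<sigma> {..<Suc n} Q"
      by (auto simp: bijections_def)
    have "bij_betw \<sigma> ({..<Suc n} - {n}) (Q - {\<sigma> n})"
      using \<sigma>(2) by (rule bij_betw_DiffI) (use bij_betwE[OF \<sigma>(2)] in auto)
    moreover have "{..<Suc n} - {n} = {..<n}" by auto
    ultimately have b: "bij_betw \<sigma> {..<n} (Q - {\<sigma> n})" by simp
    then have "bij_betw (\<sigma>(n := undefined)) {..<n} (Q - {\<sigma> n})"
      by (subst bij_betw_cong[where g = \<sigma>]) auto
    moreover have "\<sigma>(n := undefined) \<in> {..<n} \<rightarrow>\<^sub>E Q - {\<sigma> n}"
      using b \<sigma>(1) by (auto simp: PiE_iff extensional_def bij_betw_def)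
    ultimately show ?case using \<sigma>(1) by (auto simp: bijections_def)
  next
    case (5 p)
    then show ?case by (auto simp: mult.commute intro!: prod.cong)
  qed
  finally show ?thesis by simp
qed

context gaussian_space
begin

text \<open>In the Wick expansion every pair taken inside one of the two orthogonal families
  contributes 0, so only perfect matchings between the families survive: the result is the permanent
  of the cross covariances. If the families have different sizes, there is no matching and both
  sides are 0.\<close>

lemma pairing_formula:
  assumes "finite Q"
    and "\<And>i. i < n \<Longrightarrow> X i \<in> V" "\<And>j. j \<in> Q \<Longrightarrow> Y j \<in> V"
    and "\<And>i j. i < n \<Longrightarrow> j < n \<Longrightarrow> i \<noteq> j \<Longrightarrow> expectation (\<lambda>\<omega>. X i \<omega> * X j \<omega>) = 0"
    and "\<And>i j. i \<in> Q \<Longrightarrow> j \<in> Q \<Longrightarrow> i \<noteq> j \<Longrightarrow> expectation (\<lambda>\<omega>. Y i \<omega> * Y j \<omega>) = 0"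
  shows "expectation (\<lambda>\<omega>. (\<Prod>i<n. X i \<omega>) * (\<Prod>j\<in>Q. Y j \<omega>)) =
    (\<Sum>\<sigma>\<in>bijections n Q. \<Prod>i<n. expectation (\<lambda>\<omega>. X i \<omega> * Y (\<sigma> i) \<omega>))"
  using assms
proof (induction n arbitrary: Q)
  case 0
  show ?case
  proof (cases "Q = {}")
    case True
    then show ?thesis by (simp add: bijections_0 prob_space)
  next
    case False
    \<comment> \<open>No \<open>X\<close> is left, so any remaining \<open>Y j\<close> would have to
      be paired with another \<open>Y k\<close>, and all these covariances are 0.\<close>
    then obtain j where j: "j \<in> Q" by auto
    have "expectation (\<lambda>\<omega>. \<Prod>k\<in>Q. Y k \<omega>) = expectation (\<lambda>\<omega>. Y j \<omega> * (\<Prod>k\<in>Q - {j}. Y k \<omega>))"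
      using j 0 by (simp add: prod.remove)
    also have "\<dots> = (\<Sum>k\<in>Q - {j}. expectation (\<lambda>\<omega>. Y j \<omega> * Y k \<omega>) * expectation (\<lambda>\<omega>. \<Prod>l\<in>Q - {j} - {k}. Y l \<omega>))"
      using j 0 by (intro wick) auto
    also have "\<dots> = 0"
      using j 0 by (intro sum.neutral) auto
    finally show ?thesis using False by (simp add: bijections_0)
  qed
next
  case (Suc n)
  \<comment> \<open>Both families are indexed together by a disjoint sum, so that the Wick formula
    for one family applies to \<open>X n\<close> against all the others.\<close>
  define U where "U = case_sum X Y"
  have prodU: "(\<Prod>k\<in>A <+> B. U k \<omega>) = (\<Prod>i\<in>A. X i \<omega>) * (\<Prod>j\<in>B. Y j \<omega>)"
    if "finite A" "finite B" for A B \<omega>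
    using that by (simp add: U_def prod.Plus)
  have diff: "({..<n} <+> Q) - {Inr j} = {..<n} <+> (Q - {j})" for j
    by auto
  have "expectation (\<lambda>\<omega>. (\<Prod>i<Suc n. X i \<omega>) * (\<Prod>j\<in>Q. Y j \<omega>)) =
      expectation (\<lambda>\<omega>. X n \<omega> * (\<Prod>k\<in>{..<n} <+> Q. U k \<omega>))"
    using Suc.prems by (simp add: prodU mult_ac)
  also have "\<dots> = (\<Sum>k\<in>{..<n} <+> Q. expectation (\<lambda>\<omega>. X n \<omega> * U k \<omega>) *
      expectation (\<lambda>\<omega>. \<Prod>l\<in>({..<n} <+> Q) - {k}. U l \<omega>))"
    using Suc.prems by (intro wick) (auto simp: U_def)
  also have "\<dots> = (\<Sum>i<n. expectation (\<lambda>\<omega>. X n \<omega> * X i \<omega>) * expectation (\<lambda>\<omega>. \<Prod>l\<in>({..<n} <+> Q) - {Inl i}. U l \<omega>)) +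
      (\<Sum>j\<in>Q. expectation (\<lambda>\<omega>. X n \<omega> * Y j \<omega>) * expectation (\<lambda>\<omega>. \<Prod>l\<in>{..<n} <+> (Q - {j}). U l \<omega>))"
    using Suc.prems(1) by (simp add: sum.Plus diff) (simp add: U_def)
  also have "(\<Sum>i<n. expectation (\<lambda>\<omega>. X n \<omega> * X i \<omega>) * expectation (\<lambda>\<omega>. \<Prod>l\<in>({..<n} <+> Q) - {Inl i}. U l \<omega>)) = 0"
    using Suc.prems by (intro sum.neutral) auto
  also have "(\<Sum>j\<in>Q. expectation (\<lambda>\<omega>. X n \<omega> * Y j \<omega>) * expectation (\<lambda>\<omega>. \<Prod>l\<in>{..<n} <+> (Q - {j}). U l \<omega>)) =
      (\<Sum>j\<in>Q. expectation (\<lambda>\<omega>. X n \<omega> * Y j \<omega>) *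
        (\<Sum>\<sigma>\<in>bijections n (Q - {j}). \<Prod>i<n. expectation (\<lambda>\<omega>. X i \<omega> * Y (\<sigma> i) \<omega>)))"
  proof (rule sum.cong[OF refl])
    fix j assume "j \<in> Q"
    have "expectation (\<lambda>\<omega>. \<Prod>l\<in>{..<n} <+> (Q - {j}). U l \<omega>) =
        expectation (\<lambda>\<omega>. (\<Prod>i<n. X i \<omega>) * (\<Prod>j\<in>Q - {j}. Y j \<omega>))"
      using Suc.prems(1) by (simp add: prodU)
    also have "\<dots> = (\<Sum>\<sigma>\<in>bijections n (Q - {j}). \<Prod>i<n. expectation (\<lambda>\<omega>. X i \<omega> * Y (\<sigma> i) \<omega>))"
      using Suc.prems by (intro Suc.IH) auto
    finally show "expectation (\<lambda>\<omega>. X n \<omega> * Y j \<omega>) * expectation (\<lambda>\<omega>. \<Prod>l\<in>{..<n} <+> (Q - {j}). U l \<omega>) =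
        expectation (\<lambda>\<omega>. X n \<omega> * Y j \<omega>) *
        (\<Sum>\<sigma>\<in>bijections n (Q - {j}). \<Prod>i<n. expectation (\<lambda>\<omega>. X i \<omega> * Y (\<sigma> i) \<omega>))"
      by simp
  qed
  also have "\<dots> = (\<Sum>\<sigma>\<in>bijections (Suc n) Q. \<Prod>i<Suc n. expectation (\<lambda>\<omega>. X i \<omega> * Y (\<sigma> i) \<omega>))"
    using Suc.prems(1) by (rule sum_bijections_Suc[symmetric])
  finally show ?case by simp
qed

end

section \<open>The linear span of an isonormal family, and integrals of boxes\<close>

definition gaussian_span :: "((real \<Rightarrow> real) \<Rightarrow> 'a \<Rightarrow> real) \<Rightarrow> ('a \<Rightarrow> real) set" where
  "gaussian_span W = {\<lambda>\<omega>. \<Sum>i<n. a i * W (h i) \<omega> |n a h. \<forall>i<(n::nat). h i \<in> L2 lborel}"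

lemma gaussian_span_base:
  assumes "h \<in> L2 lborel" shows "W h \<in> gaussian_span W"
proof -
  have "W h = (\<lambda>\<omega>. \<Sum>i<(1::nat). 1 * W h \<omega>)" by simp
  then show ?thesis
    unfolding gaussian_span_def mem_Collect_eq using assms
    by (intro exI[of _ "1::nat"] exI[of _ "\<lambda>_. 1"] exI[of _ "\<lambda>_. h"]) auto
qed

lemma gaussian_space_isonormal:
  assumes "prob_space M" and "isonormal M W"
  shows "gaussian_space M (gaussian_span W)"
proof (rule gaussian_space.intro[OF assms(1)], unfold_locales)
  fix X assume "X \<in> gaussian_span W"
  then show "centered_gaussian M X"
    using assms(2) unfolding gaussian_span_def isonormal_def by blast
next
  fix X Y assume "X \<in> gaussian_span W" "Y \<in> gaussian_span W"
  then obtain n a h m b g where X: "X = (\<lambda>\<omega>. \<Sum>i<(n::nat). a i * W (h i) \<omega>)" "\<forall>i<n. h i \<in> L2 lborel"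
    and Y: "Y = (\<lambda>\<omega>. \<Sum>i<(m::nat). b i * W (g i) \<omega>)" "\<forall>i<m. g i \<in> L2 lborel"
    unfolding gaussian_span_def by blast
  define c where "c i = (if i < n then a i else b (i - n))" for i
  define k where "k i = (if i < n then h i else g (i - n))" for i
  have "(\<Sum>i<n + m. c i * W (k i) \<omega>) = X \<omega> + Y \<omega>" for \<omega>
  proof -
    have "(\<Sum>i<n + m. c i * W (k i) \<omega>) = (\<Sum>i<n. c i * W (k i) \<omega>) + (\<Sum>i<m. c (n + i) * W (k (n + i)) \<omega>)"
      by (induction m) (simp_all add: add.assoc)
    then show ?thesis by (simp add: X Y c_def k_def)
  qed
  moreover have "\<forall>i<n + m. k i \<in> L2 lborel" using X Y by (auto simp: k_def)
  ultimately show "(\<lambda>\<omega>. X \<omega> + Y \<omega>) \<in> gaussian_span W"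
    unfolding gaussian_span_def mem_Collect_eq
    by (intro exI[of _ "n + m"] exI[of _ c] exI[of _ k]) (simp add: fun_eq_iff)
next
  fix X :: "'a \<Rightarrow> real" and c :: real assume "X \<in> gaussian_span W"
  then obtain n a h where X: "X = (\<lambda>\<omega>. \<Sum>i<(n::nat). a i * W (h i) \<omega>)" "\<forall>i<n. h i \<in> L2 lborel"
    unfolding gaussian_span_def by blast
  then show "(\<lambda>\<omega>. c * X \<omega>) \<in> gaussian_span W"
    unfolding gaussian_span_def mem_Collect_eq
    by (intro exI[of _ n] exI[of _ "\<lambda>i. c * a i"] exI[of _ h]) (simp add: fun_eq_iff sum_distrib_left mult_ac)
qed

lemma indicator_L2:
  assumes "A \<in> sets M" "emeasure M A < \<infinity>"
  shows "(indicator A :: 'a \<Rightarrow> real) \<in> L2 M"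
proof -
  have "integrable M (indicator A :: 'a \<Rightarrow> real)" using assms by simp
  moreover have "(\<lambda>x. (indicator A x :: real)\<^sup>2) = indicator A"
    by (auto simp: fun_eq_iff indicator_def)
  ultimately show ?thesis using assms by (simp add: L2_def)
qed

lemma integral_box_product:
  assumes "\<And>j. j < q \<Longrightarrow> A j \<in> sets lborel \<and> emeasure lborel (A j) < \<infinity>"
    and "\<And>j. j < q \<Longrightarrow> B j \<in> sets lborel \<and> emeasure lborel (B j) < \<infinity>"
  shows "integrable (lebesgue_pow q) (\<lambda>\<psi>. (\<Prod>j<q. indicator (A j) (\<psi> j)) * (\<Prod>j<q. indicator (B j) (\<psi> j)) :: real)" (is "integrable _ ?f")
    and "(\<integral>\<psi>. (\<Prod>j<q. indicator (A j) (\<psi> j)) * (\<Prod>j<q. indicator (B j) (\<psi> j)) \<partial>lebesgue_pow q) =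
      (\<Prod>j<q. \<integral>x. indicator (A j) x * indicator (B j) x \<partial>lborel :: real)"
proof -
  interpret product_sigma_finite "\<lambda>_ :: nat. lborel :: real measure" by standard
  have i: "integrable lborel (\<lambda>x. indicator (A j) x * indicator (B j) x :: real)" if "j < q" for j
  proof -
    have "emeasure lborel (A j \<inter> B j) \<le> emeasure lborel (A j)"
      using assms that by (intro emeasure_mono) auto
    then have "emeasure lborel (A j \<inter> B j) < \<infinity>" using assms(1)[OF that] by (auto simp: top_unique less_top)
    then show ?thesis
      unfolding indicator_inter_arith[symmetric] using assms that by (intro integrable_real_indicator) auto
  qed
  have f: "?f = (\<lambda>\<psi>. \<Prod>j<q. indicator (A j) (\<psi> j) * indicator (B j) (\<psi> j))"
    by (simp add: prod.distrib)
  show "integrable (lebesgue_pow q) ?f"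
    unfolding f lebesgue_pow_def using i by (intro product_integrable_prod) auto
  show "(\<integral>\<psi>. ?f \<psi> \<partial>lebesgue_pow q) = (\<Prod>j<q. \<integral>x. indicator (A j) x * indicator (B j) x \<partial>lborel)"
    unfolding f lebesgue_pow_def using i by (intro product_integral_prod) auto
qed

section \<open>The contraction property of multiple Wiener integrals\<close>

text \<open>The two families of boxes are separate because a sum of boxes will be paired with the
  one obtained by permuting their sides.\<close>

lemma integral_box_sums:
  fixes A B :: "nat \<Rightarrow> nat \<Rightarrow> real set" and a b :: "nat \<Rightarrow> real"
  assumes "\<And>i j. i < n \<Longrightarrow> j < q \<Longrightarrow> A i j \<in> sets lborel \<and> emeasure lborel (A i j) < \<infinity>"
    and "\<And>k j. k < m \<Longrightarrow> j < q \<Longrightarrow> B k j \<in> sets lborel \<and> emeasure lborel (B k j) < \<infinity>"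
  defines "f \<equiv> \<lambda>\<psi>. \<Sum>i<n. a i * (\<Prod>j<q. indicator (A i j) (\<psi> j))"
    and "g \<equiv> \<lambda>\<psi>. \<Sum>k<m. b k * (\<Prod>j<q. indicator (B k j) (\<psi> j))"
  shows "integrable (lebesgue_pow q) (\<lambda>\<psi>. f \<psi> * g \<psi>)"
    and "(\<integral>\<psi>. f \<psi> * g \<psi> \<partial>lebesgue_pow q) =
      (\<Sum>i<n. \<Sum>k<m. a i * b k * (\<Prod>j<q. \<integral>x. indicator (A i j) x * indicator (B k j) x \<partial>lborel))"
proof -
  have fg: "(\<lambda>\<psi>. f \<psi> * g \<psi>) = (\<lambda>\<psi>. \<Sum>i<n. \<Sum>k<m. a i * b k *
      ((\<Prod>j<q. indicator (A i j) (\<psi> j)) * (\<Prod>j<q. indicator (B k j) (\<psi> j))))"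
    by (simp add: f_def g_def sum_product mult_ac)
  show "integrable (lebesgue_pow q) (\<lambda>\<psi>. f \<psi> * g \<psi>)"
    unfolding fg using assms(1,2)
    by (intro Bochner_Integration.integrable_sum integrable_mult_right integral_box_product(1)) auto
  show "(\<integral>\<psi>. f \<psi> * g \<psi> \<partial>lebesgue_pow q) =
      (\<Sum>i<n. \<Sum>k<m. a i * b k * (\<Prod>j<q. \<integral>x. indicator (A i j) x * indicator (B k j) x \<partial>lborel))"
    unfolding fg using assms(1,2)
    by (subst Bochner_Integration.integral_sum,
        (intro Bochner_Integration.integrable_sum integrable_mult_right integral_box_product(1); auto),
        intro sum.cong refl, subst Bochner_Integration.integral_sum,
        (intro integrable_mult_right integral_box_product(1); auto),
        intro sum.cong refl, simp add: integral_box_product(2))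
qed

lemma elementary_fun_nth:
  "elementary_fun q F \<psi> = (\<Sum>i<length F. fst (F ! i) * (\<Prod>j<q. indicator (snd (F ! i) j) (\<psi> j)))"
  unfolding elementary_fun_def by (simp add: sum_list_sum_nth atLeast0LessThan case_prod_unfold)

lemma elementary_integral_nth:
  "elementary_integral W q F \<omega> = (\<Sum>i<length F. fst (F ! i) * (\<Prod>j<q. W (indicator (snd (F ! i) j)) \<omega>))"
  unfolding elementary_integral_def by (simp add: sum_list_sum_nth atLeast0LessThan case_prod_unfold)

lemma elementary_fun_measurable:
  assumes "off_diagonal q F"
  shows "elementary_fun q F \<in> borel_measurable (lebesgue_pow q)"
proof -
  have A: "snd (F ! i) j \<in> sets borel" if "i < length F" "j < q" for i j
    using assms nth_mem[OF that(1)] that(2) unfolding off_diagonal_def by fastforce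
  have "(\<lambda>\<psi>. indicator (snd (F ! i) j) (\<psi> j) :: real) \<in> borel_measurable (lebesgue_pow q)"
    if "i < length F" "j < q" for i j
    unfolding lebesgue_pow_def
    by (rule measurable_compose[OF measurable_component_singleton]) (use A that in auto)
  then show ?thesis
    unfolding elementary_fun_nth[abs_def] by measurable
qed

text \<open>By the pairing formula the second moment is the sum over permutations \<sigma> of the
  inner products of \<open>f\<close> with \<open>f\<close> after permuting coordinates. Each is at
  most the squared norm of \<open>f\<close>, which yields the factor q!, written as a cardinality.
  No symmetry of \<open>f\<close> is involved.\<close>

lemma elementary_integral_bound:
  assumes "prob_space M" "isonormal M W" "off_diagonal q F"
  shows "elementary_integral W q F \<in> borel_measurable M"
    and "(\<integral>\<^sup>+\<omega>. ennreal ((elementary_integral W q F \<omega>)\<^sup>2) \<partial>M) \<le>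
      ennreal (real (card (bijections q {..<q}))) * (\<integral>\<^sup>+\<psi>. ennreal ((elementary_fun q F \<psi>)\<^sup>2) \<partial>lebesgue_pow q)"
proof -
  interpret gaussian_space M "gaussian_span W"
    using assms by (intro gaussian_space_isonormal)
  define n a A where "n = length F" and "a i = fst (F ! i)" and "A i = snd (F ! i)" for i
  define \<mu> where "\<mu> B C = (\<integral>x. indicator B x * indicator C x \<partial>lborel :: real)" for B C :: "real set"
  define X where "X i j = W (indicator (A i j))" for i j
  have I: "elementary_integral W q F = (\<lambda>\<omega>. \<Sum>i<n. a i * (\<Prod>j<q. X i j \<omega>))"
    by (simp add: elementary_integral_nth fun_eq_iff n_def a_def A_def X_def)
  \<comment> \<open>\<open>f \<sigma>\<close> has the same boxes with sides permuted by \<sigma>;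
    the identity gives back the given elementary function.\<close>
  define f where "f \<sigma> \<psi> = (\<Sum>i<n. a i * (\<Prod>j<q. indicator (A i (\<sigma> j)) (\<psi> j)))" for \<sigma> and \<psi> :: "nat \<Rightarrow> real"
  have F: "elementary_fun q F = f (\<lambda>j. j)"
    by (simp add: elementary_fun_nth fun_eq_iff n_def a_def A_def f_def)
  have nth: "(a i, A i) \<in> set F" if "i < n" for i
    using that by (simp add: a_def A_def n_def)
  have A: "A i j \<in> sets lborel \<and> emeasure lborel (A i j) < \<infinity>" if "i < n" "j < q" for i j
    using assms(3) nth[OF that(1)] that(2) unfolding off_diagonal_def by blast
  have disj: "disjoint_family_on (A i) {..<q}" if "i < n" for i
    using assms(3) nth[OF that(1)] unfolding off_diagonal_def by blast
  have L2: "indicator (A i j) \<in> L2 lborel" if "i < n" "j < q" for i j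
    using A[OF that] by (intro indicator_L2) auto
  have X: "X i j \<in> gaussian_span W" if "i < n" "j < q" for i j
    unfolding X_def by (intro gaussian_span_base L2 that)
  have cov: "expectation (\<lambda>\<omega>. X i j \<omega> * X k l \<omega>) = \<mu> (A i j) (A k l)"
    if "i < n" "j < q" "k < n" "l < q" for i j k l
    using assms(2) L2 that unfolding isonormal_def X_def \<mu>_def by blast
  \<comment> \<open>Here the boxes must avoid the diagonals: disjoint sides give uncorrelated
    variables, as the pairing formula requires within each factor.\<close>
  have cov0: "expectation (\<lambda>\<omega>. X i j \<omega> * X i l \<omega>) = 0" if "i < n" "j < q" "l < q" "j \<noteq> l" for i j l
  proof -
    have "A i j \<inter> A i l = {}" using disj[OF that(1)] that by (auto simp: disjoint_family_on_def)
    then have "(\<lambda>x. indicator (A i j) x * indicator (A i l) x) = (\<lambda>x. 0 :: real)"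
      by (auto simp: indicator_def fun_eq_iff)
    then show ?thesis using cov[of i j i l] that unfolding \<mu>_def by simp
  qed
  have P: "has_moments M (\<lambda>\<omega>. \<Prod>j<q. X i j \<omega>)" if "i < n" for i
    using X that by (intro has_moments_prod moments) auto
  show meas: "elementary_integral W q F \<in> borel_measurable M"
    unfolding I using P
    by (intro borel_measurable_sum borel_measurable_times borel_measurable_const has_moments_measurable) auto
  have sq: "(elementary_integral W q F \<omega>)\<^sup>2 = (\<Sum>i<n. \<Sum>k<n. a i * a k * ((\<Prod>j<q. X i j \<omega>) * (\<Prod>j<q. X k j \<omega>)))" for \<omega>
    by (simp add: I power2_eq_square sum_product mult_ac)
  have int: "integrable M (\<lambda>\<omega>. a i * a k * ((\<Prod>j<q. X i j \<omega>) * (\<Prod>j<q. X k j \<omega>)))" if "i < n" "k < n" for i k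
    using P that by (intro integrable_mult_right has_moments_integrable has_moments_mult) auto
  have int_sq: "integrable M (\<lambda>\<omega>. (elementary_integral W q F \<omega>)\<^sup>2)"
    unfolding sq using int by (intro Bochner_Integration.integrable_sum) auto
  let ?S = "bijections q {..<q}"
  have bij: "bij_betw \<sigma> {..<q} {..<q}" if "\<sigma> \<in> ?S" for \<sigma>
    using that by (simp add: bijections_def)
  have \<sigma>q: "\<sigma> j < q" if "\<sigma> \<in> ?S" "j < q" for \<sigma> j
    using bij_betwE[OF bij[OF that(1)]] that(2) by auto
  have ff: "integrable (lebesgue_pow q) (\<lambda>\<psi>. f \<sigma> \<psi> * f \<tau> \<psi>)"
     "(\<integral>\<psi>. f \<sigma> \<psi> * f \<tau> \<psi> \<partial>lebesgue_pow q) = (\<Sum>i<n. \<Sum>k<n. a i * a k * (\<Prod>j<q. \<mu> (A i (\<sigma> j)) (A k (\<tau> j))))"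
    if "\<And>j. j < q \<Longrightarrow> \<sigma> j < q" "\<And>j. j < q \<Longrightarrow> \<tau> j < q" for \<sigma> \<tau>
    unfolding f_def \<mu>_def using A that
    by (intro integral_box_sums[where A = "\<lambda>i j. A i (\<sigma> j)" and B = "\<lambda>i j. A i (\<tau> j)"]; auto)+
  have "expectation (\<lambda>\<omega>. (elementary_integral W q F \<omega>)\<^sup>2) =
      (\<Sum>i<n. \<Sum>k<n. a i * a k * expectation (\<lambda>\<omega>. (\<Prod>j<q. X i j \<omega>) * (\<Prod>j<q. X k j \<omega>)))"
    unfolding sq
    by (subst Bochner_Integration.integral_sum, (intro Bochner_Integration.integrable_sum int; simp),
        intro sum.cong refl, subst Bochner_Integration.integral_sum, (intro int; simp), simp)
  also have "\<dots> = (\<Sum>i<n. \<Sum>k<n. a i * a k * (\<Sum>\<sigma>\<in>?S. \<Prod>j<q. \<mu> (A i j) (A k (\<sigma> j))))"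
  proof (intro sum.cong refl arg_cong2[where f = "(*)"])
    fix i k assume ik: "i \<in> {..<n}" "k \<in> {..<n}"
    have "expectation (\<lambda>\<omega>. (\<Prod>j<q. X i j \<omega>) * (\<Prod>j<q. X k j \<omega>)) =
        (\<Sum>\<sigma>\<in>?S. \<Prod>j<q. expectation (\<lambda>\<omega>. X i j \<omega> * X k (\<sigma> j) \<omega>))"
      using ik X cov0 by (intro pairing_formula) auto
    also have "\<dots> = (\<Sum>\<sigma>\<in>?S. \<Prod>j<q. \<mu> (A i j) (A k (\<sigma> j)))"
      using ik \<sigma>q by (intro sum.cong prod.cong refl cov) auto
    finally show "expectation (\<lambda>\<omega>. (\<Prod>j<q. X i j \<omega>) * (\<Prod>j<q. X k j \<omega>)) = (\<Sum>\<sigma>\<in>?S. \<Prod>j<q. \<mu> (A i j) (A k (\<sigma> j)))" .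
  qed
  also have "\<dots> = (\<Sum>\<sigma>\<in>?S. \<Sum>i<n. \<Sum>k<n. a i * a k * (\<Prod>j<q. \<mu> (A i j) (A k (\<sigma> j))))"
    by (simp add: sum_distrib_left sum.swap[where B = ?S])
  also have "\<dots> = (\<Sum>\<sigma>\<in>?S. \<integral>\<psi>. f (\<lambda>j. j) \<psi> * f \<sigma> \<psi> \<partial>lebesgue_pow q)"
    by (intro sum.cong refl, subst ff(2)) (use \<sigma>q in auto)
  also have "\<dots> \<le> (\<Sum>\<sigma>\<in>?S. \<integral>\<psi>. f (\<lambda>j. j) \<psi> * f (\<lambda>j. j) \<psi> \<partial>lebesgue_pow q)"
  proof (rule sum_mono)
    fix \<sigma> assume \<sigma>: "\<sigma> \<in> ?S"
    let ?id = "\<lambda>j :: nat. j"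
    have i: "integrable (lebesgue_pow q) (\<lambda>\<psi>. f ?id \<psi> * f \<sigma> \<psi>)" "integrable (lebesgue_pow q) (\<lambda>\<psi>. f ?id \<psi> * f ?id \<psi>)"
        "integrable (lebesgue_pow q) (\<lambda>\<psi>. f \<sigma> \<psi> * f \<sigma> \<psi>)"
      using \<sigma>q[OF \<sigma>] by (intro ff(1); simp)+
    have "(\<integral>\<psi>. f ?id \<psi> * f \<sigma> \<psi> \<partial>lebesgue_pow q) \<le>
        (\<integral>\<psi>. 1 / 2 * (f ?id \<psi> * f ?id \<psi>) + 1 / 2 * (f \<sigma> \<psi> * f \<sigma> \<psi>) \<partial>lebesgue_pow q)"
    proof (intro integral_mono Bochner_Integration.integrable_add integrable_mult_right i)
      fix \<psi>
      show "f ?id \<psi> * f \<sigma> \<psi> \<le> 1 / 2 * (f ?id \<psi> * f ?id \<psi>) + 1 / 2 * (f \<sigma> \<psi> * f \<sigma> \<psi>)"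
        using sum_squares_bound[of "f ?id \<psi>" "f \<sigma> \<psi>"] by (simp add: power2_eq_square)
    qed
    also have "\<dots> = 1 / 2 * (\<integral>\<psi>. f ?id \<psi> * f ?id \<psi> \<partial>lebesgue_pow q) + 1 / 2 * (\<integral>\<psi>. f \<sigma> \<psi> * f \<sigma> \<psi> \<partial>lebesgue_pow q)"
      using i by simp
    \<comment> \<open>Permuting the sides of both boxes by the same \<sigma> only reorders the
      product of one-dimensional integrals, so the norm is unchanged.\<close>
    also have "(\<integral>\<psi>. f \<sigma> \<psi> * f \<sigma> \<psi> \<partial>lebesgue_pow q) = (\<integral>\<psi>. f ?id \<psi> * f ?id \<psi> \<partial>lebesgue_pow q)"
    proof -
      have "(\<Prod>j<q. \<mu> (A i (\<sigma> j)) (A k (\<sigma> j))) = (\<Prod>j<q. \<mu> (A i j) (A k j))" for i k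
        by (rule prod.reindex_bij_betw[OF bij[OF \<sigma>], where g = "\<lambda>j. \<mu> (A i j) (A k j)"])
      then show ?thesis using \<sigma>q[OF \<sigma>] by (simp add: ff(2))
    qed
    finally show "(\<integral>\<psi>. f ?id \<psi> * f \<sigma> \<psi> \<partial>lebesgue_pow q) \<le> (\<integral>\<psi>. f ?id \<psi> * f ?id \<psi> \<partial>lebesgue_pow q)"
      by simp
  qed
  also have "\<dots> = real (card ?S) * (\<integral>\<psi>. (elementary_fun q F \<psi>)\<^sup>2 \<partial>lebesgue_pow q)"
    by (simp add: F power2_eq_square)
  finally have le: "expectation (\<lambda>\<omega>. (elementary_integral W q F \<omega>)\<^sup>2) \<le> \<dots>" .
  have "integrable (lebesgue_pow q) (\<lambda>\<psi>. (elementary_fun q F \<psi>)\<^sup>2)"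
    using ff(1)[of "\<lambda>j. j" "\<lambda>j. j"] by (simp add: F power2_eq_square)
  with le int_sq show "(\<integral>\<^sup>+\<omega>. ennreal ((elementary_integral W q F \<omega>)\<^sup>2) \<partial>M) \<le>
      ennreal (real (card ?S)) * (\<integral>\<^sup>+\<psi>. ennreal ((elementary_fun q F \<psi>)\<^sup>2) \<partial>lebesgue_pow q)"
    by (simp add: nn_integral_eq_integral ennreal_mult[symmetric])
qed

section \<open>Mean-square limits and linearity of the multiple integral\<close>

lemma nn_integral_square_add:
  fixes f g :: "'a \<Rightarrow> real"
  assumes [measurable]: "f \<in> borel_measurable M" "g \<in> borel_measurable M"
  shows "(\<integral>\<^sup>+x. ennreal ((f x + g x)\<^sup>2) \<partial>M) \<le>
    2 * (\<integral>\<^sup>+x. ennreal ((f x)\<^sup>2) \<partial>M) + 2 * (\<integral>\<^sup>+x. ennreal ((g x)\<^sup>2) \<partial>M)"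
proof -
  have "(\<integral>\<^sup>+x. ennreal ((f x + g x)\<^sup>2) \<partial>M) \<le> (\<integral>\<^sup>+x. 2 * ennreal ((f x)\<^sup>2) + 2 * ennreal ((g x)\<^sup>2) \<partial>M)"
  proof (rule nn_integral_mono)
    fix x
    have "(f x + g x)\<^sup>2 \<le> 2 * (f x)\<^sup>2 + 2 * (g x)\<^sup>2"
      using sum_squares_bound[of "f x" "g x"] by (simp add: power2_sum)
    then have "ennreal ((f x + g x)\<^sup>2) \<le> ennreal (2 * (f x)\<^sup>2 + 2 * (g x)\<^sup>2)" by (rule ennreal_leI)
    also have "\<dots> = 2 * ennreal ((f x)\<^sup>2) + 2 * ennreal ((g x)\<^sup>2)"
      by (simp add: ennreal_plus ennreal_mult)
    finally show "ennreal ((f x + g x)\<^sup>2) \<le> 2 * ennreal ((f x)\<^sup>2) + 2 * ennreal ((g x)\<^sup>2)" .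
  qed
  also have "\<dots> = 2 * (\<integral>\<^sup>+x. ennreal ((f x)\<^sup>2) \<partial>M) + 2 * (\<integral>\<^sup>+x. ennreal ((g x)\<^sup>2) \<partial>M)"
    by (subst nn_integral_add) (auto simp: nn_integral_cmult)
  finally show ?thesis .
qed

lemma L2_converges_add:
  assumes "L2_converges M F f" "L2_converges M G g"
    and [measurable]: "\<And>n. F n \<in> borel_measurable M" "\<And>n. G n \<in> borel_measurable M"
      "f \<in> borel_measurable M" "g \<in> borel_measurable M"
  shows "L2_converges M (\<lambda>n x. F n x + G n x) (\<lambda>x. f x + g x)"
  unfolding L2_converges_def
proof (rule tendsto_sandwich[OF _ _ tendsto_const])
  have "((\<lambda>n. 2 * (\<integral>\<^sup>+x. ennreal ((F n x - f x)\<^sup>2) \<partial>M) + 2 * (\<integral>\<^sup>+x. ennreal ((G n x - g x)\<^sup>2) \<partial>M))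
     \<longlongrightarrow> 2 * 0 + 2 * 0) sequentially"
    using assms(1,2) unfolding L2_converges_def
    by (intro tendsto_add tendsto_mult_ennreal tendsto_const) auto
  then show "(\<lambda>n. 2 * (\<integral>\<^sup>+x. ennreal ((F n x - f x)\<^sup>2) \<partial>M) + 2 * (\<integral>\<^sup>+x. ennreal ((G n x - g x)\<^sup>2) \<partial>M)) \<longlonglongrightarrow> 0"
    by simp
  show "\<forall>\<^sub>F n in sequentially. (\<integral>\<^sup>+x. ennreal ((F n x + G n x - (f x + g x))\<^sup>2) \<partial>M) \<le>
    2 * (\<integral>\<^sup>+x. ennreal ((F n x - f x)\<^sup>2) \<partial>M) + 2 * (\<integral>\<^sup>+x. ennreal ((G n x - g x)\<^sup>2) \<partial>M)"
    using nn_integral_square_add[of "\<lambda>x. F _ x - f x" M "\<lambda>x. G _ x - g x"]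
    by (intro always_eventually allI) (simp add: algebra_simps)
qed simp

lemma L2_converges_cmult:
  assumes "L2_converges M F f"
    and [measurable]: "\<And>n. F n \<in> borel_measurable M" "f \<in> borel_measurable M"
  shows "L2_converges M (\<lambda>n x. c * F n x) (\<lambda>x. c * f x)"
proof -
  have "(\<integral>\<^sup>+x. ennreal ((c * F n x - c * f x)\<^sup>2) \<partial>M) = ennreal (c\<^sup>2) * (\<integral>\<^sup>+x. ennreal ((F n x - f x)\<^sup>2) \<partial>M)" for n
    by (subst nn_integral_cmult[symmetric])
       (auto simp: ennreal_mult[symmetric] power_mult_distrib[symmetric] right_diff_distrib)
  moreover have "((\<lambda>n. ennreal (c\<^sup>2) * (\<integral>\<^sup>+x. ennreal ((F n x - f x)\<^sup>2) \<partial>M)) \<longlongrightarrow> ennreal (c\<^sup>2) * 0) sequentially"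
    using assms(1) unfolding L2_converges_def by (intro tendsto_mult_ennreal tendsto_const) auto
  ultimately show ?thesis unfolding L2_converges_def by simp
qed

lemma L2_add: "f \<in> L2 M \<Longrightarrow> g \<in> L2 M \<Longrightarrow> (\<lambda>x. f x + g x) \<in> L2 M"
  unfolding L2_def
proof safe
  assume [measurable]: "f \<in> borel_measurable M" "g \<in> borel_measurable M"
    and i: "integrable M (\<lambda>x. (f x)\<^sup>2)" "integrable M (\<lambda>x. (g x)\<^sup>2)"
  show "(\<lambda>x. f x + g x) \<in> borel_measurable M" by measurable
  have "integrable M (\<lambda>x. 2 * (f x)\<^sup>2 + 2 * (g x)\<^sup>2)" using i by simp
  then show "integrable M (\<lambda>x. (f x + g x)\<^sup>2)"
  proof (rule Bochner_Integration.integrable_bound)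
    show "AE x in M. norm ((f x + g x)\<^sup>2) \<le> norm (2 * (f x)\<^sup>2 + 2 * (g x)\<^sup>2)"
    proof (rule AE_I2)
      fix x
      have "(f x + g x)\<^sup>2 \<le> 2 * (f x)\<^sup>2 + 2 * (g x)\<^sup>2"
        using sum_squares_bound[of "f x" "g x"] by (simp add: power2_sum)
      then show "norm ((f x + g x)\<^sup>2) \<le> norm (2 * (f x)\<^sup>2 + 2 * (g x)\<^sup>2)"
        by simp
    qed
  qed measurable
qed

lemma L2_cmult: "f \<in> L2 M \<Longrightarrow> (\<lambda>x. c * f x) \<in> L2 M"
  by (auto simp: L2_def power_mult_distrib)

text \<open>Elementary functions are encoded as lists, so concatenation adds the functions and the
  integrals exactly, without a common refinement of the boxes.\<close>

lemma multiple_wiener_integral_add: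
  assumes "prob_space M" "isonormal M W"
    and "multiple_wiener_integral M W q f J" "multiple_wiener_integral M W q g K"
  shows "multiple_wiener_integral M W q (\<lambda>\<psi>. f \<psi> + g \<psi>) (\<lambda>\<omega>. J \<omega> + K \<omega>)"
proof -
  obtain F where F: "\<And>n. off_diagonal q (F n)" "L2_converges (lebesgue_pow q) (\<lambda>n. elementary_fun q (F n)) f"
      "L2_converges M (\<lambda>n. elementary_integral W q (F n)) J"
    using assms(3) unfolding multiple_wiener_integral_def by blast
  obtain G where G: "\<And>n. off_diagonal q (G n)" "L2_converges (lebesgue_pow q) (\<lambda>n. elementary_fun q (G n)) g"
      "L2_converges M (\<lambda>n. elementary_integral W q (G n)) K"
    using assms(4) unfolding multiple_wiener_integral_def by blast
  have m: "f \<in> L2 (lebesgue_pow q)" "g \<in> L2 (lebesgue_pow q)" "J \<in> borel_measurable M" "K \<in> borel_measurable M"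
    using assms(3,4) unfolding multiple_wiener_integral_def by auto
  have "off_diagonal q (F n @ G n)" for n
    using F(1)[of n] G(1)[of n] by (auto simp: off_diagonal_def)
  moreover have "L2_converges (lebesgue_pow q) (\<lambda>n. elementary_fun q (F n @ G n)) (\<lambda>\<psi>. f \<psi> + g \<psi>)"
    using L2_converges_add[OF F(2) G(2)] elementary_fun_measurable F(1) G(1) m
    by (simp add: elementary_fun_def[abs_def] L2_def)
  moreover have "L2_converges M (\<lambda>n. elementary_integral W q (F n @ G n)) (\<lambda>\<omega>. J \<omega> + K \<omega>)"
    using L2_converges_add[OF F(3) G(3)] elementary_integral_bound(1)[OF assms(1,2)] F(1) G(1) m
    by (simp add: elementary_integral_def[abs_def])
  ultimately show ?thesis
    unfolding multiple_wiener_integral_def using m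
    by (intro conjI L2_add borel_measurable_add exI[of _ "\<lambda>n. F n @ G n"]) auto
qed

lemma multiple_wiener_integral_cmult:
  assumes "prob_space M" "isonormal M W" "multiple_wiener_integral M W q f J"
  shows "multiple_wiener_integral M W q (\<lambda>\<psi>. c * f \<psi>) (\<lambda>\<omega>. c * J \<omega>)"
proof -
  obtain F where F: "\<And>n. off_diagonal q (F n)" "L2_converges (lebesgue_pow q) (\<lambda>n. elementary_fun q (F n)) f"
      "L2_converges M (\<lambda>n. elementary_integral W q (F n)) J"
    using assms(3) unfolding multiple_wiener_integral_def by blast
  have m: "f \<in> L2 (lebesgue_pow q)" "J \<in> borel_measurable M"
    using assms(3) unfolding multiple_wiener_integral_def by auto
  define G where "G n = map (\<lambda>(a, A). (c * a, A)) (F n)" for n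
  have ef: "elementary_fun q (G n) = (\<lambda>\<psi>. c * elementary_fun q (F n) \<psi>)" for n
    by (simp add: elementary_fun_def fun_eq_iff G_def sum_list_const_mult[symmetric] comp_def case_prod_unfold mult_ac)
  have ei: "elementary_integral W q (G n) = (\<lambda>\<omega>. c * elementary_integral W q (F n) \<omega>)" for n
    by (simp add: elementary_integral_def fun_eq_iff G_def sum_list_const_mult[symmetric] comp_def case_prod_unfold mult_ac)
  have "off_diagonal q (G n)" for n
    using F(1)[of n] by (auto simp: off_diagonal_def G_def)
  moreover have "L2_converges (lebesgue_pow q) (\<lambda>n. elementary_fun q (G n)) (\<lambda>\<psi>. c * f \<psi>)"
    unfolding ef using elementary_fun_measurable F(1) m
    by (intro L2_converges_cmult F(2)) (auto simp: L2_def)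
  moreover have "L2_converges M (\<lambda>n. elementary_integral W q (G n)) (\<lambda>\<omega>. c * J \<omega>)"
    unfolding ei using elementary_integral_bound(1)[OF assms(1,2)] F(1) m
    by (intro L2_converges_cmult F(3)) auto
  ultimately show ?thesis
    unfolding multiple_wiener_integral_def using m
    by (intro conjI L2_cmult borel_measurable_times borel_measurable_const exI[of _ G]) auto
qed

lemma multiple_wiener_integral_zero: 
  "multiple_wiener_integral M W q (\<lambda>\<psi>. 0) (\<lambda>\<omega>. 0)"
  unfolding multiple_wiener_integral_def
  by (auto simp: L2_def L2_converges_def elementary_fun_def elementary_integral_def off_diagonal_def
      intro!: exI[of _ "\<lambda>_. []"])

lemma multiple_wiener_integral_sum:
  assumes "prob_space M" "isonormal M W"
    and "\<And>k :: nat. k < n \<Longrightarrow> multiple_wiener_integral M W q (f k) (J k)"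
  shows "multiple_wiener_integral M W q (\<lambda>\<psi>. \<Sum>k<n. f k \<psi>) (\<lambda>\<omega>. \<Sum>k<n. J k \<omega>)"
  using assms(3)
  by (induction n) (auto intro: multiple_wiener_integral_zero multiple_wiener_integral_add[OF assms(1,2)])

lemma multiple_wiener_integral_diff:
  assumes "prob_space M" "isonormal M W"
    and "multiple_wiener_integral M W q f J" "multiple_wiener_integral M W q g K"
  shows "multiple_wiener_integral M W q (\<lambda>\<psi>. f \<psi> - g \<psi>) (\<lambda>\<omega>. J \<omega> - K \<omega>)"
  using multiple_wiener_integral_add[OF assms(1,2,3) multiple_wiener_integral_cmult[OF assms(1,2,4), of "-1"]]
  by simp

text \<open>The factor \<open>4\<close>, lost by using \<open>(a + b)\<^sup>2 \<le> 2 a\<^sup>2 + 2 b\<^sup>2\<close> in the limit, is immaterial.\<close>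

lemma multiple_wiener_integral_bound:
  assumes "prob_space M" "isonormal M W" "multiple_wiener_integral M W q f J"
  shows "(\<integral>\<^sup>+\<omega>. ennreal ((J \<omega>)\<^sup>2) \<partial>M) \<le>
    4 * ennreal (real (card (bijections q {..<q}))) * (\<integral>\<^sup>+\<psi>. ennreal ((f \<psi>)\<^sup>2) \<partial>lebesgue_pow q)"
proof -
  let ?N = "ennreal (real (card (bijections q {..<q})))"
  obtain F where F: "\<And>n. off_diagonal q (F n)" "L2_converges (lebesgue_pow q) (\<lambda>n. elementary_fun q (F n)) f"
      "L2_converges M (\<lambda>n. elementary_integral W q (F n)) J"
    using assms(3) unfolding multiple_wiener_integral_def by blast
  have [measurable]: "f \<in> borel_measurable (lebesgue_pow q)" "J \<in> borel_measurable M"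
    using assms(3) unfolding multiple_wiener_integral_def L2_def by auto
  have [measurable]: "elementary_integral W q (F n) \<in> borel_measurable M"
      "elementary_fun q (F n) \<in> borel_measurable (lebesgue_pow q)" for n
    using elementary_integral_bound(1)[OF assms(1,2) F(1)] elementary_fun_measurable[OF F(1)] by auto
  define d e where "d n = (\<integral>\<^sup>+\<psi>. ennreal ((elementary_fun q (F n) \<psi> - f \<psi>)\<^sup>2) \<partial>lebesgue_pow q)"
    and "e n = (\<integral>\<^sup>+\<omega>. ennreal ((elementary_integral W q (F n) \<omega> - J \<omega>)\<^sup>2) \<partial>M)" for n
  let ?f = "\<integral>\<^sup>+\<psi>. ennreal ((f \<psi>)\<^sup>2) \<partial>lebesgue_pow q"
  have bound: "(\<integral>\<^sup>+\<omega>. ennreal ((J \<omega>)\<^sup>2) \<partial>M) \<le> 2 * e n + 2 * (?N * (2 * d n + 2 * ?f))" for n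
  proof -
    have "(\<integral>\<^sup>+\<omega>. ennreal ((J \<omega>)\<^sup>2) \<partial>M) =
        (\<integral>\<^sup>+\<omega>. ennreal (((J \<omega> - elementary_integral W q (F n) \<omega>) + elementary_integral W q (F n) \<omega>)\<^sup>2) \<partial>M)"
      by simp
    also have "\<dots> \<le> 2 * (\<integral>\<^sup>+\<omega>. ennreal ((J \<omega> - elementary_integral W q (F n) \<omega>)\<^sup>2) \<partial>M) +
        2 * (\<integral>\<^sup>+\<omega>. ennreal ((elementary_integral W q (F n) \<omega>)\<^sup>2) \<partial>M)"
      by (rule nn_integral_square_add) measurable
    also have "(\<integral>\<^sup>+\<omega>. ennreal ((J \<omega> - elementary_integral W q (F n) \<omega>)\<^sup>2) \<partial>M) = e n"
      by (simp add: e_def power2_commute)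
    also have "(\<integral>\<^sup>+\<omega>. ennreal ((elementary_integral W q (F n) \<omega>)\<^sup>2) \<partial>M) \<le>
        ?N * (\<integral>\<^sup>+\<psi>. ennreal ((elementary_fun q (F n) \<psi>)\<^sup>2) \<partial>lebesgue_pow q)"
      by (rule elementary_integral_bound(2)[OF assms(1,2) F(1)])
    also have "(\<integral>\<^sup>+\<psi>. ennreal ((elementary_fun q (F n) \<psi>)\<^sup>2) \<partial>lebesgue_pow q) =
       (\<integral>\<^sup>+\<psi>. ennreal (((elementary_fun q (F n) \<psi> - f \<psi>) + f \<psi>)\<^sup>2) \<partial>lebesgue_pow q)"
      by simp
    also have "\<dots> \<le> 2 * d n + 2 * ?f"
      unfolding d_def by (rule nn_integral_square_add) measurable
    finally show ?thesis by (simp add: mult_left_mono add_left_mono)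
  qed
  have "((\<lambda>n. 2 * e n + 2 * (?N * (2 * d n + 2 * ?f))) \<longlongrightarrow> 2 * 0 + 2 * (?N * (2 * 0 + 2 * ?f))) sequentially"
    using F(2,3) unfolding L2_converges_def d_def[symmetric] e_def[symmetric]
    by (intro tendsto_add ennreal_tendsto_cmult tendsto_const) auto
  then have "(\<integral>\<^sup>+\<omega>. ennreal ((J \<omega>)\<^sup>2) \<partial>M) \<le> 2 * 0 + 2 * (?N * (2 * 0 + 2 * ?f))"
    by (rule Lim_bounded2) (use bound in auto)
  also have "\<dots> = 4 * ?N * ?f"
    by (simp add: mult_ac)
  finally show ?thesis .
qed

section \<open>Riemann sums and the Hermite kernel\<close>

text \<open>The integrator \<open>w\<close> is integrated exactly on each piece and only
  \<open>h\<close> is replaced by constants; positivity of \<open>w\<close> turns the oscillation of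
  \<open>h\<close> into an error relative to the integral of \<open>w\<close>. Mere integrability of
  \<open>w\<close> is assumed because the singular Hermite factor will serve as weight, and
  \<open>c\<close> is free so that either endpoint can be sampled.\<close>

lemma riemann_stieltjes_sum_bound:
  fixes w h :: "real \<Rightarrow> real" and \<tau> :: "nat \<Rightarrow> real"
  assumes "\<And>k. k < n \<Longrightarrow> \<tau> k \<le> \<tau> (Suc k)"
    and "\<And>s. s \<in> {\<tau> 0..\<tau> n} \<Longrightarrow> 0 \<le> w s"
    and "w integrable_on {\<tau> 0..\<tau> n}" "(\<lambda>s. h s * w s) integrable_on {\<tau> 0..\<tau> n}"
    and "\<And>k s. k < n \<Longrightarrow> s \<in> {\<tau> k..\<tau> (Suc k)} \<Longrightarrow> \<bar>h s - c k\<bar> \<le> \<eta>"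
  shows "\<bar>integral {\<tau> 0..\<tau> n} (\<lambda>s. h s * w s) - (\<Sum>k<n. c k * integral {\<tau> k..\<tau> (Suc k)} w)\<bar>
    \<le> \<eta> * integral {\<tau> 0..\<tau> n} w"
  using assms
proof (induction n)
  case 0
  then show ?case by simp
next
  case (Suc n)
  have mono: "\<tau> 0 \<le> \<tau> m" if "m \<le> n" for m
    using that
  proof (induction m)
    case (Suc m)
    then show ?case using Suc.prems Suc.IH \<open>\<And>k. k < Suc n \<Longrightarrow> \<tau> k \<le> \<tau> (Suc k)\<close>[of m] by simp
  qed simp
  have le: "\<tau> 0 \<le> \<tau> n" "\<tau> n \<le> \<tau> (Suc n)" using mono Suc.prems(1)[of n] by auto
  have sub: "{\<tau> 0..\<tau> n} \<subseteq> {\<tau> 0..\<tau> (Suc n)}" "{\<tau> n..\<tau> (Suc n)} \<subseteq> {\<tau> 0..\<tau> (Suc n)}"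
    using le by auto
  note int = integrable_on_subinterval[OF Suc.prems(3) sub(1)] integrable_on_subinterval[OF Suc.prems(4) sub(1)]
    integrable_on_subinterval[OF Suc.prems(3) sub(2)] integrable_on_subinterval[OF Suc.prems(4) sub(2)]
  let ?A = "{\<tau> 0..\<tau> n}" and ?B = "{\<tau> n..\<tau> (Suc n)}"
  have IH: "\<bar>integral ?A (\<lambda>s. h s * w s) - (\<Sum>k<n. c k * integral {\<tau> k..\<tau> (Suc k)} w)\<bar> \<le> \<eta> * integral ?A w"
  proof (rule Suc.IH)
    show "0 \<le> w s" if "s \<in> ?A" for s using Suc.prems(2) sub(1) that by blast
  qed (use Suc.prems int in auto)
  have cw: "(\<lambda>s. c n * w s) integrable_on ?B" "(\<lambda>s. \<eta> * w s) integrable_on ?B"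
    by (intro integrable_on_mult_right int(3))+
  have "\<bar>integral ?B (\<lambda>s. h s * w s - c n * w s)\<bar> \<le> integral ?B (\<lambda>s. \<eta> * w s)"
  proof -
    have "norm (integral ?B (\<lambda>s. h s * w s - c n * w s)) \<le> integral ?B (\<lambda>s. \<eta> * w s)"
    proof (rule integral_norm_bound_integral)
      fix s assume s: "s \<in> ?B"
      have "\<bar>(h s - c n) * w s\<bar> \<le> \<eta> * w s"
        using Suc.prems(2)[of s] Suc.prems(5)[of n s] s sub(2) by (auto simp: abs_mult intro!: mult_right_mono)
      then show "norm (h s * w s - c n * w s) \<le> \<eta> * w s"
        by (simp add: left_diff_distrib)
    qed (use int cw in \<open>auto intro: integrable_diff\<close>)
    then show ?thesis by simp
  qed
  then have "\<bar>integral ?B (\<lambda>s. h s * w s) - c n * integral ?B w\<bar> \<le> \<eta> * integral ?B w"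
    using int cw by (simp add: integral_diff)
  moreover have "integral {\<tau> 0..\<tau> (Suc n)} (\<lambda>s. h s * w s) = integral ?A (\<lambda>s. h s * w s) + integral ?B (\<lambda>s. h s * w s)"
    "integral {\<tau> 0..\<tau> (Suc n)} w = integral ?A w + integral ?B w"
    using le Suc.prems(3,4) by (simp_all add: Henstock_Kurzweil_Integration.integral_combine)
  ultimately show ?case using IH by (simp add: algebra_simps)
qed

definition partition_point :: "real \<Rightarrow> nat \<Rightarrow> nat \<Rightarrow> real" where
  "partition_point t n k = t * real k / real n"

lemma partition_point_0 [simp]: "partition_point t n 0 = 0"
  by (simp add: partition_point_def)

lemma partition_point_end: "n > 0 \<Longrightarrow> partition_point t n n = t"
  by (simp add: partition_point_def)

lemma partition_point_mono: "t \<ge> 0 \<Longrightarrow> i \<le> j \<Longrightarrow> partition_point t n i \<le> partition_point t n j"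
  by (auto simp: partition_point_def intro!: divide_right_mono mult_left_mono)

lemma partition_point_mem: "t \<ge> 0 \<Longrightarrow> k \<le> n \<Longrightarrow> partition_point t n k \<in> {0..t}"
  using partition_point_mono[of t 0 k n] partition_point_mono[of t k n n]
  by (cases "n = 0") (auto simp: partition_point_end)

lemma partition_oscillation:
  fixes h :: "real \<Rightarrow> real"
  assumes "continuous_on {0..t} h" "t \<ge> 0" "\<eta> > 0"
  shows "\<forall>\<^sub>F n in sequentially. \<forall>k<n. \<forall>s\<in>{partition_point t n k..partition_point t n (Suc k)}.
    \<forall>r\<in>{partition_point t n k..partition_point t n (Suc k)}. \<bar>h s - h r\<bar> \<le> \<eta>"
proof -
  have "uniformly_continuous_on {0..t} h"
    using assms(1) by (intro compact_uniformly_continuous) auto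
  then obtain d where d: "d > 0" "\<And>s r. s \<in> {0..t} \<Longrightarrow> r \<in> {0..t} \<Longrightarrow> dist r s < d \<Longrightarrow> dist (h r) (h s) < \<eta>"
    using assms(3) unfolding uniformly_continuous_on_def by metis
  have "(\<lambda>n. t / real n) \<longlonglongrightarrow> 0" by (rule lim_const_over_n)
  then have "\<forall>\<^sub>F n in sequentially. t / real n < d" by (rule order_tendstoD(2)[OF _ d(1)])
  then show ?thesis
  proof eventually_elim
    case (elim n)
    show ?case
    proof (intro allI impI ballI)
      fix k s r
      assume k: "k < n" and s: "s \<in> {partition_point t n k..partition_point t n (Suc k)}"
        and r: "r \<in> {partition_point t n k..partition_point t n (Suc k)}"
      have mem: "s \<in> {0..t}" "r \<in> {0..t}"
        using s r k partition_point_mem[of t k n] partition_point_mem[of t "Suc k" n] assms(2) by auto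
      have "partition_point t n (Suc k) - partition_point t n k = t / real n"
        by (simp add: partition_point_def field_simps diff_divide_distrib[symmetric])
      then have "dist s r < d" using s r elim by (auto simp: dist_real_def)
      then show "\<bar>h s - h r\<bar> \<le> \<eta>" using d(2)[OF mem(2,1)] by (simp add: dist_real_def)
    qed
  qed
qed

text \<open>Right endpoints are sampled because summation by parts produces them. The weight 1 gives
  ordinary Riemann sums.\<close>

lemma riemann_stieltjes_limit:
  fixes w h :: "real \<Rightarrow> real"
  assumes t: "t \<ge> 0" and h: "continuous_on {0..t} h" and w: "continuous_on {0..t} w"
    and w0: "\<And>s. s \<in> {0..t} \<Longrightarrow> 0 \<le> w s"
  shows "(\<lambda>n. \<Sum>k<n. h (partition_point t n (Suc k)) *
    integral {partition_point t n k..partition_point t n (Suc k)} w) \<longlonglongrightarrow> integral {0..t} (\<lambda>s. h s * w s)"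
proof (rule LIMSEQ_I)
  fix e :: real assume "e > 0"
  have I0: "integral {0..t} w \<ge> 0"
    using w0 by (intro integral_nonneg integrable_continuous_interval w) auto
  \<comment> \<open>The added 1 keeps the divisor positive when the integral of \<open>w\<close> is
    0.\<close>
  define K where "K = integral {0..t} w + 1"
  have K: "K > 0" using I0 by (simp add: K_def)
  define \<eta> where "\<eta> = e / (2 * K)"
  have \<eta>: "\<eta> > 0" using \<open>e > 0\<close> K by (simp add: \<eta>_def)
  have "\<eta> * integral {0..t} w \<le> \<eta> * K" using \<eta> by (simp add: K_def)
  also have "\<dots> = e / 2" using K by (simp add: \<eta>_def)
  also have "\<dots> < e" using \<open>e > 0\<close> by simp
  finally have \<eta>e: "\<eta> * integral {0..t} w < e" .
  from partition_oscillation[OF h t \<eta>] eventually_gt_at_top[of 0]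
  have "\<forall>\<^sub>F n in sequentially. norm ((\<Sum>k<n. h (partition_point t n (Suc k)) *
    integral {partition_point t n k..partition_point t n (Suc k)} w) - integral {0..t} (\<lambda>s. h s * w s)) < e"
  proof eventually_elim
    case (elim n)
    let ?\<tau> = "partition_point t n"
    have "\<bar>integral {?\<tau> 0..?\<tau> n} (\<lambda>s. h s * w s) - (\<Sum>k<n. h (?\<tau> (Suc k)) * integral {?\<tau> k..?\<tau> (Suc k)} w)\<bar>
        \<le> \<eta> * integral {?\<tau> 0..?\<tau> n} w"
    proof (rule riemann_stieltjes_sum_bound)
      show "w integrable_on {?\<tau> 0..?\<tau> n}" "(\<lambda>s. h s * w s) integrable_on {?\<tau> 0..?\<tau> n}"
        using elim h w by (auto simp: partition_point_end intro!: integrable_continuous_interval continuous_intros)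
    qed (use elim t w0 partition_point_mono[OF t] in \<open>auto simp: partition_point_end\<close>)
    then have "\<bar>integral {0..t} (\<lambda>s. h s * w s) - (\<Sum>k<n. h (?\<tau> (Suc k)) * integral {?\<tau> k..?\<tau> (Suc k)} w)\<bar>
        \<le> \<eta> * integral {0..t} w"
      using elim by (simp add: partition_point_end)
    then show ?case using \<eta>e by (simp add: abs_minus_commute)
  qed
  then show "\<exists>no. \<forall>n\<ge>no. norm ((\<Sum>k<n. h (partition_point t n (Suc k)) *
    integral {partition_point t n k..partition_point t n (Suc k)} w) - integral {0..t} (\<lambda>s. h s * w s)) < e"
    unfolding eventually_sequentially .
qed

text \<open>As a pointwise limit of Riemann sums, the integral is measurable from measurability at
  each fixed time; joint measurability is not assumed.\<close>

lemma borel_measurable_integral_continuous: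
  fixes h :: "real \<Rightarrow> 'a \<Rightarrow> real"
  assumes "\<And>s. s \<in> {0..1} \<Longrightarrow> h s \<in> borel_measurable M"
    and "\<And>\<omega>. \<omega> \<in> space M \<Longrightarrow> continuous_on {0..1} (\<lambda>s. h s \<omega>)"
  shows "(\<lambda>\<omega>. integral {0..1} (\<lambda>s. h s \<omega>)) \<in> borel_measurable M"
proof (rule borel_measurable_LIMSEQ_real)
  fix \<omega> assume "\<omega> \<in> space M"
  then show "(\<lambda>n. \<Sum>k<n. h (partition_point 1 n (Suc k)) \<omega> *
      integral {partition_point 1 n k..partition_point 1 n (Suc k)} (\<lambda>_. 1)) \<longlonglongrightarrow> integral {0..1} (\<lambda>s. h s \<omega>)"
    using riemann_stieltjes_limit[of 1 "\<lambda>s. h s \<omega>" "\<lambda>_. 1"] assms(2) by simp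
next
  fix n
  show "(\<lambda>\<omega>. \<Sum>k<n. h (partition_point 1 n (Suc k)) \<omega> *
      integral {partition_point 1 n k..partition_point 1 n (Suc k)} (\<lambda>_. 1)) \<in> borel_measurable M"
    using assms(1) partition_point_mem[of 1 _ n]
    by (intro borel_measurable_sum borel_measurable_times borel_measurable_const) auto
qed

section \<open>Pathwise integration by parts and the linear equation\<close>

lemma sum_by_parts:
  fixes e z :: "nat \<Rightarrow> real"
  shows "(\<Sum>k<n. e k * (z (Suc k) - z k)) = e n * z n - e 0 * z 0 - (\<Sum>k<n. (e (Suc k) - e k) * z (Suc k))"
  by (induction n) (simp_all add: algebra_simps)

text \<open>Multiplying by \<theta> instead of dividing includes
  \<open>\<theta> = 0\<close>.\<close>

lemma integral_exp:
  fixes \<theta> :: real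
  assumes "a \<le> b"
  shows "\<theta> * integral {a..b} (\<lambda>s. exp (- \<theta> * s)) = exp (- \<theta> * a) - exp (- \<theta> * b)"
proof -
  have "((\<lambda>s. \<theta> * exp (- \<theta> * s)) has_integral (- exp (- \<theta> * b)) - (- exp (- \<theta> * a))) {a..b}"
    using assms by (intro fundamental_theorem_of_calculus)
      (auto intro!: derivative_eq_intros simp: has_real_derivative_iff_has_vector_derivative[symmetric])
  then show ?thesis by (auto dest!: integral_unique)
qed

text \<open>The path \<open>z\<close> is only continuous, so Abel summation moves the increments to
  the exponential, whose increments are integrals of the exponential itself. The term
  \<open>z 0\<close> stays because the Hermite process starts at 0 only almost surely.\<close>

lemma exponential_sum_limit:
  fixes z :: "real \<Rightarrow> real" and \<theta> :: real
  assumes t: "t \<ge> 0" and z: "continuous_on {0..t} z"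
  shows "(\<lambda>n. \<Sum>k<n. exp (- \<theta> * partition_point t n k) * (z (partition_point t n (Suc k)) - z (partition_point t n k)))
    \<longlonglongrightarrow> exp (- \<theta> * t) * z t - z 0 + \<theta> * integral {0..t} (\<lambda>s. exp (- \<theta> * s) * z s)"
proof -
  let ?\<tau> = "partition_point t"
  have "(\<lambda>n. exp (- \<theta> * t) * z t - z 0 + \<theta> * (\<Sum>k<n. z (?\<tau> n (Suc k)) * integral {?\<tau> n k..?\<tau> n (Suc k)} (\<lambda>s. exp (- \<theta> * s))))
      \<longlonglongrightarrow> exp (- \<theta> * t) * z t - z 0 + \<theta> * integral {0..t} (\<lambda>s. z s * exp (- \<theta> * s))"
    using t z by (intro tendsto_add tendsto_mult tendsto_const riemann_stieltjes_limit continuous_intros) auto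
  moreover have "\<forall>\<^sub>F n in sequentially. exp (- \<theta> * t) * z t - z 0 +
      \<theta> * (\<Sum>k<n. z (?\<tau> n (Suc k)) * integral {?\<tau> n k..?\<tau> n (Suc k)} (\<lambda>s. exp (- \<theta> * s))) =
      (\<Sum>k<n. exp (- \<theta> * ?\<tau> n k) * (z (?\<tau> n (Suc k)) - z (?\<tau> n k)))"
    using eventually_gt_at_top[of 0]
  proof eventually_elim
    case (elim n)
    have "\<theta> * (\<Sum>k<n. z (?\<tau> n (Suc k)) * integral {?\<tau> n k..?\<tau> n (Suc k)} (\<lambda>s. exp (- \<theta> * s))) =
        (\<Sum>k<n. z (?\<tau> n (Suc k)) * (\<theta> * integral {?\<tau> n k..?\<tau> n (Suc k)} (\<lambda>s. exp (- \<theta> * s))))"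
      by (simp add: sum_distrib_left mult_ac)
    also have "\<dots> = - (\<Sum>k<n. (exp (- \<theta> * ?\<tau> n (Suc k)) - exp (- \<theta> * ?\<tau> n k)) * z (?\<tau> n (Suc k)))"
      unfolding sum_negf[symmetric]
      by (intro sum.cong refl, subst integral_exp) (auto simp: t partition_point_mono algebra_simps)
    finally show ?case
      using elim sum_by_parts[of "\<lambda>k. exp (- \<theta> * ?\<tau> n k)" "\<lambda>k. z (?\<tau> n k)" n] by (simp add: partition_point_end)
  qed
  ultimately show ?thesis
    by (simp add: tendsto_cong mult.commute[of "z _"])
qed

text \<open>Variation of constants. The integrating factor multiplies the primitive of
  \<open>D\<close> rather than \<open>D\<close>, since \<open>D\<close> inherits from
  \<open>z\<close> no differentiability.\<close>

lemma linear_equation_solution: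
  fixes D z :: "real \<Rightarrow> real"
  assumes D: "continuous_on {0..1} D" and eq: "\<And>t. t \<in> {0..1} \<Longrightarrow> D t = \<theta> * integral {0..t} D + z t"
    and t: "t \<in> {0..1}"
  shows "D t = z t + \<theta> * exp (\<theta> * t) * integral {0..t} (\<lambda>s. exp (- \<theta> * s) * z s)"
proof -
  have "((\<lambda>s. exp (- \<theta> * s) * integral {0..s} D) has_real_derivative exp (- \<theta> * s) * z s) (at s within {0..t})"
    if "s \<in> {0..t}" for s
  proof -
    have "((\<lambda>s. integral {0..s} D) has_real_derivative D s) (at s within {0..t})"
      using t that by (intro integral_has_real_derivative continuous_on_subset[OF D]) auto
    then have "((\<lambda>s. exp (- \<theta> * s) * integral {0..s} D) has_real_derivative
        - \<theta> * exp (- \<theta> * s) * integral {0..s} D + exp (- \<theta> * s) * D s) (at s within {0..t})"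
      by (auto intro!: derivative_eq_intros)
    moreover have "- \<theta> * exp (- \<theta> * s) * integral {0..s} D + exp (- \<theta> * s) * D s = exp (- \<theta> * s) * z s"
      using eq[of s] t that by (simp add: algebra_simps)
    ultimately show ?thesis by simp
  qed
  then have "((\<lambda>s. exp (- \<theta> * s) * z s) has_integral exp (- \<theta> * t) * integral {0..t} D - exp (- \<theta> * 0) * integral {0..0} D) {0..t}"
    using t by (intro fundamental_theorem_of_calculus)
      (auto simp: has_real_derivative_iff_has_vector_derivative[symmetric])
  then have "integral {0..t} (\<lambda>s. exp (- \<theta> * s) * z s) = exp (- \<theta> * t) * integral {0..t} D"
    by (simp add: integral_unique)
  then have "exp (\<theta> * t) * integral {0..t} (\<lambda>s. exp (- \<theta> * s) * z s) = integral {0..t} D"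
    by (simp add: exp_minus)
  then show ?thesis unfolding mult.assoc using eq[OF t] by simp
qed

section \<open>The Hermite kernel at a fixed point\<close>

text \<open>At points \<open>\<psi>\<close> with coinciding coordinates this function of \<open>u\<close> need not be integrable, and then the
  Bochner integral in the kernel is \<open>0\<close>.\<close>

definition hermite_factor :: "nat \<Rightarrow> real \<Rightarrow> (nat \<Rightarrow> real) \<Rightarrow> real \<Rightarrow> real" where
  "hermite_factor q H \<psi> u = (\<Prod>j<q. max 0 (u - \<psi> j) powr (hermite_H0 q H - 3/2))"

lemma hermite_factor_nonneg: "0 \<le> hermite_factor q H \<psi> u"
  by (auto simp: hermite_factor_def intro: prod_nonneg)

lemma hermite_factor_measurable [measurable]: "hermite_factor q H \<psi> \<in> borel_measurable borel"
  unfolding hermite_factor_def[abs_def] by measurable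

text \<open>A nonzero product at \<open>t\<close> means that \<open>t\<close> lies strictly to the
  right of every \<psi> j; from there on each factor is a power with nonpositive exponent of a
  growing positive number.\<close>

lemma hermite_factor_antimono:
  assumes "H < 1" "hermite_factor q H \<psi> t \<noteq> 0" "t \<le> u"
  shows "hermite_factor q H \<psi> u \<le> hermite_factor q H \<psi> t"
  unfolding hermite_factor_def
proof (rule prod_mono)
  fix j assume j: "j \<in> {..<q}"
  have "max 0 (t - \<psi> j) \<noteq> 0"
    using assms(2) j unfolding hermite_factor_def by (metis finite_lessThan powr_0 prod_zero)
  then have "t - \<psi> j > 0" by (auto simp: max_def split: if_splits)
  moreover have "(H - 1) / real q \<le> 0" using assms(1) by (simp add: divide_nonpos_nonneg)
  then have "hermite_H0 q H - 3/2 \<le> 0" unfolding hermite_H0_def by linarith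
  ultimately show "0 \<le> max 0 (u - \<psi> j) powr (hermite_H0 q H - 3/2) \<and>
      max 0 (u - \<psi> j) powr (hermite_H0 q H - 3/2) \<le> max 0 (t - \<psi> j) powr (hermite_H0 q H - 3/2)"
    using assms(3) by (auto intro!: powr_mono2')
qed

text \<open>Since \<open>0 powr a = 0\<close>, a zero at \<open>t\<close> means that some \<psi> j
  is at least \<open>t\<close>, and this persists to the left. Together with monotonicity,
  integrability can fail only just to the right of the largest \<psi> j.\<close>

lemma hermite_factor_zero_left:
  assumes "hermite_factor q H \<psi> t = 0" "u \<le> t"
  shows "hermite_factor q H \<psi> u = 0"
proof -
  obtain j where "j < q" "max 0 (t - \<psi> j) powr (hermite_H0 q H - 3/2) = 0"
    using assms(1) unfolding hermite_factor_def by (auto simp: prod_zero_iff)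
  then have "t \<le> \<psi> j" by (auto simp: max_def split: if_splits)
  then have "max 0 (u - \<psi> j) = 0" using assms(2) by auto
  then show ?thesis using \<open>j < q\<close> unfolding hermite_factor_def by (intro prod_zero bexI[of _ j]) auto
qed

lemma hermite_kernel_eq:
  "hermite_kernel q H f \<psi> = (LBINT u. f u * hermite_factor q H \<psi> u)"
  by (simp add: hermite_kernel_def hermite_factor_def)

text \<open>On a bounded interval the exponential and its reciprocal are bounded. The equivalence is
  needed in full: a failure of integrability must carry over as well, so that both Bochner integrals
  take the value 0.\<close>

lemma set_integrable_exp_iff:
  fixes g :: "real \<Rightarrow> real"
  assumes [measurable]: "g \<in> borel_measurable borel"
  shows "integrable lborel (\<lambda>u. exp (\<theta> * u) * indicator {0..t} u * g u) \<longleftrightarrow> set_integrable lborel {0..t} g"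
proof -
  have bound: "exp (\<theta> * u) \<le> exp (\<bar>\<theta>\<bar> * \<bar>t\<bar>)" if "u \<in> {0..t}" for \<theta> u :: real
  proof -
    have "\<theta> * u \<le> \<bar>\<theta>\<bar> * \<bar>u\<bar>" by (metis abs_ge_self abs_mult)
    also have "\<dots> \<le> \<bar>\<theta>\<bar> * \<bar>t\<bar>" using that by (intro mult_left_mono) auto
    finally show ?thesis by simp
  qed
  have mult: "integrable lborel (\<lambda>u. exp (\<theta> * u) * indicator {0..t} u * f u)"
    if "integrable lborel (\<lambda>u. indicator {0..t} u * f u)" and [measurable]: "f \<in> borel_measurable borel"
    for \<theta> and f :: "real \<Rightarrow> real"
  proof (rule Bochner_Integration.integrable_bound[OF integrable_mult_right[OF that(1), of "exp (\<bar>\<theta>\<bar> * \<bar>t\<bar>)"]])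
    show "AE u in lborel. norm (exp (\<theta> * u) * indicator {0..t} u * f u) \<le>
        norm (exp (\<bar>\<theta>\<bar> * \<bar>t\<bar>) * (indicator {0..t} u * f u))"
      using bound[of _ \<theta>] by (intro AE_I2) (auto simp: indicator_def abs_mult intro!: mult_right_mono)
  qed measurable
  show ?thesis
  proof
    assume "set_integrable lborel {0..t} g"
    then show "integrable lborel (\<lambda>u. exp (\<theta> * u) * indicator {0..t} u * g u)"
      unfolding set_integrable_def by (intro mult) auto
  next
    assume "integrable lborel (\<lambda>u. exp (\<theta> * u) * indicator {0..t} u * g u)"
    then have "integrable lborel (\<lambda>u. indicator {0..t} u * (exp (\<theta> * u) * g u))"
      by (simp add: mult_ac)
    from mult[OF this, of "- \<theta>"]
    have "integrable lborel (\<lambda>u. exp (- \<theta> * u) * indicator {0..t} u * (exp (\<theta> * u) * g u))" by simp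
    moreover have "(\<lambda>u. exp (- \<theta> * u) * indicator {0..t} u * (exp (\<theta> * u) * g u)) = (\<lambda>u. indicator {0..t} u * g u)"
      by (simp add: exp_minus fun_eq_iff)
    ultimately show "set_integrable lborel {0..t} g" by (simp only: set_integrable_def real_scaleR_def)
  qed
qed

text \<open>At each \<psi>, either all kernels for \<open>t\<close> in the unit interval are genuine
  integrals, or all of them are 0. Hence identities between kernels hold at every \<psi>, and no
  null set of bad points has to be identified.\<close>

lemma hermite_kernel_cases:
  fixes \<theta> :: real
  assumes "H < 1"
  obtains (integrable)
    "\<And>t. t \<in> {0..1} \<Longrightarrow> hermite_factor q H \<psi> integrable_on {0..t}"
    "\<And>t. t \<in> {0..1} \<Longrightarrow> (\<lambda>u. exp (\<theta> * u) * hermite_factor q H \<psi> u) integrable_on {0..t}"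
    "\<And>t. t \<in> {0..1} \<Longrightarrow> hermite_kernel q H (indicator {0..t}) \<psi> = integral {0..t} (hermite_factor q H \<psi>)"
    "\<And>t. t \<in> {0..1} \<Longrightarrow> hermite_kernel q H (\<lambda>u. exp (\<theta> * u) * indicator {0..t} u) \<psi> =
      integral {0..t} (\<lambda>u. exp (\<theta> * u) * hermite_factor q H \<psi> u)"
  | (degenerate)
    "\<And>t. t \<in> {0..1} \<Longrightarrow> hermite_kernel q H (indicator {0..t}) \<psi> = 0"
    "\<And>t. t \<in> {0..1} \<Longrightarrow> hermite_kernel q H (\<lambda>u. exp (\<theta> * u) * indicator {0..t} u) \<psi> = 0"
proof (cases "set_integrable lborel {0..1} (hermite_factor q H \<psi>)")
  case True
  let ?g = "hermite_factor q H \<psi>"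
  have s: "set_integrable lborel {0..t} ?g" if "t \<in> {0..1}" for t
    using that by (intro set_integrable_subset[OF True]) auto
  have e: "set_integrable lborel {0..t} (\<lambda>u. exp (\<theta> * u) * ?g u)" if "t \<in> {0..1}" for t
    using set_integrable_exp_iff[of ?g \<theta> t] s[OF that] by (simp add: set_integrable_def mult_ac)
  show ?thesis
  proof (rule integrable)
    fix t :: real assume t: "t \<in> {0..1}"
    show "?g integrable_on {0..t}" "(\<lambda>u. exp (\<theta> * u) * ?g u) integrable_on {0..t}"
      using set_borel_integral_eq_integral(1) s[OF t] e[OF t] by blast+
    show "hermite_kernel q H (indicator {0..t}) \<psi> = integral {0..t} ?g"
      using set_borel_integral_eq_integral(2)[OF s[OF t]]
      by (simp add: hermite_kernel_eq set_lebesgue_integral_def)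
    show "hermite_kernel q H (\<lambda>u. exp (\<theta> * u) * indicator {0..t} u) \<psi> =
        integral {0..t} (\<lambda>u. exp (\<theta> * u) * ?g u)"
      using set_borel_integral_eq_integral(2)[OF e[OF t]]
      by (simp add: hermite_kernel_eq set_lebesgue_integral_def mult_ac)
  qed
next
  case False
  let ?g = "hermite_factor q H \<psi>"
  \<comment> \<open>If the factor were positive at \<open>t\<close>, it would be bounded by
    \<open>?g t\<close> on the rest of the unit interval, and integrability up to \<open>t\<close>
    would extend to all of it. So integrability up to \<open>t\<close> is possible only because the
    factor vanishes there.\<close>
  have zero: "?g t = 0" if t: "t \<in> {0..1}" and s: "set_integrable lborel {0..t} ?g" for t
  proof (rule ccontr)
    assume "?g t \<noteq> 0"
    have "set_integrable lborel {t..1} ?g"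
      unfolding set_integrable_def
    proof (rule Bochner_Integration.integrable_bound)
      show "integrable lborel (\<lambda>u. ?g t * indicator {t..1} u)"
        using t by (intro integrable_mult_right integrable_real_indicator) auto
      show "AE u in lborel. norm (indicator {t..1} u *\<^sub>R ?g u) \<le> norm (?g t * indicator {t..1} u)"
        using hermite_factor_antimono[OF assms \<open>?g t \<noteq> 0\<close>] hermite_factor_nonneg
        by (intro AE_I2) (auto simp: indicator_def)
    qed measurable
    then have "set_integrable lborel ({0..t} \<union> {t..1}) ?g"
      using s by (intro set_integrable_Un) auto
    moreover have "{0..t} \<union> {t..1} = {0..1}" using t by auto
    ultimately show False using False by simp
  qed
  show ?thesis
  proof (rule degenerate)
    fix t :: real assume t: "t \<in> {0..1}"
    show "hermite_kernel q H (indicator {0..t}) \<psi> = 0"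
    proof (cases "set_integrable lborel {0..t} ?g")
      case True
      have "(\<lambda>u. indicator {0..t} u * ?g u) = (\<lambda>u. 0)"
        using hermite_factor_zero_left[OF zero[OF t True]] by (auto simp: indicator_def fun_eq_iff)
      then show ?thesis unfolding hermite_kernel_eq by simp
    next
      case False
      then show ?thesis by (simp add: hermite_kernel_eq set_integrable_def not_integrable_integral_eq)
    qed
    show "hermite_kernel q H (\<lambda>u. exp (\<theta> * u) * indicator {0..t} u) \<psi> = 0"
    proof (cases "set_integrable lborel {0..t} ?g")
      case True
      have "(\<lambda>u. exp (\<theta> * u) * indicator {0..t} u * ?g u) = (\<lambda>u. 0)"
        using hermite_factor_zero_left[OF zero[OF t True]] by (auto simp: indicator_def fun_eq_iff)
      then show ?thesis unfolding hermite_kernel_eq by simp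
    next
      case False
      then have "\<not> integrable lborel (\<lambda>u. exp (\<theta> * u) * indicator {0..t} u * ?g u)"
        by (simp add: set_integrable_exp_iff)
      then show ?thesis by (simp add: hermite_kernel_eq not_integrable_integral_eq)
    qed
  qed
qed

lemma hermite_kernel_nonneg: "0 \<le> hermite_kernel q H (indicator S) \<psi>"
  unfolding hermite_kernel_eq by (intro integral_nonneg_AE AE_I2) (simp add: hermite_factor_nonneg)

text \<open>The weighted Riemann sum bound with the Hermite factor as weight, increments of the
  kernel being its integrals over the pieces. In the degenerate case it reads
  \<open>0 \<le> 0\<close>.\<close>

lemma hermite_kernel_approximation:
  fixes \<theta> :: real
  assumes "H < 1" "t \<in> {0..1}" "n > 0"
    and osc: "\<forall>k<n. \<forall>s\<in>{partition_point t n k..partition_point t n (Suc k)}.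
      \<bar>exp (\<theta> * s) - exp (\<theta> * partition_point t n k)\<bar> \<le> \<eta>"
  shows "\<bar>hermite_kernel q H (\<lambda>u. exp (\<theta> * u) * indicator {0..t} u) \<psi> -
      (\<Sum>k<n. exp (\<theta> * partition_point t n k) *
        (hermite_kernel q H (indicator {0..partition_point t n (Suc k)}) \<psi> -
         hermite_kernel q H (indicator {0..partition_point t n k}) \<psi>))\<bar>
    \<le> \<eta> * hermite_kernel q H (indicator {0..t}) \<psi>"
proof -
  let ?\<tau> = "partition_point t n" and ?g = "hermite_factor q H \<psi>"
  have t: "t \<ge> 0" using assms by auto
  have \<tau>: "?\<tau> k \<in> {0..1}" if "k \<le> n" for k
    using partition_point_mem[OF t that] assms(2) by auto
  have \<tau>': "?\<tau> 0 = 0" "?\<tau> n = t" using assms(3) by (auto simp: partition_point_end)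
  from assms(1) show ?thesis
  proof (cases rule: hermite_kernel_cases[where q = q and \<psi> = \<psi> and \<theta> = \<theta>])
    case integrable
    have "\<bar>integral {?\<tau> 0..?\<tau> n} (\<lambda>u. exp (\<theta> * u) * ?g u) - (\<Sum>k<n. exp (\<theta> * ?\<tau> k) * integral {?\<tau> k..?\<tau> (Suc k)} ?g)\<bar>
        \<le> \<eta> * integral {?\<tau> 0..?\<tau> n} ?g"
      by (rule riemann_stieltjes_sum_bound)
        (use osc partition_point_mono[OF t] integrable(1,2)[OF assms(2)] in \<open>auto simp: hermite_factor_nonneg \<tau>'\<close>)
    moreover have "integral {?\<tau> k..?\<tau> (Suc k)} ?g = integral {0..?\<tau> (Suc k)} ?g - integral {0..?\<tau> k} ?g" if "k < n" for k
      using Henstock_Kurzweil_Integration.integral_combine[of 0 "?\<tau> k" "?\<tau> (Suc k)" ?g] \<tau>[of k] \<tau>[of "Suc k"] that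
        partition_point_mono[OF t, of k "Suc k" n] integrable(1) by auto
    ultimately show ?thesis
      using \<tau> assms(2) by (simp add: integrable(3,4) \<tau>')
  next
    case degenerate
    then show ?thesis using \<tau> assms(2) by simp
  qed
qed

section \<open>Integration by parts for the Hermite process\<close>

text \<open>Almost sure uniqueness of versions: by the second moment bound a zero kernel admits only
  null variables.\<close>

lemma multiple_wiener_integral_null:
  assumes "prob_space M" "isonormal M W" "multiple_wiener_integral M W q (\<lambda>\<psi>. 0) J"
  shows "AE \<omega> in M. J \<omega> = 0"
proof -
  have [measurable]: "J \<in> borel_measurable M" using assms(3) by (simp add: multiple_wiener_integral_def)
  have "(\<integral>\<^sup>+\<omega>. ennreal ((J \<omega>)\<^sup>2) \<partial>M) = 0"
    using multiple_wiener_integral_bound[OF assms] by simp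
  then show ?thesis by (simp add: nn_integral_0_iff_AE)
qed

lemma nn_integral_eq_0I:
  fixes x :: ennreal
  assumes "B < \<infinity>" "\<And>\<eta>. \<eta> > 0 \<Longrightarrow> x \<le> ennreal (\<eta>\<^sup>2) * B"
  shows "x = 0"
proof -
  obtain b where b: "B = ennreal b" "b \<ge> 0" using assms(1) by (cases B) auto
  have "(\<lambda>n. ennreal ((1 / real (Suc n))\<^sup>2 * b)) \<longlonglongrightarrow> ennreal (0\<^sup>2 * b)"
    by (intro tendsto_ennrealI tendsto_intros LIMSEQ_Suc[OF lim_const_over_n])
  moreover have "x \<le> ennreal ((1 / real (Suc n))\<^sup>2 * b)" for n
    using assms(2)[of "1 / real (Suc n)"] b by (simp add: ennreal_mult)
  ultimately have "x \<le> ennreal (0\<^sup>2 * b)" by (intro LIMSEQ_le_const) auto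
  then show ?thesis by simp
qed

text \<open>Riemann sums of \<open>Z\<close> converge pathwise after summation by parts, and in mean square to the Wiener
  integral. For the latter no norm of the kernels has to be computed: by positivity the error of
  the kernels is at most \<open>\<eta>\<close> times the kernel of \<open>Z t\<close>, which is square integrable.\<close>

lemma hermite_wiener_integral_by_parts:
  fixes \<theta> :: real
  assumes P: "prob_space M" and W: "isonormal M W" and H: "H < 1"
    and Z: "hermite_process_on M W q H {0..1} Z" and t: "t \<in> {0..1}"
    and J: "hermite_wiener_integral M W q H (\<lambda>s. exp (\<theta> * s) * indicator {0..t} s) J"
  shows "AE \<omega> in M. J \<omega> = exp (\<theta> * t) * Z t \<omega> - Z 0 \<omega> - \<theta> * integral {0..t} (\<lambda>s. exp (\<theta> * s) * Z s \<omega>)"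
proof -
  let ?c = "hermite_const q H"
  let ?N = "4 * ennreal (real (card (bijections q {..<q})))"
  let ?G = "\<lambda>t. hermite_kernel q H (indicator {0..t})"
  let ?E = "hermite_kernel q H (\<lambda>s. exp (\<theta> * s) * indicator {0..t} s)"
  let ?\<tau> = "partition_point t"
  have t0: "t \<ge> 0" using t by simp
  have \<tau>: "?\<tau> n k \<in> {0..1}" if "k \<le> n" for k n
    using partition_point_mem[OF t0 that] t by auto
  obtain I where I: "\<And>s. s \<in> {0..1} \<Longrightarrow> multiple_wiener_integral M W q (?G s) (I s)"
    and ZI: "\<And>s \<omega>. s \<in> {0..1} \<Longrightarrow> \<omega> \<in> space M \<Longrightarrow> Z s \<omega> = ?c * I s \<omega>"
    using Z unfolding hermite_process_on_def by metis
  have Zc: "continuous_on {0..1} (\<lambda>s. Z s \<omega>)" if "\<omega> \<in> space M" for \<omega>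
    using Z that unfolding hermite_process_on_def by blast
  obtain K where K: "multiple_wiener_integral M W q ?E K" and JK: "\<And>\<omega>. \<omega> \<in> space M \<Longrightarrow> J \<omega> = ?c * K \<omega>"
    using J unfolding hermite_wiener_integral_def by auto
  have [measurable]: "K \<in> borel_measurable M" using K by (simp add: multiple_wiener_integral_def)
  have Im: "I s \<in> borel_measurable M" if "s \<in> {0..1}" for s
    using I[OF that] by (simp add: multiple_wiener_integral_def)
  define S where "S n \<omega> = (\<Sum>k<n. exp (\<theta> * ?\<tau> n k) * (I (?\<tau> n (Suc k)) \<omega> - I (?\<tau> n k) \<omega>))" for n \<omega>
  have [measurable]: "S n \<in> borel_measurable M" for n
    unfolding S_def using \<tau> Im
    by (intro borel_measurable_sum borel_measurable_times borel_measurable_const borel_measurable_diff) auto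
  define L where "L \<omega> = exp (\<theta> * t) * Z t \<omega> - Z 0 \<omega> - \<theta> * integral {0..t} (\<lambda>s. exp (\<theta> * s) * Z s \<omega>)" for \<omega>
  have lim: "(\<lambda>n. ?c * S n \<omega>) \<longlonglongrightarrow> L \<omega>" if \<omega>: "\<omega> \<in> space M" for \<omega>
  proof -
    \<comment> \<open>The pathwise limit was stated for decaying exponentials and is used here with
      \<theta> replaced by its negative.\<close>
    have "(\<lambda>n. \<Sum>k<n. exp (- (- \<theta>) * ?\<tau> n k) * (Z (?\<tau> n (Suc k)) \<omega> - Z (?\<tau> n k) \<omega>))
        \<longlonglongrightarrow> exp (- (- \<theta>) * t) * Z t \<omega> - Z 0 \<omega> + (- \<theta>) * integral {0..t} (\<lambda>s. exp (- (- \<theta>) * s) * Z s \<omega>)"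
      using t by (intro exponential_sum_limit t0 continuous_on_subset[OF Zc[OF \<omega>]]) auto
    moreover have "(\<Sum>k<n. exp (- (- \<theta>) * ?\<tau> n k) * (Z (?\<tau> n (Suc k)) \<omega> - Z (?\<tau> n k) \<omega>)) = ?c * S n \<omega>" for n
      unfolding S_def sum_distrib_left using \<tau>
      by (intro sum.cong refl) (simp add: ZI \<omega> algebra_simps)
    ultimately show ?thesis by (simp add: L_def)
  qed
  have [measurable]: "L \<in> borel_measurable M"
    by (rule borel_measurable_LIMSEQ_real[OF lim]) measurable
  have diff: "multiple_wiener_integral M W q
      (\<lambda>\<psi>. ?E \<psi> - (\<Sum>k<n. exp (\<theta> * ?\<tau> n k) * (?G (?\<tau> n (Suc k)) \<psi> - ?G (?\<tau> n k) \<psi>))) (\<lambda>\<omega>. K \<omega> - S n \<omega>)" for n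
    unfolding S_def using \<tau>
    by (intro multiple_wiener_integral_diff[OF P W] multiple_wiener_integral_sum[OF P W]
        multiple_wiener_integral_cmult[OF P W] K I) auto
  let ?B = "\<integral>\<^sup>+\<psi>. ennreal ((?G t \<psi>)\<^sup>2) \<partial>lebesgue_pow q"
  have GL2: "?G t \<in> L2 (lebesgue_pow q)" using I[OF t] by (simp add: multiple_wiener_integral_def)
  have Gm [measurable]: "?G t \<in> borel_measurable (lebesgue_pow q)" using GL2 by (simp add: L2_def)
  have B: "?B < \<infinity>"
    using GL2 by (simp add: L2_def nn_integral_eq_integral)
  have small: "\<forall>\<^sub>F n in sequentially. (\<integral>\<^sup>+\<omega>. ennreal ((?c * K \<omega> - ?c * S n \<omega>)\<^sup>2) \<partial>M) \<le>
      ennreal (\<eta>\<^sup>2) * (ennreal (?c\<^sup>2) * (?N * ?B))" if "\<eta> > 0" for \<eta>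
  proof -
    have "continuous_on {0..t} (\<lambda>s. exp (\<theta> * s))" by (intro continuous_intros)
    from partition_oscillation[OF this t0 that] eventually_gt_at_top[of 0] show ?thesis
    proof eventually_elim
      case (elim n)
      have "(\<integral>\<^sup>+\<omega>. ennreal ((?c * K \<omega> - ?c * S n \<omega>)\<^sup>2) \<partial>M) = (\<integral>\<^sup>+\<omega>. ennreal (?c\<^sup>2) * ennreal ((K \<omega> - S n \<omega>)\<^sup>2) \<partial>M)"
        by (simp add: right_diff_distrib[symmetric] power_mult_distrib ennreal_mult)
      also have "\<dots> = ennreal (?c\<^sup>2) * (\<integral>\<^sup>+\<omega>. ennreal ((K \<omega> - S n \<omega>)\<^sup>2) \<partial>M)"
        by (rule nn_integral_cmult) measurable
      also have "\<dots> \<le> ennreal (?c\<^sup>2) * (?N * (\<integral>\<^sup>+\<psi>. ennreal ((?E \<psi> - (\<Sum>k<n. exp (\<theta> * ?\<tau> n k) *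
          (?G (?\<tau> n (Suc k)) \<psi> - ?G (?\<tau> n k) \<psi>)))\<^sup>2) \<partial>lebesgue_pow q))"
        by (intro mult_left_mono multiple_wiener_integral_bound[OF P W diff]) simp
      also have "\<dots> \<le> ennreal (?c\<^sup>2) * (?N * (\<integral>\<^sup>+\<psi>. ennreal (\<eta>\<^sup>2) * ennreal ((?G t \<psi>)\<^sup>2) \<partial>lebesgue_pow q))"
      proof (intro mult_left_mono nn_integral_mono)
        fix \<psi>
        have "\<bar>?E \<psi> - (\<Sum>k<n. exp (\<theta> * ?\<tau> n k) * (?G (?\<tau> n (Suc k)) \<psi> - ?G (?\<tau> n k) \<psi>))\<bar> \<le> \<eta> * ?G t \<psi>"
          using elim partition_point_mono[OF t0] by (intro hermite_kernel_approximation H t) auto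
        also have "\<dots> = \<bar>\<eta> * ?G t \<psi>\<bar>" using that by (simp add: hermite_kernel_nonneg abs_mult)
        finally show "ennreal ((?E \<psi> - (\<Sum>k<n. exp (\<theta> * ?\<tau> n k) * (?G (?\<tau> n (Suc k)) \<psi> - ?G (?\<tau> n k) \<psi>)))\<^sup>2) \<le>
            ennreal (\<eta>\<^sup>2) * ennreal ((?G t \<psi>)\<^sup>2)"
          by (simp add: abs_le_square_iff power_mult_distrib ennreal_mult[symmetric])
      qed simp_all
      also have "(\<integral>\<^sup>+\<psi>. ennreal (\<eta>\<^sup>2) * ennreal ((?G t \<psi>)\<^sup>2) \<partial>lebesgue_pow q) = ennreal (\<eta>\<^sup>2) * ?B"
        by (rule nn_integral_cmult) measurable
      finally show ?case by (simp add: mult_ac)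
    qed
  qed
  have "(\<integral>\<^sup>+\<omega>. ennreal ((?c * K \<omega> - L \<omega>)\<^sup>2) \<partial>M) = 0"
  proof (rule nn_integral_eq_0I)
    show "ennreal (?c\<^sup>2) * (?N * ?B) < \<infinity>"
      using B by (simp add: ennreal_mult_less_top)
    fix \<eta> :: real assume \<eta>: "\<eta> > 0"
    \<comment> \<open>Fatou's lemma identifies the two limits: along the Riemann sums the pathwise
      limit is \<open>L\<close>, while their mean-square distance to \<open>?c * K\<close> is
      eventually as small as desired.\<close>
    have "(\<integral>\<^sup>+\<omega>. ennreal ((?c * K \<omega> - L \<omega>)\<^sup>2) \<partial>M) =
        (\<integral>\<^sup>+\<omega>. liminf (\<lambda>n. ennreal ((?c * K \<omega> - ?c * S n \<omega>)\<^sup>2)) \<partial>M)"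
    proof (rule nn_integral_cong)
      fix \<omega> assume "\<omega> \<in> space M"
      then have "(\<lambda>n. ennreal ((?c * K \<omega> - ?c * S n \<omega>)\<^sup>2)) \<longlonglongrightarrow> ennreal ((?c * K \<omega> - L \<omega>)\<^sup>2)"
        by (intro tendsto_ennrealI tendsto_intros lim)
      then show "ennreal ((?c * K \<omega> - L \<omega>)\<^sup>2) = liminf (\<lambda>n. ennreal ((?c * K \<omega> - ?c * S n \<omega>)\<^sup>2))"
        by (rule lim_imp_Liminf[OF trivial_limit_sequentially, symmetric])
    qed
    also have "\<dots> \<le> liminf (\<lambda>n. \<integral>\<^sup>+\<omega>. ennreal ((?c * K \<omega> - ?c * S n \<omega>)\<^sup>2) \<partial>M)"
      by (rule nn_integral_liminf) measurable
    also have "\<dots> \<le> ennreal (\<eta>\<^sup>2) * (ennreal (?c\<^sup>2) * (?N * ?B))"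
      by (intro Liminf_le small \<eta>) simp
    finally show "(\<integral>\<^sup>+\<omega>. ennreal ((?c * K \<omega> - L \<omega>)\<^sup>2) \<partial>M) \<le> ennreal (\<eta>\<^sup>2) * (ennreal (?c\<^sup>2) * (?N * ?B))" .
  qed
  then have "AE \<omega> in M. ennreal ((?c * K \<omega> - L \<omega>)\<^sup>2) = 0"
    by (subst (asm) nn_integral_0_iff_AE) auto
  then show ?thesis
    using AE_space by eventually_elim (simp add: JK L_def)
qed

text \<open>The kernel integrates over a single point and so vanishes identically; since
  \<open>Z 0\<close> is only some version, the conclusion is almost sure.\<close>

lemma hermite_process_start:
  assumes P: "prob_space M" and W: "isonormal M W" and H: "H < 1"
    and Z: "hermite_process_on M W q H {0..1} Z"
  shows "AE \<omega> in M. Z 0 \<omega> = 0"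
proof -
  obtain I where I: "multiple_wiener_integral M W q (hermite_kernel q H (indicator {0..0})) I"
    and ZI: "\<And>\<omega>. \<omega> \<in> space M \<Longrightarrow> Z 0 \<omega> = hermite_const q H * I \<omega>"
    using Z unfolding hermite_process_on_def by (metis atLeastAtMost_iff order_refl zero_le_one)
  have "hermite_kernel q H (indicator {0..0}) \<psi> = 0" for \<psi>
    using H
  proof (cases rule: hermite_kernel_cases[where q = q and \<psi> = \<psi> and \<theta> = 0])
    case integrable
    then show ?thesis using integrable(3)[of 0] by simp
  next
    case degenerate
    then show ?thesis using degenerate(1)[of 0] by simp
  qed
  then have "hermite_kernel q H (indicator {0..0}) = (\<lambda>\<psi>. 0)" by (simp add: fun_eq_iff)
  then have "AE \<omega> in M. I \<omega> = 0"
    using I by (intro multiple_wiener_integral_null[OF P W]) simp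
  then show ?thesis using AE_space by eventually_elim (simp add: ZI)
qed

lemma closure_rationals_unit_interval: "closure ({0..1} \<inter> \<rat>) = {0..1::real}"
proof -
  have "closure ({0..1} \<inter> \<rat>) = closure {0..1::real}"
    by (rule closure_convex_Int_superset) (auto simp: Rats_closure_real)
  then show ?thesis by simp
qed

text \<open>Integration by parts at a fixed time has an exceptional set depending on that time.
  Rational times keep the union null, and continuity of both sides in \<open>t\<close> gives the
  remaining times.\<close>

lemma fractional_ornstein_uhlenbeck:
  fixes \<theta> :: real
  assumes P: "prob_space M" and W: "isonormal M W" and H: "H < 1"
    and Z: "hermite_process_on M W q H {0..1} Z"
    and J: "\<And>t. t \<in> {0..1} \<Longrightarrow>
      hermite_wiener_integral M W q H (\<lambda>s. exp (- \<theta> * s) * indicator {0..t} s) (J t)"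
    and Y: "\<And>t \<omega>. t \<in> {0..1} \<Longrightarrow> \<omega> \<in> space M \<Longrightarrow> Y t \<omega> = exp (\<theta> * t) * J t \<omega>"
    and Yc: "\<And>\<omega>. \<omega> \<in> space M \<Longrightarrow> continuous_on {0..1} (\<lambda>t. Y t \<omega>)"
  shows "AE \<omega> in M. \<forall>t\<in>{0..1}. Y t \<omega> =
    Z t \<omega> + \<theta> * exp (\<theta> * t) * integral {0..t} (\<lambda>s. exp (- \<theta> * s) * Z s \<omega>)"
proof -
  have "AE \<omega> in M. \<forall>t\<in>{0..1} \<inter> \<rat>. J t \<omega> =
      exp (- \<theta> * t) * Z t \<omega> - Z 0 \<omega> - (- \<theta>) * integral {0..t} (\<lambda>s. exp (- \<theta> * s) * Z s \<omega>)"
    using countable_rat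
    by (intro AE_ball_countable[THEN iffD2] ballI hermite_wiener_integral_by_parts[OF P W H Z] J) auto
  then show ?thesis
    using hermite_process_start[OF P W H Z] AE_space
  proof eventually_elim
    case (elim \<omega>)
    have Zc: "continuous_on {0..1} (\<lambda>s. Z s \<omega>)"
      using Z elim(3) unfolding hermite_process_on_def by blast
    define V where "V t = Y t \<omega> - (Z t \<omega> + \<theta> * exp (\<theta> * t) * integral {0..t} (\<lambda>s. exp (- \<theta> * s) * Z s \<omega>))" for t
    have "V t = 0" if "t \<in> {0..1} \<inter> \<rat>" for t
    proof -
      have "J t \<omega> = exp (- \<theta> * t) * Z t \<omega> + \<theta> * integral {0..t} (\<lambda>s. exp (- \<theta> * s) * Z s \<omega>)"
        using elim(1,2) that by simp
      then have "Y t \<omega> = exp (\<theta> * t) * (exp (- \<theta> * t) * Z t \<omega> + \<theta> * integral {0..t} (\<lambda>s. exp (- \<theta> * s) * Z s \<omega>))"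
        using Y[of t \<omega>] that elim(3) by simp
      moreover have "a * (b * z + \<theta> * i) = z + \<theta> * a * i" if "a * b = 1" for a b z i :: real
        using that by algebra
      moreover have "exp (\<theta> * t) * exp (- \<theta> * t) = 1" by (simp add: exp_minus)
      ultimately show ?thesis unfolding V_def by (simp only: diff_self)
    qed
    moreover have "continuous_on {0..1} V"
      unfolding V_def
      by (intro continuous_intros Yc[OF elim(3)] Zc indefinite_integral_continuous_1 integrable_continuous_interval)
    ultimately have "V t = 0" if "t \<in> {0..1}" for t
      using that continuous_constant_on_closure[of "{0..1} \<inter> \<rat>" V 0 t] by (simp add: closure_rationals_unit_interval)
    then show ?case by (simp add: V_def)
  qed
qed

lemma set_lebesgue_integral_continuous:
  fixes f :: "real \<Rightarrow> real"
  assumes "continuous_on {a..b} f"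
  shows "(LBINT t:{a..b}. f t) = integral {a..b} f"
  by (intro set_borel_integral_eq_integral(2) borel_integrable_atLeastAtMost' assms)

text \<open>Subtracting the noiseless solution leaves the same linear equation with zero initial
  value and forcing \<open>\<epsilon> * z\<close>.\<close>

lemma perturbed_linear_equation:
  fixes \<theta> :: real
  assumes X: "continuous_on {0..1} X" and z: "continuous_on {0..1} z"
    and eq: "\<And>t. t \<in> {0..1} \<Longrightarrow> X t = x0 + \<theta> * (LBINT s:{0..t}. X s) + \<epsilon> * z t"
    and t: "t \<in> {0..1}"
  shows "X t = x0 * exp (\<theta> * t) + \<epsilon> * (z t + \<theta> * exp (\<theta> * t) * integral {0..t} (\<lambda>s. exp (- \<theta> * s) * z s))"
proof -
  define D where "D t = X t - x0 * exp (\<theta> * t)" for t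
  have D: "D t = \<theta> * integral {0..t} D + \<epsilon> * z t" if t: "t \<in> {0..1}" for t
  proof -
    have Xt: "continuous_on {0..t} X" by (rule continuous_on_subset[OF X]) (use t in auto)
    have "((\<lambda>s. \<theta> * (x0 * exp (\<theta> * s))) has_integral x0 * exp (\<theta> * t) - x0 * exp (\<theta> * 0)) {0..t}"
      using t by (intro fundamental_theorem_of_calculus)
        (auto intro!: derivative_eq_intros simp: has_real_derivative_iff_has_vector_derivative[symmetric])
    from integral_unique[OF this]
    have "\<theta> * integral {0..t} (\<lambda>s. x0 * exp (\<theta> * s)) = x0 * exp (\<theta> * t) - x0 * exp (\<theta> * 0)"
      by (simp only: integral_mult_right)
    moreover have "(LBINT s:{0..t}. X s) = integral {0..t} X"
      by (rule set_lebesgue_integral_continuous[OF Xt])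
    moreover have "integral {0..t} D = integral {0..t} X - integral {0..t} (\<lambda>s. x0 * exp (\<theta> * s))"
      unfolding D_def by (intro integral_diff integrable_continuous_interval Xt continuous_intros)
    ultimately show ?thesis using eq[OF t] by (simp add: D_def[of t] right_diff_distrib del: integral_mult_right)
  qed
  have "continuous_on {0..1} D" unfolding D_def by (intro continuous_intros X)
  from linear_equation_solution[OF this D t]
  have "D t = \<epsilon> * z t + \<theta> * exp (\<theta> * t) * integral {0..t} (\<lambda>s. exp (- \<theta> * s) * (\<epsilon> * z s))" .
  also have "(\<lambda>s. exp (- \<theta> * s) * (\<epsilon> * z s)) = (\<lambda>s. \<epsilon> * (exp (- \<theta> * s) * z s))" by (simp add: mult_ac)
  also have "integral {0..t} \<dots> = \<epsilon> * integral {0..t} (\<lambda>s. exp (- \<theta> * s) * z s)" by (rule integral_mult_right)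
  finally show ?thesis by (simp add: D_def algebra_simps)
qed

section \<open>Best approximation in the mean by a line\<close>

lemma integral_abs_diff_le:
  fixes f g h :: "real \<Rightarrow> real"
  assumes "continuous_on {0..1} f" "continuous_on {0..1} g" "continuous_on {0..1} h"
    and "\<And>t. t \<in> {0..1} \<Longrightarrow> \<bar>f t - g t\<bar> \<le> h t"
  shows "\<bar>integral {0..1} f - integral {0..1} g\<bar> \<le> integral {0..1} h"
proof -
  have i: "f integrable_on {0..1}" "g integrable_on {0..1}" "h integrable_on {0..1}"
    using assms(1-3) by (auto intro: integrable_continuous_interval)
  have "norm (integral {0..1} (\<lambda>t. f t - g t)) \<le> integral {0..1} h"
    using assms(4) i by (intro integral_norm_bound_integral integrable_diff) auto
  then show ?thesis using i by (simp add: integral_diff)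
qed

definition L1_distance :: "(real \<Rightarrow> real) \<Rightarrow> (real \<Rightarrow> real) \<Rightarrow> real \<Rightarrow> real" where
  "L1_distance y g u = integral {0..1} (\<lambda>t. \<bar>y t - u * g t\<bar>)"

text \<open>\<open>g\<close> stands for the derivative in the parameter of the noiseless path, which
  vanishes at time 0; hence nonvanishing is asked only on the half-open interval.\<close>

locale L1_line =
  fixes y g :: "real \<Rightarrow> real"
  assumes y: "continuous_on {0..1} y" and g: "continuous_on {0..1} g"
    and g_nonzero: "\<And>t. 0 < t \<Longrightarrow> t \<le> 1 \<Longrightarrow> g t \<noteq> 0"
    and integral_g: "integral {0..1} g \<noteq> 0"
begin

abbreviation "f \<equiv> L1_distance y g"

lemma integrand_continuous: "continuous_on {0..1} (\<lambda>t. \<bar>y t - u * g t\<bar>)"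
  by (intro continuous_intros y g)

lemma integrand_integrable: "(\<lambda>t. \<bar>y t - u * g t\<bar>) integrable_on {0..1}"
  by (intro integrable_continuous_interval integrand_continuous)

lemma integral_abs_g: "0 < integral {0..1} (\<lambda>t. \<bar>g t\<bar>)"
proof -
  have c: "continuous_on {0..1} (\<lambda>t. \<bar>g t\<bar>)" by (intro continuous_intros g)
  have "integral {0..1} (\<lambda>t. \<bar>g t\<bar>) \<noteq> 0"
    using integral_eq_0_iff[OF c] g_nonzero[of 1] by auto
  moreover have "0 \<le> integral {0..1} (\<lambda>t. \<bar>g t\<bar>)"
    by (intro integral_nonneg integrable_continuous_interval c) auto
  ultimately show ?thesis by simp
qed

lemma lipschitz: "\<bar>f u - f v\<bar> \<le> \<bar>u - v\<bar> * integral {0..1} (\<lambda>t. \<bar>g t\<bar>)"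
proof -
  have "\<bar>f u - f v\<bar> \<le> integral {0..1} (\<lambda>t. \<bar>u - v\<bar> * \<bar>g t\<bar>)"
    unfolding L1_distance_def
  proof (rule integral_abs_diff_le)
    fix t
    have "\<bar>\<bar>y t - u * g t\<bar> - \<bar>y t - v * g t\<bar>\<bar> \<le> \<bar>(y t - u * g t) - (y t - v * g t)\<bar>"
      by (rule abs_triangle_ineq3)
    also have "\<dots> = \<bar>u - v\<bar> * \<bar>g t\<bar>"
      by (simp add: abs_mult[symmetric] algebra_simps abs_minus_commute)
    finally show "\<bar>\<bar>y t - u * g t\<bar> - \<bar>y t - v * g t\<bar>\<bar> \<le> \<bar>u - v\<bar> * \<bar>g t\<bar>" .
  qed (intro continuous_intros y g)+
  then show ?thesis by simp
qed

lemma continuous_f: "continuous_on UNIV f"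
proof -
  have "(integral {0..1} (\<lambda>t. \<bar>g t\<bar>))-lipschitz_on UNIV f"
    using lipschitz integral_abs_g by (intro lipschitz_onI) (auto simp: dist_real_def mult.commute)
  then show ?thesis by (rule lipschitz_on_continuous_on)
qed

lemma convex_f: "convex_on UNIV f"
proof (rule convex_onI)
  fix s u v :: real
  assume s: "0 < s" "s < 1"
  have "f ((1 - s) *\<^sub>R u + s *\<^sub>R v) \<le> integral {0..1} (\<lambda>t. (1 - s) * \<bar>y t - u * g t\<bar> + s * \<bar>y t - v * g t\<bar>)"
    unfolding L1_distance_def
  proof (intro integral_le integrable_add integrable_on_mult_right integrand_integrable)
    fix t
    have "\<bar>y t - ((1 - s) *\<^sub>R u + s *\<^sub>R v) * g t\<bar> = \<bar>(1 - s) * (y t - u * g t) + s * (y t - v * g t)\<bar>"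
      by (simp add: algebra_simps)
    also have "\<dots> \<le> \<bar>(1 - s) * (y t - u * g t)\<bar> + \<bar>s * (y t - v * g t)\<bar>" by (rule abs_triangle_ineq)
    also have "\<dots> = (1 - s) * \<bar>y t - u * g t\<bar> + s * \<bar>y t - v * g t\<bar>" using s by (simp add: abs_mult)
    finally show "\<bar>y t - ((1 - s) *\<^sub>R u + s *\<^sub>R v) * g t\<bar> \<le> (1 - s) * \<bar>y t - u * g t\<bar> + s * \<bar>y t - v * g t\<bar>" .
  qed
  also have "\<dots> = (1 - s) * f u + s * f v"
    unfolding L1_distance_def
    by (subst integral_add) (auto intro!: integrable_on_mult_right integrand_integrable)
  finally show "f ((1 - s) *\<^sub>R u + s *\<^sub>R v) \<le> (1 - s) * f u + s * f v" .
qed simp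

text \<open>Coercivity: by the triangle inequality \<bar>u\<bar> times the norm of \<open>g\<close>
  is at most \<open>f u + f 0\<close>. Beyond the radius \<open>R = 2 * f 0 / G\<close> this forces
  \<open>f\<close> above \<open>f 0\<close>, so a minimum over a compact interval is global.\<close>

lemma minimizer_exists: "\<exists>u. \<forall>v. f u \<le> f v"
proof -
  define G where "G = integral {0..1} (\<lambda>t. \<bar>g t\<bar>)"
  have G: "G > 0" using integral_abs_g by (simp add: G_def)
  have f0: "f 0 \<ge> 0"
    unfolding L1_distance_def by (intro integral_nonneg integrand_integrable) auto
  have coercive: "\<bar>u\<bar> * G \<le> f u + f 0" for u
  proof -
    have "integral {0..1} (\<lambda>t. \<bar>u\<bar> * \<bar>g t\<bar>) \<le> integral {0..1} (\<lambda>t. \<bar>y t - u * g t\<bar> + \<bar>y t - 0 * g t\<bar>)"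
    proof (rule integral_le)
      show "(\<lambda>t. \<bar>u\<bar> * \<bar>g t\<bar>) integrable_on {0..1}"
        by (intro integrable_continuous_interval continuous_intros g)
      show "(\<lambda>t. \<bar>y t - u * g t\<bar> + \<bar>y t - 0 * g t\<bar>) integrable_on {0..1}"
        by (intro integrable_add integrand_integrable)
      show "\<bar>u\<bar> * \<bar>g t\<bar> \<le> \<bar>y t - u * g t\<bar> + \<bar>y t - 0 * g t\<bar>" for t
        using abs_triangle_ineq4[of "y t" "y t - u * g t"] by (simp add: abs_mult)
    qed
    then show ?thesis
      unfolding L1_distance_def by (subst (asm) integral_add) (auto intro!: integrand_integrable integrable_continuous_interval continuous_intros y simp: G_def)
  qed
  define R where "R = 2 * f 0 / G"
  have R: "R \<ge> 0" using f0 G by (simp add: R_def)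
  have "\<exists>u\<in>{-R..R}. \<forall>v\<in>{-R..R}. f u \<le> f v"
    using R by (intro continuous_attains_inf continuous_on_subset[OF continuous_f]) auto
  then obtain u where u: "u \<in> {-R..R}" "\<And>v. v \<in> {-R..R} \<Longrightarrow> f u \<le> f v" by blast
  have "f u \<le> f v" for v
  proof (cases "v \<in> {-R..R}")
    case False
    then have "R < \<bar>v\<bar>" by auto
    then have "R * G < \<bar>v\<bar> * G" using G by simp
    moreover have "R * G = 2 * f 0" using G by (simp add: R_def)
    ultimately have "f 0 < f v" using coercive[of v] by linarith
    moreover have "f u \<le> f 0" using R by (intro u(2)) auto
    ultimately show ?thesis by simp
  qed (use u(2) in auto)
  then show ?thesis by blast
qed

text \<open>If two distinct points minimize \<open>f\<close>, then so does their midpoint, and equality in the triangle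
  inequality forces the residuals to have one and the same constant sign. So \<open>f\<close> is affine between
  them, with slope \<open>\<plusminus> integral {0..1} g \<noteq> 0\<close>.\<close>

lemma minimizer_unique:
  assumes u: "\<And>w. f u \<le> f w" and v: "\<And>w. f v \<le> f w"
  shows "u = v"
proof (rule ccontr)
  assume "u \<noteq> v"
  define a b m where "a t = y t - u * g t" and "b t = y t - v * g t" and "m t = (a t + b t) / 2" for t
  have ca: "continuous_on {0..1} a" and cb: "continuous_on {0..1} b"
    unfolding a_def b_def by (intro continuous_intros y g)+
  have cm: "continuous_on {0..1} m"
    unfolding m_def by (intro continuous_intros ca cb) auto
  have fu: "f u = integral {0..1} (\<lambda>t. \<bar>a t\<bar>)" and fv: "f v = integral {0..1} (\<lambda>t. \<bar>b t\<bar>)"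
    by (simp_all add: L1_distance_def a_def b_def)
  have fm: "f ((u + v) / 2) = integral {0..1} (\<lambda>t. \<bar>m t\<bar>)"
    by (simp add: L1_distance_def m_def a_def b_def field_simps)
  have fuv: "f u = f v" using u[of v] v[of u] by simp
  let ?h = "\<lambda>t. (\<bar>a t\<bar> + \<bar>b t\<bar>) / 2 - \<bar>m t\<bar>"
  have ch: "continuous_on {0..1} ?h"
    by (intro continuous_intros ca cb cm) auto
  have ia: "(\<lambda>t. \<bar>a t\<bar>) integrable_on {0..1}" "(\<lambda>t. \<bar>b t\<bar>) integrable_on {0..1}" "(\<lambda>t. \<bar>m t\<bar>) integrable_on {0..1}"
    by (intro integrable_continuous_interval continuous_intros ca cb cm)+
  have "integral {0..1} ?h = (f u + f v) / 2 - f ((u + v) / 2)"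
  proof -
    have "integral {0..1} ?h = integral {0..1} (\<lambda>t. 1 / 2 * \<bar>a t\<bar> + 1 / 2 * \<bar>b t\<bar> - \<bar>m t\<bar>)"
      by (simp add: add_divide_distrib)
    also have "\<dots> = integral {0..1} (\<lambda>t. 1 / 2 * \<bar>a t\<bar>) + integral {0..1} (\<lambda>t. 1 / 2 * \<bar>b t\<bar>) - integral {0..1} (\<lambda>t. \<bar>m t\<bar>)"
      using integrable_on_mult_right[OF ia(1), of "1/2"] integrable_on_mult_right[OF ia(2), of "1/2"] ia(3)
      by (simp only: integral_diff integral_add integrable_add)
    finally show ?thesis by (simp add: fu fv fm field_simps)
  qed
  moreover have h0: "?h t \<ge> 0" for t
    unfolding m_def by (simp add: abs_triangle_ineq)
  moreover have "0 \<le> integral {0..1} ?h"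
    using h0 by (intro integral_nonneg integrable_continuous_interval ch) auto
  ultimately have "integral {0..1} ?h = 0" using u[of "(u + v) / 2"] fuv by simp
  then have "?h t = 0" if "t \<in> {0..1}" for t
    using integral_eq_0_iff[OF ch] h0 that by simp
  then have eq: "2 * \<bar>m t\<bar> = \<bar>a t\<bar> + \<bar>b t\<bar>" if "t \<in> {0..1}" for t
    using that by (simp add: field_simps)
  have ab: "a t - b t = (v - u) * g t" for t by (simp add: a_def b_def algebra_simps)
  \<comment> \<open>Where the midpoint residual vanishes, both residuals do, hence also their
    difference \<open>(v - u) * g t\<close>.\<close>
  have zero: "t = 0" if "t \<in> {0..1}" "m t = 0" for t
  proof (rule ccontr)
    assume "t \<noteq> 0"
    have "a t - b t = 0" using eq[OF that(1)] that(2) by auto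
    then show False using ab[of t] g_nonzero[of t] that(1) \<open>t \<noteq> 0\<close> \<open>u \<noteq> v\<close> by auto
  qed
  define s :: real where "s = sgn (m 1)"
  have "m 1 \<noteq> 0" using zero[of 1] by auto
  then have s: "\<bar>s\<bar> = 1" "s * m 1 > 0" "s \<noteq> 0" by (auto simp: s_def sgn_mult abs_sgn mult_sgn_abs linorder_neq_iff)
  \<comment> \<open>A change of sign would, by the intermediate value theorem, produce a zero of
    \<open>m\<close> in the interval from \<open>t\<close> to 1; the only possible zero is 0, and
    then \<open>t = 0\<close> is that zero itself.\<close>
  have sm: "s * m t \<ge> 0" if t: "t \<in> {0..1}" for t
  proof (rule ccontr)
    assume neg: "\<not> s * m t \<ge> 0"
    have "\<exists>z\<ge>t. z \<le> 1 \<and> s * m z = 0"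
      using neg s(2) t by (intro IVT' continuous_on_subset[OF continuous_on_mult_left[OF cm]]) auto
    then obtain z where z: "t \<le> z" "z \<le> 1" "s * m z = 0" by blast
    then have "z = 0" using zero[of z] s t by auto
    then show False using z t neg by auto
  qed
  have sa: "\<bar>a t\<bar> = s * a t \<and> \<bar>b t\<bar> = s * b t" if t: "t \<in> {0..1}" for t
  proof -
    have mm: "2 * m t = a t + b t" by (simp add: m_def)
    consider "s = 1" | "s = -1" using s(1) by (auto simp: abs_if split: if_splits)
    then show ?thesis
      using sm[OF t] eq[OF t] mm by cases (auto simp: abs_if split: if_splits)
  qed
  have "f u - f v = integral {0..1} (\<lambda>t. s * a t) - integral {0..1} (\<lambda>t. s * b t)"
    unfolding fu fv using sa by (intro arg_cong2[where f = "(-)"] Henstock_Kurzweil_Integration.integral_cong) auto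
  also have "\<dots> = integral {0..1} (\<lambda>t. s * a t - s * b t)"
    by (intro integral_diff[symmetric] integrable_continuous_interval continuous_intros ca cb)
  also have "(\<lambda>t. s * a t - s * b t) = (\<lambda>t. s * (v - u) * g t)"
    using ab by (simp add: fun_eq_iff right_diff_distrib[symmetric])
  also have "integral {0..1} \<dots> = s * (v - u) * integral {0..1} g" by simp
  finally show False using fuv s \<open>u \<noteq> v\<close> integral_g by simp
qed

definition minimizer :: real where "minimizer = (THE u. \<forall>v. f u \<le> f v)"

lemma minimizer_le: "f minimizer \<le> f v"
proof -
  have "\<exists>!u. \<forall>v. f u \<le> f v" using minimizer_exists minimizer_unique by blast
  from theI'[OF this] show ?thesis by (simp add: minimizer_def)
qed

lemma minimizer_eq: "(\<And>v. f u \<le> f v) \<Longrightarrow> u = minimizer"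
  using minimizer_unique minimizer_le by blast

lemma minimizer_less: "u \<noteq> minimizer \<Longrightarrow> f minimizer < f u"
  using minimizer_le minimizer_eq by (metis less_le_not_le order_trans)

text \<open>By convexity \<open>f\<close> is monotone on each side of its minimizer:
  \<open>v\<close> is a convex combination of the minimizer and \<open>u\<close>.\<close>

lemma f_between:
  assumes "minimizer \<le> v \<and> v \<le> u \<or> u \<le> v \<and> v \<le> minimizer"
  shows "f v \<le> f u"
proof (cases "u = minimizer")
  case True
  then show ?thesis using assms by auto
next
  case False
  define s where "s = (v - minimizer) / (u - minimizer)"
  have s: "0 \<le> s" "s \<le> 1" using assms False by (auto simp: s_def divide_simps)
  have "s * (u - minimizer) = v - minimizer" using False by (simp add: s_def)
  then have "v = (1 - s) *\<^sub>R minimizer + s *\<^sub>R u" by (simp add: algebra_simps)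
  then have "f v \<le> (1 - s) * f minimizer + s * f u" using convex_onD[OF convex_f s, of minimizer u] by simp
  also have "\<dots> \<le> (1 - s) * f u + s * f u" using s minimizer_le[of u] by (simp add: mult_left_mono)
  finally show ?thesis by (simp add: algebra_simps)
qed

text \<open>The gap is the smaller excess of \<open>f\<close> at the two points at distance \<eta>;
  monotonicity on either side carries it to all points farther out.\<close>

lemma minimizer_separated:
  assumes "\<eta> > 0"
  obtains \<kappa> where "\<kappa> > 0" "\<And>u. f u < f minimizer + \<kappa> \<Longrightarrow> \<bar>u - minimizer\<bar> < \<eta>"
proof
  let ?\<kappa> = "min (f (minimizer + \<eta>)) (f (minimizer - \<eta>)) - f minimizer"
  show "?\<kappa> > 0" using assms minimizer_less[of "minimizer + \<eta>"] minimizer_less[of "minimizer - \<eta>"] by simp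
  fix u assume "f u < f minimizer + ?\<kappa>"
  then have lt: "f u < f (minimizer + \<eta>)" "f u < f (minimizer - \<eta>)" by auto
  have "\<not> minimizer + \<eta> \<le> u" "\<not> u \<le> minimizer - \<eta>"
    using f_between[of "minimizer + \<eta>" u] f_between[of "minimizer - \<eta>" u] lt assms by auto
  then show "\<bar>u - minimizer\<bar> < \<eta>" by linarith
qed

text \<open>Meant for measurability: the position of the minimizer is decided by countably many
  comparisons of values of \<open>f\<close>. Just to the right of the minimizer, \<open>f\<close>
  stays below \<open>f a\<close> by continuity; to the left of \<open>a \<le> minimizer\<close> no
  value is below \<open>f a\<close>.\<close>

lemma minimizer_less_iff: "minimizer < a \<longleftrightarrow> (\<exists>r\<in>\<rat>. r < a \<and> f r < f a)"
proof
  assume "minimizer < a"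
  have "isCont f minimizer"
    using continuous_f by (simp add: continuous_on_eq_continuous_at)
  then have "\<forall>\<^sub>F r in at minimizer. f r < f a"
    unfolding isCont_def using minimizer_less[of a] \<open>minimizer < a\<close> by (intro order_tendstoD(2)) auto
  then obtain d where d: "d > 0" "\<And>r. r \<noteq> minimizer \<Longrightarrow> dist r minimizer < d \<Longrightarrow> f r < f a"
    unfolding eventually_at by blast
  obtain r where r: "r \<in> \<rat>" "minimizer < r" "r < min a (minimizer + d)"
    using Rats_dense_in_real[of minimizer "min a (minimizer + d)"] \<open>minimizer < a\<close> d(1) by auto
  then show "\<exists>r\<in>\<rat>. r < a \<and> f r < f a"
    using d(2)[of r] by (intro bexI[of _ r]) (auto simp: dist_real_def)
next
  assume "\<exists>r\<in>\<rat>. r < a \<and> f r < f a"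
  then show "minimizer < a" using f_between[of a] by (meson not_less order.strict_implies_order)
qed

end

text \<open>The left side is bounded because the right side stays below 1 for negative
  \<open>x\<close>. A bound valid for all \<open>x\<close> is required since no compactness of
  \<Theta> is available.\<close>

lemma exp_minus_one_lower: "\<bar>x\<bar> / (1 + \<bar>x\<bar>) \<le> \<bar>exp x - 1\<bar>" for x :: real
proof (cases "x \<ge> 0")
  case True
  then have "x / (1 + x) \<le> x" by (simp add: pos_divide_le_eq algebra_simps)
  moreover have "x \<le> exp x - 1" using exp_ge_add_one_self[of x] by linarith
  ultimately show ?thesis using True by simp
next
  case False
  then have p: "1 - x > 0" by simp
  have "1 - x \<le> exp (- x)" using exp_ge_add_one_self[of "- x"] by simp
  then have "exp x \<le> 1 / (1 - x)"
    using p by (simp add: exp_minus field_simps)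
  moreover have "- x / (1 - x) = 1 - 1 / (1 - x)" using p by (simp add: field_simps)
  moreover have "exp x \<le> 1" using False by simp
  ultimately show ?thesis using False by simp
qed

lemma exp_quadratic_bound: "\<bar>exp x - 1 - x\<bar> \<le> x\<^sup>2" if "\<bar>x\<bar> \<le> 1" for x :: real
proof -
  have "exp x \<le> 1 + x + x\<^sup>2"
  proof (cases "x \<ge> 0")
    case True
    then show ?thesis using exp_bound[of x] that by simp
  next
    case False
    then have p: "1 - x > 0" by simp
    have "1 - x \<le> exp (- x)" using exp_ge_add_one_self[of "- x"] by simp
    then have "exp x \<le> 1 / (1 - x)" using p by (simp add: exp_minus field_simps)
    also have "\<dots> \<le> 1 + x + x\<^sup>2"
    proof -
      have "x ^ 3 \<le> 0" using False by (simp add: power_le_zero_eq)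
      then have "1 \<le> (1 + x + x\<^sup>2) * (1 - x)" by (simp add: algebra_simps power2_eq_square power3_eq_cube)
      then show ?thesis using p by (simp add: divide_simps)
    qed
    finally show ?thesis .
  qed
  then show ?thesis using exp_ge_add_one_self[of x] by linarith
qed

text \<open>The deterministic core, for one path. Comparison with \<theta>0 gives a rescaled error
  \<open>u\<close> bounded by \<open>C\<close>; in that range the criterion is \<epsilon> times
  \<open>f u\<close> up to \<open>B * \<epsilon>\<^sup>2\<close>. Comparison with
  \<open>\<theta>0 + \<epsilon> * ?z\<close> then shows that \<open>u\<close> nearly minimizes
  \<open>f\<close>, and separation of the minimizer concludes.\<close>

lemma minimum_L1_norm_estimate:
  fixes y :: "real \<Rightarrow> real" and x0 \<theta>0 :: real
  defines "g \<equiv> \<lambda>t. t * x0 * exp (\<theta>0 * t)"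
    and "\<phi> \<equiv> \<lambda>\<epsilon> \<theta>. integral {0..1} (\<lambda>t. \<bar>x0 * exp (\<theta>0 * t) + \<epsilon> * y t - x0 * exp (\<theta> * t)\<bar>)"
  assumes "L1_line y g" and x0: "x0 \<noteq> 0" and \<Theta>: "\<theta>0 \<in> interior \<Theta>" and \<eta>: "\<eta> > 0"
  shows "\<exists>\<epsilon>0>0. \<forall>\<epsilon>. 0 < \<epsilon> \<and> \<epsilon> < \<epsilon>0 \<longrightarrow> (\<forall>\<theta>\<in>\<Theta>. (\<forall>\<theta>'\<in>\<Theta>. \<phi> \<epsilon> \<theta> \<le> \<phi> \<epsilon> \<theta>') \<longrightarrow>
    \<bar>(\<theta> - \<theta>0) / \<epsilon> - L1_line.minimizer y g\<bar> < \<eta>)"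
proof -
  interpret L1_line y g by fact
  let ?z = minimizer
  obtain \<kappa> where \<kappa>: "\<kappa> > 0" "\<And>u. f u < f ?z + \<kappa> \<Longrightarrow> \<bar>u - ?z\<bar> < \<eta>"
    using minimizer_separated[OF \<eta>] by blast
  obtain r where r: "r > 0" "ball \<theta>0 r \<subseteq> \<Theta>" using \<Theta> mem_interior by blast
  \<comment> \<open>The divisor 2 in \<open>c\<close> is the integral of \<open>t\<close> over the
    unit interval. \<open>C\<close> bounds both the rescaled estimator and the minimizer, and
    \<open>B\<close> collects the second-order Taylor error of the exponential for parameters up to
    \<open>C\<close>.\<close>
  define c where "c = \<bar>x0\<bar> * exp (- \<bar>\<theta>0\<bar>) / 2"
  define K where "K = integral {0..1} (\<lambda>t. \<bar>y t\<bar>)"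
  define C where "C = max (4 * K / c) \<bar>?z\<bar> + 1"
  define B where "B = \<bar>x0\<bar> * exp \<bar>\<theta>0\<bar> * C\<^sup>2"
  have c: "c > 0" using x0 by (simp add: c_def)
  have K: "K \<ge> 0"
    unfolding K_def by (intro integral_nonneg integrable_continuous_interval continuous_intros y) auto
  have C: "C \<ge> 1" by (auto simp: C_def intro: max.coboundedI2)
  have B: "B \<ge> 0" by (simp add: B_def)
  have \<phi>c: "continuous_on {0..1} (\<lambda>t. \<bar>x0 * exp (\<theta>0 * t) + \<epsilon> * y t - x0 * exp (\<theta> * t)\<bar>)" for \<epsilon> \<theta>
    by (intro continuous_intros y)
  have exp_ge: "exp (- \<bar>\<theta>0\<bar>) \<le> exp (\<theta>0 * t)" and exp_le: "exp (\<theta>0 * t) \<le> exp \<bar>\<theta>0\<bar>" if t: "t \<in> {0..1}" for t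
  proof -
    have "\<bar>\<theta>0 * t\<bar> \<le> \<bar>\<theta>0\<bar> * 1" unfolding abs_mult using t by (intro mult_left_mono) auto
    then show "exp (- \<bar>\<theta>0\<bar>) \<le> exp (\<theta>0 * t)" "exp (\<theta>0 * t) \<le> exp \<bar>\<theta>0\<bar>" by auto
  qed
  \<comment> \<open>Identifiability away from \<theta>0: the distance of the noiseless paths is at
    most the criterion plus the size of the noise.\<close>
  have lower: "c * (\<bar>d\<bar> / (1 + \<bar>d\<bar>)) \<le> \<phi> \<epsilon> (\<theta>0 + d) + \<epsilon> * K" if "\<epsilon> > 0" for d \<epsilon>
  proof -
    have "integral {0..1} (\<lambda>t. t * (2 * c * (\<bar>d\<bar> / (1 + \<bar>d\<bar>)))) \<le>
        integral {0..1} (\<lambda>t. \<bar>x0 * exp (\<theta>0 * t) + \<epsilon> * y t - x0 * exp ((\<theta>0 + d) * t)\<bar> + \<epsilon> * \<bar>y t\<bar>)"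
    proof (rule integral_le)
      show "(\<lambda>t. t * (2 * c * (\<bar>d\<bar> / (1 + \<bar>d\<bar>)))) integrable_on {0..1}"
        by (intro integrable_continuous_interval continuous_intros)
      show "(\<lambda>t. \<bar>x0 * exp (\<theta>0 * t) + \<epsilon> * y t - x0 * exp ((\<theta>0 + d) * t)\<bar> + \<epsilon> * \<bar>y t\<bar>) integrable_on {0..1}"
        by (intro integrable_continuous_interval continuous_intros y)
      fix t :: real assume t: "t \<in> {0..1}"
      have "t * (\<bar>d\<bar> / (1 + \<bar>d\<bar>)) \<le> \<bar>d * t\<bar> / (1 + \<bar>d * t\<bar>)"
      proof -
        have "\<bar>d * t\<bar> / (1 + \<bar>d\<bar>) \<le> \<bar>d * t\<bar> / (1 + \<bar>d * t\<bar>)"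
          using t mult_left_mono[of t 1 "\<bar>d\<bar>"] by (intro divide_left_mono) (auto simp: abs_mult intro!: mult_pos_pos add_pos_nonneg)
        then show ?thesis using t by (simp add: abs_mult mult.commute)
      qed
      also have "\<dots> \<le> \<bar>exp (d * t) - 1\<bar>" by (rule exp_minus_one_lower)
      finally have ratio: "t * (\<bar>d\<bar> / (1 + \<bar>d\<bar>)) \<le> \<bar>exp (d * t) - 1\<bar>" .
      have "2 * c = \<bar>x0\<bar> * exp (- \<bar>\<theta>0\<bar>)" by (simp add: c_def)
      also have "\<dots> \<le> \<bar>x0\<bar> * exp (\<theta>0 * t)" using exp_ge[OF t] by (simp add: mult_left_mono)
      finally have "2 * c * (t * (\<bar>d\<bar> / (1 + \<bar>d\<bar>))) \<le> (\<bar>x0\<bar> * exp (\<theta>0 * t)) * \<bar>exp (d * t) - 1\<bar>"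
        by (rule mult_mono[OF _ ratio]) (use t in auto)
      also have "\<dots> = \<bar>x0 * exp (\<theta>0 * t) - x0 * exp ((\<theta>0 + d) * t)\<bar>"
      proof -
        have "x0 * exp (\<theta>0 * t) - x0 * exp ((\<theta>0 + d) * t) = - (x0 * exp (\<theta>0 * t) * (exp (d * t) - 1))"
          by (simp add: algebra_simps exp_add)
        then show ?thesis by (simp add: abs_mult)
      qed
      also have "\<dots> \<le> \<bar>x0 * exp (\<theta>0 * t) + \<epsilon> * y t - x0 * exp ((\<theta>0 + d) * t)\<bar> + \<bar>\<epsilon> * y t\<bar>"
        by (rule order_trans[OF _ abs_triangle_ineq4]) simp
      also have "\<bar>\<epsilon> * y t\<bar> = \<epsilon> * \<bar>y t\<bar>" using that by (simp add: abs_mult)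
      finally show "t * (2 * c * (\<bar>d\<bar> / (1 + \<bar>d\<bar>))) \<le>
          \<bar>x0 * exp (\<theta>0 * t) + \<epsilon> * y t - x0 * exp ((\<theta>0 + d) * t)\<bar> + \<epsilon> * \<bar>y t\<bar>"
        by (simp only: mult_ac)
    qed
    also have "\<dots> = \<phi> \<epsilon> (\<theta>0 + d) + \<epsilon> * K"
      unfolding \<phi>_def K_def
      by (subst integral_add) (auto intro!: integrable_continuous_interval continuous_intros y)
    also have "integral {0..1} (\<lambda>t. t * (2 * c * (\<bar>d\<bar> / (1 + \<bar>d\<bar>)))) = c * (\<bar>d\<bar> / (1 + \<bar>d\<bar>))"
      using integral_ident[of 0 "1::real"] by (subst integral_mult_left) simp
    finally show ?thesis .
  qed
  \<comment> \<open>Expanding the exponential to first order in the parameter, the factor \<epsilon>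
    comes out of the absolute value and leaves the linear criterion; the remainder is
    quadratic.\<close>
  have approx: "\<bar>\<phi> \<epsilon> (\<theta>0 + \<epsilon> * u) - \<epsilon> * f u\<bar> \<le> B * \<epsilon>\<^sup>2" if \<epsilon>: "\<epsilon> > 0" "\<epsilon> * C \<le> 1" and u: "\<bar>u\<bar> \<le> C" for \<epsilon> u
  proof -
    have "\<epsilon> * f u = integral {0..1} (\<lambda>t. \<epsilon> * \<bar>y t - u * g t\<bar>)" by (simp add: L1_distance_def)
    moreover have "\<bar>\<phi> \<epsilon> (\<theta>0 + \<epsilon> * u) - integral {0..1} (\<lambda>t. \<epsilon> * \<bar>y t - u * g t\<bar>)\<bar> \<le> integral {0..1} (\<lambda>t::real. B * \<epsilon>\<^sup>2)"
      unfolding \<phi>_def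
    proof (rule integral_abs_diff_le)
      fix t :: real assume t: "t \<in> {0..1}"
      let ?x = "\<epsilon> * u * t"
      have ut: "\<bar>u * t\<bar> \<le> C" 
        using mult_mono[OF u, of "\<bar>t\<bar>" 1] C t by (simp add: abs_mult)
      have x: "\<bar>?x\<bar> \<le> 1"
      proof -
        have "\<bar>?x\<bar> = \<epsilon> * \<bar>u * t\<bar>" using \<epsilon> by (simp add: abs_mult)
        also have "\<dots> \<le> \<epsilon> * C" using ut \<epsilon> by (intro mult_left_mono) auto
        finally show ?thesis using \<epsilon> by simp
      qed
      have x2: "?x\<^sup>2 \<le> C\<^sup>2 * \<epsilon>\<^sup>2"
      proof -
        have "(u * t)\<^sup>2 \<le> C\<^sup>2" using ut by (simp add: abs_le_square_iff[symmetric])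
        then have "\<epsilon>\<^sup>2 * (u * t)\<^sup>2 \<le> \<epsilon>\<^sup>2 * C\<^sup>2" by (intro mult_left_mono) auto
        then show ?thesis by (simp add: power_mult_distrib mult_ac)
      qed
      have "\<bar>\<bar>x0 * exp (\<theta>0 * t) + \<epsilon> * y t - x0 * exp ((\<theta>0 + \<epsilon> * u) * t)\<bar> - \<epsilon> * \<bar>y t - u * g t\<bar>\<bar> =
          \<bar>\<bar>x0 * exp (\<theta>0 * t) + \<epsilon> * y t - x0 * exp ((\<theta>0 + \<epsilon> * u) * t)\<bar> - \<bar>\<epsilon> * (y t - u * g t)\<bar>\<bar>"
        using \<epsilon> by (simp add: abs_mult)
      also have "\<dots> \<le> \<bar>(x0 * exp (\<theta>0 * t) + \<epsilon> * y t - x0 * exp ((\<theta>0 + \<epsilon> * u) * t)) - \<epsilon> * (y t - u * g t)\<bar>"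
        by (rule abs_triangle_ineq3)
      also have "(x0 * exp (\<theta>0 * t) + \<epsilon> * y t - x0 * exp ((\<theta>0 + \<epsilon> * u) * t)) - \<epsilon> * (y t - u * g t) =
          - (x0 * exp (\<theta>0 * t) * (exp ?x - 1 - ?x))"
        by (simp add: algebra_simps exp_add g_def)
      also have "\<bar>\<dots>\<bar> = \<bar>x0\<bar> * exp (\<theta>0 * t) * \<bar>exp ?x - 1 - ?x\<bar>" by (simp add: abs_mult)
      also have "\<dots> \<le> \<bar>x0\<bar> * exp \<bar>\<theta>0\<bar> * (C\<^sup>2 * \<epsilon>\<^sup>2)"
        using exp_quadratic_bound[OF x] x2 exp_le[OF t] by (intro mult_mono mult_left_mono) auto
      finally show "\<bar>\<bar>x0 * exp (\<theta>0 * t) + \<epsilon> * y t - x0 * exp ((\<theta>0 + \<epsilon> * u) * t)\<bar> - \<epsilon> * \<bar>y t - u * g t\<bar>\<bar> \<le> B * \<epsilon>\<^sup>2"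
        by (simp add: B_def mult_ac)
    qed (intro continuous_intros y g)+
    moreover have "integral {0..1} (\<lambda>t::real. B * \<epsilon>\<^sup>2) = B * \<epsilon>\<^sup>2" by simp
    ultimately show ?thesis by (simp only:)
  qed
  \<comment> \<open>The four bounds serve, in order, to keep the competitor in \<Theta>, to keep the
    Taylor expansion valid, to absorb the error term in the a priori bound, and to push the
    remainder below the gap \<kappa>. Each added 1 keeps a denominator positive.\<close>
  define \<epsilon>0 where "\<epsilon>0 = Min {r / C, 1 / C, c / (4 * K + 1), \<kappa> / (2 * B + 1)}"
  have "\<epsilon>0 > 0" using r C c K \<kappa> B by (simp add: \<epsilon>0_def)
  moreover have "\<bar>(\<theta> - \<theta>0) / \<epsilon> - ?z\<bar> < \<eta>"
    if \<epsilon>: "0 < \<epsilon>" "\<epsilon> < \<epsilon>0" and \<theta>: "\<theta> \<in> \<Theta>" and min: "\<forall>\<theta>'\<in>\<Theta>. \<phi> \<epsilon> \<theta> \<le> \<phi> \<epsilon> \<theta>'" for \<epsilon> \<theta>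
  proof -
    have lt: "\<epsilon> < r / C" "\<epsilon> < 1 / C" "\<epsilon> < c / (4 * K + 1)" "\<epsilon> < \<kappa> / (2 * B + 1)"
      using \<epsilon>(2) by (auto simp: \<epsilon>0_def)
    have e: "\<epsilon> * C < r" "\<epsilon> * C < 1" "\<epsilon> * (4 * K + 1) < c" "\<epsilon> * (2 * B + 1) < \<kappa>"
      using lt C K B by (simp_all add: pos_less_divide_eq)
    define u where "u = (\<theta> - \<theta>0) / \<epsilon>"
    have \<theta>u: "\<theta> = \<theta>0 + \<epsilon> * u" using \<epsilon> by (simp add: u_def)
    have "\<bar>\<epsilon> * u\<bar> \<le> 4 * K / c * \<epsilon>"
    proof -
      let ?d = "\<bar>\<epsilon> * u\<bar>"
      have "\<theta>0 \<in> \<Theta>" using \<Theta> interior_subset by blast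
      then have "\<phi> \<epsilon> \<theta> \<le> \<phi> \<epsilon> \<theta>0" using min by blast
      also have "\<phi> \<epsilon> \<theta>0 = \<epsilon> * K" using \<epsilon> by (simp add: \<phi>_def K_def abs_mult)
      finally have "c * (?d / (1 + ?d)) \<le> 2 * \<epsilon> * K" using lower[OF \<epsilon>(1), of "\<epsilon> * u"] \<theta>u by simp
      then have "c * ?d \<le> 2 * \<epsilon> * K * (1 + ?d)" by (simp add: pos_divide_le_eq add_pos_nonneg)
      also have "\<dots> = 2 * \<epsilon> * K + 2 * \<epsilon> * K * ?d" by (simp add: algebra_simps)
      \<comment> \<open>Half of \<open>c * ?d\<close> is absorbed into the left side, which doubles
        the constant from 2 to 4.\<close>
      also have "\<dots> \<le> 2 * \<epsilon> * K + c / 2 * ?d"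
        using e(3) \<epsilon> by (intro add_left_mono mult_right_mono) (auto simp: algebra_simps)
      finally have "c * ?d \<le> 4 * \<epsilon> * K" by simp
      then show ?thesis using c by (simp add: field_simps)
    qed
    then have "\<bar>u\<bar> * \<epsilon> \<le> 4 * K / c * \<epsilon>" using \<epsilon> by (simp add: abs_mult mult.commute)
    then have "\<bar>u\<bar> \<le> 4 * K / c" using \<epsilon>(1) by (rule mult_right_le_imp_le)
    then have u: "\<bar>u\<bar> \<le> C" unfolding C_def by linarith
    have z: "\<bar>?z\<bar> \<le> C" unfolding C_def by linarith
    have "\<theta>0 + \<epsilon> * ?z \<in> \<Theta>"
    proof (rule subsetD[OF r(2)])
      have "\<epsilon> * \<bar>?z\<bar> \<le> \<epsilon> * C" using z \<epsilon> by (intro mult_left_mono) auto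
      then have "\<epsilon> * \<bar>?z\<bar> < r" using e(1) by linarith
      then show "\<theta>0 + \<epsilon> * ?z \<in> ball \<theta>0 r" using \<epsilon> by (simp add: dist_real_def abs_mult)
    qed
    then have "\<phi> \<epsilon> \<theta> \<le> \<phi> \<epsilon> (\<theta>0 + \<epsilon> * ?z)" using min by blast
    then have "\<epsilon> * f u \<le> \<epsilon> * f ?z + 2 * (B * \<epsilon>\<^sup>2)"
      using approx[OF \<epsilon>(1) _ u] approx[OF \<epsilon>(1) _ z] e(2) \<theta>u by simp
    then have "\<epsilon> * f u \<le> \<epsilon> * (f ?z + 2 * B * \<epsilon>)" by (simp add: algebra_simps power2_eq_square)
    then have "f u \<le> f ?z + 2 * B * \<epsilon>" using \<epsilon> by simp
    also have "2 * B * \<epsilon> < \<kappa>" using e(4) \<epsilon> by (simp add: algebra_simps)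
    finally show ?thesis using \<kappa>(2)[of u] by (simp add: u_def)
  qed
  ultimately show ?thesis by blast
qed

section \<open>Convergence of the estimator\<close>

lemma (in prob_space) tendsto_measure_of_AE:
  assumes V [measurable]: "\<And>n. V n \<in> borel_measurable M" and \<xi> [measurable]: "\<xi> \<in> borel_measurable M"
    and lim: "AE \<omega> in M. (\<lambda>n. V n \<omega>) \<longlonglongrightarrow> (\<xi> \<omega> :: real)" and \<eta>: "\<eta> > 0"
  shows "(\<lambda>n. measure M {\<omega> \<in> space M. \<bar>V n \<omega> - \<xi> \<omega>\<bar> > \<eta>}) \<longlonglongrightarrow> 0"
proof -
  let ?A = "\<lambda>n. {\<omega> \<in> space M. \<bar>V n \<omega> - \<xi> \<omega>\<bar> > \<eta>}"
  have "(\<lambda>n. \<integral>\<omega>. indicator (?A n) \<omega> \<partial>M) \<longlonglongrightarrow> (\<integral>\<omega>. 0 \<partial>M :: real)"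
  proof (rule integral_dominated_convergence[where w = "\<lambda>_. 1"])
    show "AE \<omega> in M. (\<lambda>n. indicator (?A n) \<omega> :: real) \<longlonglongrightarrow> 0"
      using lim
    proof eventually_elim
      case (elim \<omega>)
      have "\<forall>\<^sub>F n in sequentially. dist (V n \<omega>) (\<xi> \<omega>) < \<eta>" by (rule tendstoD[OF elim \<eta>])
      then have "\<forall>\<^sub>F n in sequentially. indicator (?A n) \<omega> = (0 :: real)"
        by eventually_elim (simp add: dist_real_def indicator_def)
      then show ?case by (rule tendsto_eventually)
    qed
  qed (auto simp: indicator_def)
  then show ?thesis by simp
qed

lemma L1_distance_measurable:
  assumes "\<And>t. t \<in> {0..1} \<Longrightarrow> Y t \<in> borel_measurable M"
    and "\<And>\<omega>. \<omega> \<in> space M \<Longrightarrow> continuous_on {0..1} (\<lambda>t. Y t \<omega>)" "continuous_on {0..1} g"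
  shows "(\<lambda>\<omega>. L1_distance (\<lambda>t. Y t \<omega>) g u) \<in> borel_measurable M"
  unfolding L1_distance_def
proof (rule borel_measurable_integral_continuous)
  show "(\<lambda>\<omega>. \<bar>Y s \<omega> - u * g s\<bar>) \<in> borel_measurable M" if "s \<in> {0..1}" for s
    using assms(1)[OF that] by (intro borel_measurable_abs borel_measurable_diff borel_measurable_const)
  show "continuous_on {0..1} (\<lambda>s. \<bar>Y s \<omega> - u * g s\<bar>)" if "\<omega> \<in> space M" for \<omega>
    by (intro continuous_intros assms that)
qed

text \<open>The rational characterization writes each sublevel set of the minimizer as a countable
  union of measurable comparisons.\<close>

lemma L1_minimizer_measurable:
  assumes "\<And>t. t \<in> {0..1} \<Longrightarrow> Y t \<in> borel_measurable M"
    and "\<And>\<omega>. \<omega> \<in> space M \<Longrightarrow> L1_line (\<lambda>t. Y t \<omega>) g"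
  shows "(\<lambda>\<omega>. L1_line.minimizer (\<lambda>t. Y t \<omega>) g) \<in> borel_measurable M"
\<comment> \<open>Continuity of \<open>g\<close> is known only through some sample point, so an
  empty space is treated apart.\<close>
proof (cases "space M = {}")
  case True
  then show ?thesis by (simp add: measurable_def)
next
  case False
  then have g: "continuous_on {0..1} g" using assms(2) L1_line.g by blast
  show ?thesis
    unfolding borel_measurable_iff_less
  proof
    fix a :: real
    let ?f = "\<lambda>u \<omega>. L1_distance (\<lambda>t. Y t \<omega>) g u"
    have f [measurable]: "?f u \<in> borel_measurable M" for u
      using assms g by (intro L1_distance_measurable) (auto intro: L1_line.y)
    have "{\<omega> \<in> space M. L1_line.minimizer (\<lambda>t. Y t \<omega>) g < a} =
        (\<Union>r\<in>\<rat> \<inter> {..<a}. {\<omega> \<in> space M. ?f r \<omega> < ?f a \<omega>})"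
      using L1_line.minimizer_less_iff[OF assms(2)] by blast
    also have "\<dots> \<in> sets M"
      by (intro sets.countable_UN'' countable_Int1 countable_rat) measurable
    finally show "{\<omega> \<in> space M. L1_line.minimizer (\<lambda>t. Y t \<omega>) g < a} \<in> sets M" .
  qed
qed

lemma L1_line_exponential:
  assumes "continuous_on {0..1} y" "x0 \<noteq> 0"
  shows "L1_line y (\<lambda>t. t * x0 * exp (\<theta> * t))"
proof
  show "continuous_on {0..1} (\<lambda>t. t * x0 * exp (\<theta> * t))" by (intro continuous_intros)
  have c: "continuous_on {0..1} (\<lambda>t. t * exp (\<theta> * t))" by (intro continuous_intros)
  have "integral {0..1} (\<lambda>t. t * exp (\<theta> * t)) \<noteq> 0"
    using integral_eq_0_iff[OF c] by force
  moreover have "integral {0..1} (\<lambda>t. t * x0 * exp (\<theta> * t)) = x0 * integral {0..1} (\<lambda>t. t * exp (\<theta> * t))"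
    unfolding integral_mult_right[symmetric] by (simp add: mult_ac)
  ultimately show "integral {0..1} (\<lambda>t. t * x0 * exp (\<theta> * t)) \<noteq> 0" using assms(2) by simp
qed (use assms in auto)

theorem theorem5p1:
  fixes M :: "'a measure"
    and W :: "(real \<Rightarrow> real) \<Rightarrow> 'a \<Rightarrow> real"
    and q :: nat and H :: real
    and \<Theta> :: "real set" and \<theta>0 x0 :: real
    and Z J Y :: "real \<Rightarrow> 'a \<Rightarrow> real"
    and X :: "real \<Rightarrow> real \<Rightarrow> 'a \<Rightarrow> real"
    and \<theta>hat :: "real \<Rightarrow> 'a \<Rightarrow> real"
    and \<zeta> :: "'a \<Rightarrow> real"
  assumes "prob_space M" and "isonormal M W"
    and "q \<ge> 1" and "1/2 < H" and "H < 1"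
    and "hermite_process_on M W q H {0..1} Z"
    and "\<theta>0 \<in> interior \<Theta>"
    and "\<And>\<delta>. \<delta> > 0 \<Longrightarrow>
      (INF \<theta>\<in>{\<theta>. \<bar>\<theta> - \<theta>0\<bar> > \<delta>}. LBINT t:{0..1}. \<bar>x0 * exp (\<theta> * t) - x0 * exp (\<theta>0 * t)\<bar>) > 0"
    and "\<And>\<epsilon> t. \<epsilon> > 0 \<Longrightarrow> t \<in> {0..1} \<Longrightarrow> X \<epsilon> t \<in> borel_measurable M"
    and "\<And>\<epsilon>. \<epsilon> > 0 \<Longrightarrow> AE \<omega> in M. continuous_on {0..1} (\<lambda>t. X \<epsilon> t \<omega>) \<and>
      (\<forall>t\<in>{0..1}. X \<epsilon> t \<omega> = x0 + \<theta>0 * (LBINT s:{0..t}. X \<epsilon> s \<omega>) + \<epsilon> * Z t \<omega>)"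
    and "\<And>\<epsilon>. \<epsilon> > 0 \<Longrightarrow> \<theta>hat \<epsilon> \<in> borel_measurable M"
    and "\<And>\<epsilon> \<omega>. \<epsilon> > 0 \<Longrightarrow> \<omega> \<in> space M \<Longrightarrow> \<theta>hat \<epsilon> \<omega> \<in> \<Theta>"
    and "\<And>\<epsilon>. \<epsilon> > 0 \<Longrightarrow> AE \<omega> in M.
      (LBINT t:{0..1}. \<bar>X \<epsilon> t \<omega> - x0 * exp (\<theta>hat \<epsilon> \<omega> * t)\<bar>) =
      (INF \<theta>\<in>\<Theta>. LBINT t:{0..1}. \<bar>X \<epsilon> t \<omega> - x0 * exp (\<theta> * t)\<bar>)"
    and "\<And>t. t \<in> {0..1} \<Longrightarrow>
      hermite_wiener_integral M W q H (\<lambda>s. exp (- \<theta>0 * s) * indicator {0..t} s) (J t)"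
    and "\<And>t \<omega>. t \<in> {0..1} \<Longrightarrow> \<omega> \<in> space M \<Longrightarrow> Y t \<omega> = exp (\<theta>0 * t) * J t \<omega>"
    and "\<And>\<omega>. \<omega> \<in> space M \<Longrightarrow> continuous_on {0..1} (\<lambda>t. Y t \<omega>)"
    and "\<And>\<omega>. \<omega> \<in> space M \<Longrightarrow>
      \<zeta> \<omega> = arg_min (\<lambda>u. LBINT t:{0..1}. \<bar>Y t \<omega> - u * t * x0 * exp (\<theta>0 * t)\<bar>) (\<lambda>u. True)"
  shows "(\<forall>\<omega>\<in>space M. \<exists>!u.
        is_arg_min (\<lambda>u. LBINT t:{0..1}. \<bar>Y t \<omega> - u * t * x0 * exp (\<theta>0 * t)\<bar>) (\<lambda>u. True) u) \<and>
      \<zeta> \<in> borel_measurable M \<and>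
      (\<exists>\<xi>\<in>borel_measurable M.
        tendsto_in_probability M (\<lambda>\<epsilon> \<omega>. (\<theta>hat \<epsilon> \<omega> - \<theta>0) / \<epsilon>) \<xi> (at_right 0) \<and>
        distr M borel \<xi> = distr M borel \<zeta>)"
proof -
  note P = assms(1) and W = assms(2) and H = assms(5) and Z = assms(6) and \<Theta> = assms(7) and sep = assms(8)
    and Xeq = assms(10) and \<theta>m = assms(11) and \<theta>\<Theta> = assms(12) and \<theta>min = assms(13)
    and J = assms(14) and YJ = assms(15) and Yc = assms(16) and \<zeta> = assms(17)
  interpret prob_space M by (rule P)
  \<comment> \<open>For \<open>x0 = 0\<close> all the paths coincide, and the infimum over the
    nonempty set of distant parameters would be 0.\<close>
  have x0: "x0 \<noteq> 0"
  proof
    assume "x0 = 0"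
    moreover have "{\<theta>. 1 < \<bar>\<theta> - \<theta>0\<bar>} \<noteq> {}" by (auto intro!: exI[of _ "\<theta>0 + 2"])
    ultimately show False using sep[of 1] by simp
  qed
  define g where "g t = t * x0 * exp (\<theta>0 * t)" for t
  have line: "L1_line (\<lambda>t. Y t \<omega>) g" if "\<omega> \<in> space M" for \<omega>
    unfolding g_def by (intro L1_line_exponential Yc that x0)
  have dist: "(LBINT t:{0..1}. \<bar>Y t \<omega> - u * t * x0 * exp (\<theta>0 * t)\<bar>) = L1_distance (\<lambda>t. Y t \<omega>) g u"
    if "\<omega> \<in> space M" for \<omega> u
    by (subst set_lebesgue_integral_continuous)
      (auto intro!: continuous_intros Yc that simp: L1_distance_def g_def mult.assoc)
  let ?min = "\<lambda>\<omega>. L1_line.minimizer (\<lambda>t. Y t \<omega>) g"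
  \<comment> \<open>A single value satisfies the predicate, so the choice made by
    \<open>arg_min\<close> is determined and agrees with the measurable minimizer.\<close>
  have arg: "is_arg_min (\<lambda>u. LBINT t:{0..1}. \<bar>Y t \<omega> - u * t * x0 * exp (\<theta>0 * t)\<bar>) (\<lambda>u. True) u \<longleftrightarrow> u = ?min \<omega>"
    if "\<omega> \<in> space M" for \<omega> u
    using L1_line.minimizer_le[OF line[OF that]] L1_line.minimizer_eq[OF line[OF that]]
    by (auto simp: is_arg_min_linorder dist[OF that])
  have \<zeta>min: "\<zeta> \<omega> = ?min \<omega>" if "\<omega> \<in> space M" for \<omega>
    unfolding \<zeta>[OF that] arg_min_def arg[OF that] by simp
  have Ym: "Y t \<in> borel_measurable M" if t: "t \<in> {0..1}" for t
  proof -
    obtain I where "I \<in> borel_measurable M" and JI: "\<And>\<omega>. \<omega> \<in> space M \<Longrightarrow> J t \<omega> = hermite_const q H * I \<omega>"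
      using J[OF t] unfolding hermite_wiener_integral_def multiple_wiener_integral_def by blast
    then have "(\<lambda>\<omega>. exp (\<theta>0 * t) * (hermite_const q H * I \<omega>)) \<in> borel_measurable M" by measurable
    then show ?thesis by (subst measurable_cong) (simp_all add: YJ[OF t] JI)
  qed
  have \<zeta>m [measurable]: "\<zeta> \<in> borel_measurable M"
    by (subst measurable_cong[OF \<zeta>min]) (auto intro: L1_minimizer_measurable Ym line)
  have "tendsto_in_probability M (\<lambda>\<epsilon> \<omega>. (\<theta>hat \<epsilon> \<omega> - \<theta>0) / \<epsilon>) \<zeta> (at_right 0)"
    unfolding tendsto_in_probability_def tendsto_at_iff_sequentially comp_def
  \<comment> \<open>Along a sequence of noise levels the equation and the minimization property hold
    simultaneously outside one null set, and almost sure convergence gives convergence in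
    probability.\<close>
  proof (intro allI impI)
    fix \<eta> :: real and e :: "nat \<Rightarrow> real"
    assume \<eta>: "\<eta> > 0" and "\<forall>n. e n \<in> {0<..} - {0}" and e0: "e \<longlonglongrightarrow> 0"
    then have e: "e n > 0" for n by auto
    show "(\<lambda>n. measure M {\<omega> \<in> space M. \<bar>(\<theta>hat (e n) \<omega> - \<theta>0) / e n - \<zeta> \<omega>\<bar> > \<eta>}) \<longlonglongrightarrow> 0"
    proof (rule tendsto_measure_of_AE[OF _ \<zeta>m _ \<eta>])
      show "(\<lambda>\<omega>. (\<theta>hat (e n) \<omega> - \<theta>0) / e n) \<in> borel_measurable M" for n
        using \<theta>m[OF e] by measurable
      have "AE \<omega> in M. \<forall>n. continuous_on {0..1} (\<lambda>t. X (e n) t \<omega>) \<and>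
          (\<forall>t\<in>{0..1}. X (e n) t \<omega> = x0 + \<theta>0 * (LBINT s:{0..t}. X (e n) s \<omega>) + e n * Z t \<omega>)"
        unfolding AE_all_countable using Xeq[OF e] by blast
      moreover have "AE \<omega> in M. \<forall>n. (LBINT t:{0..1}. \<bar>X (e n) t \<omega> - x0 * exp (\<theta>hat (e n) \<omega> * t)\<bar>) =
          (INF \<theta>\<in>\<Theta>. LBINT t:{0..1}. \<bar>X (e n) t \<omega> - x0 * exp (\<theta> * t)\<bar>)"
        unfolding AE_all_countable using \<theta>min[OF e] by blast
      moreover have "AE \<omega> in M. \<forall>t\<in>{0..1}. Y t \<omega> =
          Z t \<omega> + \<theta>0 * exp (\<theta>0 * t) * integral {0..t} (\<lambda>s. exp (- \<theta>0 * s) * Z s \<omega>)"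
        using J YJ Yc by (rule fractional_ornstein_uhlenbeck[OF P W H Z])
      ultimately show "AE \<omega> in M. (\<lambda>n. (\<theta>hat (e n) \<omega> - \<theta>0) / e n) \<longlonglongrightarrow> \<zeta> \<omega>"
        using AE_space
      proof eventually_elim
        case (elim \<omega>)
        define \<phi> where "\<phi> \<epsilon> \<theta> = integral {0..1} (\<lambda>t. \<bar>x0 * exp (\<theta>0 * t) + \<epsilon> * Y t \<omega> - x0 * exp (\<theta> * t)\<bar>)" for \<epsilon> \<theta>
        have Zc: "continuous_on {0..1} (\<lambda>t. Z t \<omega>)"
          using Z elim(4) unfolding hermite_process_on_def by blast
        have X: "X (e n) t \<omega> = x0 * exp (\<theta>0 * t) + e n * Y t \<omega>" if t: "t \<in> {0..1}" for n t
          using perturbed_linear_equation[where X = "\<lambda>t. X (e n) t \<omega>" and z = "\<lambda>t. Z t \<omega>", OF _ Zc _ t]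
            elim(1,3) t by simp
        have \<phi>: "(LBINT t:{0..1}. \<bar>X (e n) t \<omega> - x0 * exp (\<theta> * t)\<bar>) = \<phi> (e n) \<theta>" for n \<theta>
        proof -
          have "(LBINT t:{0..1}. \<bar>X (e n) t \<omega> - x0 * exp (\<theta> * t)\<bar>) = integral {0..1} (\<lambda>t. \<bar>X (e n) t \<omega> - x0 * exp (\<theta> * t)\<bar>)"
            using elim(1) by (intro set_lebesgue_integral_continuous continuous_intros) auto
          also have "\<dots> = \<phi> (e n) \<theta>"
            unfolding \<phi>_def by (intro Henstock_Kurzweil_Integration.integral_cong) (simp add: X)
          finally show ?thesis .
        qed
        \<comment> \<open>A real infimum is a lower bound only when the set is bounded
          below.\<close>
        have "0 \<le> \<phi> \<epsilon> \<theta>" for \<epsilon> \<theta>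
          unfolding \<phi>_def
          by (intro integral_nonneg integrable_continuous_interval continuous_intros Yc elim(4)) auto
        then have "bdd_below (\<phi> \<epsilon> ` \<Theta>)" for \<epsilon> by (intro bdd_belowI[of _ 0]) auto
        then have min: "\<phi> (e n) (\<theta>hat (e n) \<omega>) \<le> \<phi> (e n) \<theta>'" if "\<theta>' \<in> \<Theta>" for n \<theta>'
          using elim(2) that unfolding \<phi> by (simp add: cINF_lower)
        show ?case
        proof (rule tendstoI)
          fix \<delta> :: real assume "\<delta> > 0"
          \<comment> \<open>The threshold depends on the sample point, which is harmless for
            convergence at that point.\<close>
          from minimum_L1_norm_estimate[OF line[OF elim(4), unfolded g_def[abs_def]] x0 \<Theta> this]
          obtain \<epsilon>0 where \<epsilon>0: "\<epsilon>0 > 0" "\<And>\<epsilon> \<theta>. 0 < \<epsilon> \<Longrightarrow> \<epsilon> < \<epsilon>0 \<Longrightarrow> \<theta> \<in> \<Theta> \<Longrightarrow>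
              (\<And>\<theta>'. \<theta>' \<in> \<Theta> \<Longrightarrow> \<phi> \<epsilon> \<theta> \<le> \<phi> \<epsilon> \<theta>') \<Longrightarrow> \<bar>(\<theta> - \<theta>0) / \<epsilon> - ?min \<omega>\<bar> < \<delta>"
            unfolding \<phi>_def[symmetric] g_def[abs_def, symmetric] by blast
          have "\<forall>\<^sub>F n in sequentially. e n < \<epsilon>0" by (rule order_tendstoD(2)[OF e0 \<epsilon>0(1)])
          then show "\<forall>\<^sub>F n in sequentially. dist ((\<theta>hat (e n) \<omega> - \<theta>0) / e n) (\<zeta> \<omega>) < \<delta>"
          proof eventually_elim
            case (elim n)
            then show ?case
              using \<epsilon>0(2)[OF e _ \<theta>\<Theta>[OF e] min] \<open>\<omega> \<in> space M\<close> by (simp add: dist_real_def \<zeta>min)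
          qed
        qed
      qed
    qed
  qed
  then show ?thesis
    using \<zeta>m by (intro conjI ballI bexI[of _ \<zeta>]) (simp_all add: arg)
qed

end
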